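(* For all integers $r$, $d$ and $g$ satisfying $r\geq 1$, $d\leq r+g-2$ and $d-2r\geq 0$ there exists a metric graph $\Gamma$ of genus $g$ such that $\Gamma$ has a free divisor $D$ of degree $d$ with $\operatorname{rk}(D)=r$.
   Context: A metric graph $\Gamma$ is a compact connected metric space such that each point $P\in\Gamma$ has, for some integer $n\geq 1$, a neighbourhood isometric (with the path metric) to the star $\{te^{2k\pi i/n} : t\in[0,\rho],\ k\in\mathbb{Z}\}\subset\mathbb{C}$ for some $\rho>0$, with $P$ corresponding to $0$; the valence is $\operatorname{val}(P)=n$. Vertices are the points with $\operatorname{val}(P)\neq 2$; $V(\Gamma)$ is the set of vertices, and the edges are the connected components of $\Gamma\setminus V(\Gamma)$; $E(\Gamma)$ is the set of (closed) edges. The genus of $\Gamma$ is $g(\Gamma)=|E(\Gamma)|-|V(\Gamma)|+1$ (the first Betti number; a circle, which has no vertices, has genus $1$). A divisor on $\Gamma$ is a finite formal sum $D=\sum_{P\in\Gamma}n_P P$ with $n_P\in\mathbb{Z}$; its degree is $\sum_P n_P$; it is effective if all $n_P\geq 0$. A divisor contains an effective divisor $E$ if subtracting $E$ leaves an effective divisor. A rational function on $\Gamma$ is a continuous function $f:\Gamma\to\mathbb{R}$ that is piecewise affine (finitely many pieces) with integer slopes on the edges; $\operatorname{div}(f)=\sum_P \operatorname{div}(f)(P)\,P$, where $\operatorname{div}(f)(P)$ is the sum of the slopes of $f$ in all directions emanating from $P$. Divisors $D_1,D_2$ are linearly equivalent if $D_2-D_1=\operatorname{div}(f)$ for some rational function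 $f$. The rank $\operatorname{rk}(D)$ is $-1$ if $D$ is not linearly equivalent to an effective divisor; otherwise it is the maximal integer $r\ge 0$ such that for each effective divisor $E$ of degree $r$ on $\Gamma$ there is an effective divisor $D'$ linearly equivalent to $D$ and containing $E$. An effective divisor $D$ on $\Gamma$ is called free if $\operatorname{rk}(D-P)<\operatorname{rk}(D)$ for all $P\in\Gamma$. *)

theory Defs
  imports "HOL-Analysis.Analysis" "HOL-Library.Poly_Mapping"
begin

section \<open>Path metrics and stars\<close>

definition curve_length :: "(real \<Rightarrow> 'a::metric_space) \<Rightarrow> ereal" where
  "curve_length \<gamma> =
     (SUP ts \<in> {ts. sorted ts \<and> set ts \<subseteq> {0..1}}.
        ereal (\<Sum>i<length ts - 1. dist (\<gamma> (ts ! i)) (\<gamma> (ts ! Suc i))))"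

definition path_metric :: "'a::metric_space set \<Rightarrow> 'a \<Rightarrow> 'a \<Rightarrow> ereal" where
  "path_metric S x y =
     (INF \<gamma> \<in> {\<gamma>. path \<gamma> \<and> path_image \<gamma> \<subseteq> S \<and> pathstart \<gamma> = x \<and> pathfinish \<gamma> = y}.
        curve_length \<gamma>)"

definition ray_point :: "nat \<Rightarrow> int \<Rightarrow> real \<Rightarrow> complex" where
  "ray_point n k t = of_real t * exp (2 * of_int k * of_real pi * \<i> / of_nat n)"

definition star :: "nat \<Rightarrow> real \<Rightarrow> complex set" where
  "star n \<rho> = {ray_point n k t | t k. t \<in> {0..\<rho>}}"

subsection \<open>The path metric of a star, explicitly\<close>

lemma curve_length_le:
  assumes "\<And>a b. 0 \<le> a \<Longrightarrow> a \<le> b \<Longrightarrow> b \<le> 1 \<Longrightarrow> dist (\<gamma> a) (\<gamma> b) \<le> h b - h a"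
  shows "curve_length \<gamma> \<le> ereal (h 1 - h 0)"
  unfolding curve_length_def
proof (rule SUP_least, clarify)
  fix ts :: "real list" assume ts: "sorted ts" "set ts \<subseteq> {0..1}"
  have mono: "h a \<le> h b" if "0 \<le> a" "a \<le> b" "b \<le> 1" for a b
    using assms[OF that] zero_le_dist[of "\<gamma> a" "\<gamma> b"] by linarith
  show "ereal (\<Sum>i<length ts - 1. dist (\<gamma> (ts ! i)) (\<gamma> (ts ! Suc i))) \<le> ereal (h 1 - h 0)"
  proof (cases "ts = []")
    case True
    then show ?thesis using mono[of 0 1] by simp
  next
    case False
    have rng: "ts ! i \<in> {0..1}" if "i < length ts" for i
      using ts(2) that nth_mem by blast
    have "(\<Sum>i<length ts - 1. dist (\<gamma> (ts ! i)) (\<gamma> (ts ! Suc i)))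
            \<le> (\<Sum>i<length ts - 1. h (ts ! Suc i) - h (ts ! i))"
    proof (rule sum_mono)
      fix i assume "i \<in> {..<length ts - 1}"
      then have i: "Suc i < length ts" by auto
      show "dist (\<gamma> (ts ! i)) (\<gamma> (ts ! Suc i)) \<le> h (ts ! Suc i) - h (ts ! i)"
        using rng[of i] rng[of "Suc i"] i sorted_nth_mono[OF ts(1), of i "Suc i"]
        by (intro assms) auto
    qed
    also have "\<dots> = h (ts ! (length ts - 1)) - h (ts ! 0)"
      by (rule sum_lessThan_telescope)
    also have "\<dots> \<le> h 1 - h 0"
      using rng[of 0] rng[of "length ts - 1"] False
        mono[of 0 "ts ! 0"] mono[of "ts ! (length ts - 1)" 1] by auto
    finally show ?thesis by simp
  qed
qed

lemma curve_length_ge: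
  assumes "u \<in> {0..1}"
  shows "ereal (dist (\<gamma> 0) (\<gamma> u) + dist (\<gamma> u) (\<gamma> 1)) \<le> curve_length \<gamma>"
  unfolding curve_length_def using assms
  by (intro SUP_upper2[of "[0, u, 1]"]) (auto simp: numeral_2_eq_2)

lemma ray_point_cis: "ray_point n k t = of_real t * cis (2 * of_int k * pi / of_nat n)"
  by (simp add: ray_point_def cis_conv_exp mult_ac)

lemma norm_ray_point: "norm (ray_point n k t) = \<bar>t\<bar>"
  by (simp add: ray_point_cis norm_mult)

lemma sgn_ray_point: "t > 0 \<Longrightarrow> sgn (ray_point n k t) = ray_point n k 1"
  by (simp add: sgn_div_norm norm_ray_point) (simp add: ray_point_cis field_simps scaleR_conv_of_real)

lemma scaleR_ray_point: "a *\<^sub>R ray_point n k t = ray_point n k (a * t)"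
  by (simp add: ray_point_cis scaleR_conv_of_real)

lemma finite_ray_directions:
  assumes "n \<ge> 1"
  shows "finite (range (\<lambda>k. ray_point n k 1))"
proof (rule finite_subset)
  have "ray_point n k 1 ^ n = 1" for k :: int
  proof -
    have "ray_point n k 1 ^ n = cis (2 * pi * of_int k)"
      using assms
      by (simp add: ray_point_cis Complex.DeMoivre mult.commute mult.left_commute
            del: cis_multiple_2pi)
    also have "\<dots> = 1"
      by (rule cis_multiple_2pi) simp
    finally show ?thesis .
  qed
  then show "range (\<lambda>k. ray_point n k 1) \<subseteq> {z. z ^ n = 1}" by auto
  show "finite {z::complex. z ^ n = 1}"
    using assms by (intro finite_roots_unity) auto
qed

lemma path_metric_star_aux_le:
  assumes "0 \<le> s" "s \<le> \<rho>" "0 \<le> t" "t \<le> \<rho>"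
  shows "path_metric (star n \<rho>) (ray_point n k s) (ray_point n l t) \<le> ereal (s + t)"
proof -
  let ?z = "ray_point n k s" and ?w = "ray_point n l t"
  define h where "h u = (if u \<le> 1/2 then 2 * u * s else s + (2 * u - 1) * t)" for u :: real
  define \<gamma> where "\<gamma> = linepath ?z 0 +++ linepath 0 ?w"
  have \<gamma>: "\<gamma> u = (if u \<le> 1/2 then (1 - 2 * u) *\<^sub>R ?z else (2 * u - 1) *\<^sub>R ?w)" for u
    by (simp add: \<gamma>_def joinpaths_def linepath_def)
  have "curve_length \<gamma> \<le> ereal (h 1 - h 0)"
  proof (rule curve_length_le)
    fix a b :: real assume ab: "0 \<le> a" "a \<le> b" "b \<le> 1"
    consider "b \<le> 1/2" | "a \<le> 1/2" "1/2 < b" | "1/2 < a" by linarith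
    then show "dist (\<gamma> a) (\<gamma> b) \<le> h b - h a"
    proof cases
      case 1
      have "dist (\<gamma> a) (\<gamma> b) = norm ((2 * (b - a)) *\<^sub>R ?z)"
        using 1 ab by (simp add: \<gamma> dist_norm algebra_simps)
      also have "\<dots> = 2 * (b - a) * s"
        using ab assms by (simp add: norm_ray_point)
      finally show ?thesis using 1 ab by (simp add: h_def algebra_simps)
    next
      case 2
      have "dist (\<gamma> a) (\<gamma> b) \<le> norm (\<gamma> a) + norm (\<gamma> b)"
        by (metis dist_norm norm_triangle_ineq4)
      also have "\<dots> = (1 - 2 * a) * s + (2 * b - 1) * t"
        using 2 assms by (simp add: \<gamma> norm_ray_point)
      finally show ?thesis using 2 by (simp add: h_def algebra_simps)
    next
      case 3
      have "dist (\<gamma> a) (\<gamma> b) = norm ((2 * (a - b)) *\<^sub>R ?w)"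
        using 3 ab by (simp add: \<gamma> dist_norm algebra_simps)
      also have "\<dots> = 2 * (b - a) * t"
        using ab assms by (simp add: norm_ray_point)
      finally show ?thesis using 3 ab by (simp add: h_def algebra_simps)
    qed
  qed
  then have len: "curve_length \<gamma> \<le> ereal (s + t)" by (simp add: h_def)
  have "path_image \<gamma> \<subseteq> star n \<rho>"
  proof
    fix x assume "x \<in> path_image \<gamma>"
    then obtain u where u: "0 \<le> u" "u \<le> 1" "x = \<gamma> u" by (auto simp: path_image_def)
    have "\<bar>(1 - 2 * u) * s\<bar> \<le> 1 * s" "\<bar>(2 * u - 1) * t\<bar> \<le> 1 * t"
      using u assms unfolding abs_mult by (intro mult_mono; simp)+
    then have le: "(1 - 2 * u) * s \<le> \<rho>" "(2 * u - 1) * t \<le> \<rho>"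
      using assms by linarith+
    show "x \<in> star n \<rho>"
    proof (cases "u \<le> 1/2")
      case True
      then have "x = ray_point n k ((1 - 2 * u) * s)" "0 \<le> (1 - 2 * u) * s"
        using u assms by (simp_all add: \<gamma> scaleR_ray_point)
      then show ?thesis using le unfolding star_def by auto
    next
      case False
      then have "x = ray_point n l ((2 * u - 1) * t)" "0 \<le> (2 * u - 1) * t"
        using u assms by (simp_all add: \<gamma> scaleR_ray_point)
      then show ?thesis using le unfolding star_def by auto
    qed
  qed
  then show ?thesis
    unfolding path_metric_def using len
    by (intro INF_lower2[of \<gamma>]) (auto simp: \<gamma>_def)
qed

lemma path_metric_star:
  assumes n: "n \<ge> 1" and st: "0 \<le> s" "s \<le> \<rho>" "0 \<le> t" "t \<le> \<rho>"
  shows "path_metric (star n \<rho>) (ray_point n k s) (ray_point n l t) =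
           ereal (if ray_point n k 1 = ray_point n l 1 then \<bar>s - t\<bar> else s + t)"
    (is "path_metric _ ?z ?w = _")
proof (cases "ray_point n k 1 = ray_point n l 1")
  case True
  have w: "?w = ray_point n k t"
    using True by (simp add: ray_point_cis)
  have d: "dist ?z ?w = \<bar>s - t\<bar>"
  proof -
    have "?z - ?w = ray_point n k (s - t)"
      unfolding w by (simp add: ray_point_cis algebra_simps)
    then show ?thesis by (simp add: dist_norm norm_ray_point)
  qed
  have "path_metric (star n \<rho>) ?z ?w \<le> ereal \<bar>s - t\<bar>"
  proof -
    let ?g = "linepath ?z ?w"
    have "curve_length ?g \<le> ereal (1 * dist ?z ?w - 0 * dist ?z ?w)"
    proof (rule curve_length_le)
      fix a b :: real assume ab: "0 \<le> a" "a \<le> b" "b \<le> 1"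
      have "?g a - ?g b = (b - a) *\<^sub>R (?z - ?w)"
        by (simp add: linepath_def algebra_simps)
      then have "dist (?g a) (?g b) = (b - a) * dist ?z ?w"
        using ab by (simp add: dist_norm)
      then show "dist (?g a) (?g b) \<le> b * dist ?z ?w - a * dist ?z ?w"
        by (simp add: left_diff_distrib)
    qed
    moreover have "path_image ?g \<subseteq> star n \<rho>"
    proof
      fix x assume "x \<in> path_image ?g"
      then obtain u where u: "0 \<le> u" "u \<le> 1" "x = ?g u" by (auto simp: path_image_def)
      have "x = ray_point n k ((1 - u) * s + u * t)"
        unfolding u w by (simp add: linepath_def ray_point_cis scaleR_conv_of_real algebra_simps)
      moreover have "(1 - u) * s + u * t \<le> \<rho>"
        using u st by (intro convex_bound_le) auto
      moreover have "0 \<le> (1 - u) * s + u * t"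
        using u st by simp
      ultimately show "x \<in> star n \<rho>" by (force simp: star_def)
    qed
    ultimately show ?thesis
      unfolding path_metric_def using d by (intro INF_lower2[of ?g]) auto
  qed
  moreover have "ereal \<bar>s - t\<bar> \<le> path_metric (star n \<rho>) ?z ?w"
    unfolding path_metric_def
  proof (rule INF_greatest, clarify)
    fix \<gamma> assume "pathstart \<gamma> = ?z" "pathfinish \<gamma> = ?w"
    then show "ereal \<bar>s - t\<bar> \<le> curve_length \<gamma>"
      using curve_length_ge[of 1 \<gamma>] d by (simp add: pathstart_def pathfinish_def)
  qed
  ultimately show ?thesis using True by simp
next
  case False
  have "ereal (s + t) \<le> path_metric (star n \<rho>) ?z ?w"
    unfolding path_metric_def
  proof (rule INF_greatest, clarify)
    fix \<gamma> assume g: "pathstart \<gamma> = ?z" "pathfinish \<gamma> = ?w" "path \<gamma>" "path_image \<gamma> \<subseteq> star n \<rho>"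
    have "0 \<in> path_image \<gamma>"
    proof (rule ccontr)
      assume 0: "0 \<notin> path_image \<gamma>"
      have zw: "?z \<in> path_image \<gamma>" "?w \<in> path_image \<gamma>"
        using g by (metis pathstart_in_path_image, metis pathfinish_in_path_image)
      have "connected (sgn ` path_image \<gamma>)"
        using 0 by (intro connected_continuous_image connected_path_image g(3) continuous_on_sgn
              continuous_on_id) auto
      moreover have "sgn ` path_image \<gamma> \<subseteq> range (\<lambda>k. ray_point n k 1)"
      proof clarify
        fix x assume x: "x \<in> path_image \<gamma>"
        then obtain r j where "x = ray_point n j r" "0 \<le> r" using g(4) by (auto simp: star_def)
        moreover have "x \<noteq> 0" using x 0 by auto
        ultimately have "r > 0" by (cases "r = 0") (auto simp: ray_point_cis)
        then show "sgn x \<in> range (\<lambda>k. ray_point n k 1)"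
          using \<open>x = _\<close> sgn_ray_point by simp
      qed
      ultimately have "\<exists>c. sgn ` path_image \<gamma> \<subseteq> {c}"
        using connected_finite_iff_sing finite_subset finite_ray_directions[OF n]
        by (metis empty_subsetI order_refl)
      then have "sgn ?z = sgn ?w" using zw by auto
      moreover have "?z \<noteq> 0" "?w \<noteq> 0" using zw 0 by metis+
      then have "s \<noteq> 0" "t \<noteq> 0" by (auto simp: ray_point_cis)
      ultimately show False
        using False st sgn_ray_point[of s n k] sgn_ray_point[of t n l] by simp
    qed
    then obtain u where u: "u \<in> {0..1}" "\<gamma> u = 0" by (auto simp: path_image_def)
    show "ereal (s + t) \<le> curve_length \<gamma>"
      using curve_length_ge[OF u(1), of \<gamma>] u(2) g st
      by (simp add: pathstart_def pathfinish_def norm_ray_point)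
  qed
  then show ?thesis
    using False path_metric_star_aux_le[OF st] by (simp add: antisym)
qed


section \<open>Metric graphs\<close>

text \<open>The map \<open>\<psi>\<close> goes from the star onto a neighbourhood of \<open>P\<close>.\<close>

definition star_chart ::
  "'a metric \<Rightarrow> 'a \<Rightarrow> nat \<Rightarrow> real \<Rightarrow> (complex \<Rightarrow> 'a) \<Rightarrow> bool" where
  "star_chart \<Gamma> P n \<rho> \<psi> \<longleftrightarrow>
     n \<ge> 1 \<and> \<rho> > 0 \<and> \<psi> ` star n \<rho> \<subseteq> mspace \<Gamma> \<and> \<psi> 0 = P \<and>
     (\<forall>z \<in> star n \<rho>. \<forall>w \<in> star n \<rho>. ereal (mdist \<Gamma> (\<psi> z) (\<psi> w)) = path_metric (star n \<rho>) z w) \<and>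
     (\<exists>U. openin (mtopology_of \<Gamma>) U \<and> P \<in> U \<and> U \<subseteq> \<psi> ` star n \<rho>)"

text \<open>\<^const>\<open>connected_space\<close> admits the empty space, hence the non-emptiness condition.\<close>

definition metric_graph :: "'a metric \<Rightarrow> bool" where
  "metric_graph \<Gamma> \<longleftrightarrow>
     mspace \<Gamma> \<noteq> {} \<and> compact_space (mtopology_of \<Gamma>) \<and> connected_space (mtopology_of \<Gamma>) \<and>
     (\<forall>P \<in> mspace \<Gamma>. \<exists>n \<rho> \<psi>. star_chart \<Gamma> P n \<rho> \<psi>)"

definition valence :: "'a metric \<Rightarrow> 'a \<Rightarrow> nat" where
  "valence \<Gamma> P = (THE n. \<exists>\<rho> \<psi>. star_chart \<Gamma> P n \<rho> \<psi>)"

definition vertices :: "'a metric \<Rightarrow> 'a set" where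
  "vertices \<Gamma> = {P \<in> mspace \<Gamma>. valence \<Gamma> P \<noteq> 2}"

definition edges :: "'a metric \<Rightarrow> 'a set set" where
  "edges \<Gamma> = (\<lambda>C. mtopology_of \<Gamma> closure_of C) `
     connected_components_of (subtopology (mtopology_of \<Gamma>) (mspace \<Gamma> - vertices \<Gamma>))"

text \<open>
  A graph without vertices is a circle; it has one edge, so that the formula
  \<open>|E| - |V| + 1\<close> would give 2 instead of its first Betti number 1.
\<close>

definition genus :: "'a metric \<Rightarrow> int" where
  "genus \<Gamma> = (if vertices \<Gamma> = {} then 1
                else int (card (edges \<Gamma>)) - int (card (vertices \<Gamma>)) + 1)"


section \<open>Divisors\<close>

type_synonym 'a divisor = "'a \<Rightarrow>\<^sub>0 int"

definition divisor_on :: "'a metric \<Rightarrow> 'a divisor \<Rightarrow> bool" where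
  "divisor_on \<Gamma> D \<longleftrightarrow> Poly_Mapping.keys D \<subseteq> mspace \<Gamma>"

definition divisor_degree :: "'a divisor \<Rightarrow> int" where
  "divisor_degree D = (\<Sum>P \<in> Poly_Mapping.keys D. Poly_Mapping.lookup D P)"

definition effective :: "'a divisor \<Rightarrow> bool" where
  "effective D \<longleftrightarrow> (\<forall>P. Poly_Mapping.lookup D P \<ge> 0)"

definition contains :: "'a divisor \<Rightarrow> 'a divisor \<Rightarrow> bool" where
  "contains D E \<longleftrightarrow> effective (D - E)"

definition segment :: "'a metric \<Rightarrow> (real \<Rightarrow> 'a) \<Rightarrow> real \<Rightarrow> bool" where
  "segment \<Gamma> \<gamma> L \<longleftrightarrow> L > 0 \<and> \<gamma> ` {0..L} \<subseteq> mspace \<Gamma> \<and>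
     (\<forall>s \<in> {0..L}. \<forall>t \<in> {0..L}. mdist \<Gamma> (\<gamma> s) (\<gamma> t) = \<bar>s - t\<bar>)"

text \<open>
  On every closed edge \<open>f\<close> is affine with integer slope, with respect to arc length, along each of
  finitely many segments covering the edge.
\<close>

definition rational_function :: "'a metric \<Rightarrow> ('a \<Rightarrow> real) \<Rightarrow> bool" where
  "rational_function \<Gamma> f \<longleftrightarrow>
     continuous_map (mtopology_of \<Gamma>) euclideanreal f \<and>
     (\<forall>e \<in> edges \<Gamma>. \<exists>S. finite S \<and> e = (\<Union>(\<gamma>, L) \<in> S. \<gamma> ` {0..L}) \<and>
        (\<forall>(\<gamma>, L) \<in> S. segment \<Gamma> \<gamma> L \<and>
           (\<exists>m::int. \<forall>t \<in> {0..L}. f (\<gamma> t) = f (\<gamma> 0) + of_int m * t)))"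

text \<open>
  The directions emanating from \<open>P\<close> are the \<open>n\<close> rays of a star chart at \<open>P\<close>, and the slope of \<open>f\<close> in
  a direction is the one-sided derivative at \<open>P\<close> along the ray; the sum does not depend on the chart.
\<close>

definition div_coeff :: "'a metric \<Rightarrow> ('a \<Rightarrow> real) \<Rightarrow> 'a \<Rightarrow> int" where
  "div_coeff \<Gamma> f P = (THE m. \<exists>n \<rho> \<psi> slope. star_chart \<Gamma> P n \<rho> \<psi> \<and>
     (\<forall>k<n. ((\<lambda>t. f (\<psi> (ray_point n (int k) t))) has_real_derivative of_int (slope k))
              (at 0 within {0..})) \<and>
     m = (\<Sum>k<n. slope k))"

definition is_div :: "'a metric \<Rightarrow> ('a \<Rightarrow> real) \<Rightarrow> 'a divisor \<Rightarrow> bool" where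
  "is_div \<Gamma> f D \<longleftrightarrow> divisor_on \<Gamma> D \<and>
     (\<forall>P \<in> mspace \<Gamma>. Poly_Mapping.lookup D P = div_coeff \<Gamma> f P)"

definition linearly_equivalent :: "'a metric \<Rightarrow> 'a divisor \<Rightarrow> 'a divisor \<Rightarrow> bool" where
  "linearly_equivalent \<Gamma> D1 D2 \<longleftrightarrow> (\<exists>f. rational_function \<Gamma> f \<and> is_div \<Gamma> f (D2 - D1))"

definition rk :: "'a metric \<Rightarrow> 'a divisor \<Rightarrow> int" where
  "rk \<Gamma> D =
     (if \<not> (\<exists>D'. divisor_on \<Gamma> D' \<and> effective D' \<and> linearly_equivalent \<Gamma> D D') then -1
      else int (GREATEST r. \<forall>E. divisor_on \<Gamma> E \<and> effective E \<and> divisor_degree E = int r \<longrightarrow>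
                  (\<exists>D'. divisor_on \<Gamma> D' \<and> effective D' \<and> linearly_equivalent \<Gamma> D D' \<and>
                        contains D' E)))"

definition free_divisor :: "'a metric \<Rightarrow> 'a divisor \<Rightarrow> bool" where
  "free_divisor \<Gamma> D \<longleftrightarrow> divisor_on \<Gamma> D \<and> effective D \<and>
     (\<forall>P \<in> mspace \<Gamma>. rk \<Gamma> (D - Poly_Mapping.single P 1) < rk \<Gamma> D)"

end

theory Submission
  imports Defs
begin

text \<open>
  Put \<open>k = d - 2r\<close>. The graph is a central circle of length 1 with \<open>g - 1\<close> loops of length 1 attached
  to it, \<open>k\<close> of them at the point \<open>1/3\<close> of the circle \<open>\<real>/\<int>\<close> and the others at the point \<open>0\<close>;
  the hypothesis \<open>d \<le> r + g - 2\<close> says that at least \<open>r + 1\<close> loops are attached at \<open>0\<close>. The divisor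
  consists of the point \<open>0\<close> with multiplicity \<open>2r\<close> and of the midpoints of the \<open>k\<close> loops at \<open>1/3\<close>.

  The divisor theory of such a graph is explicit. It retracts onto each of its \<open>g\<close> circles, which gives
  every point \<open>g\<close> coordinates in \<open>\<real>/\<int>\<close>. Two divisors are linearly equivalent if and only if they
  have the same degree and, for each circle, the same sum of coordinates modulo 1
  (\<open>linearly_equivalent_iff\<close>). For necessity, the slope jumps of a piecewise affine function on one circle
  add up to 0, and weighted with their positions they add up to an integer. For sufficiency, a sum of
  translates of the Green function of a circle has any prescribed admissible jumps, and the divisor of
  the sum over all circles of such functions, each pulled back by a retraction, is the prescribed one.

  Hence a class is a degree \<open>n\<close> with numbers \<open>y\<^sub>0, \<dots>\<close> modulo 1, where \<open>y\<^sub>0\<close> belongs to the central circle.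
  If \<open>y\<^sub>i\<close> is not an integer, an effective divisor of the class has a point inside the loop \<open>i\<close>. So,
  when \<open>N\<close> is the set of these loops, the class is effective if and only if \<open>|N| < n\<close>, or \<open>|N| = n\<close> and
  \<open>y\<^sub>0\<close> is the sum of the attaching points of the loops in \<open>N\<close>
  (\<open>effective_divisor_with_coords\<close>, \<open>nontrivial_loops_of_effective\<close>).

  Rank at least \<open>r\<close>: subtracting \<open>E\<close> of degree \<open>r\<close> leaves degree \<open>r + k\<close>, and at most \<open>k\<close> loops at \<open>1/3\<close>
  and \<open>r\<close> loops at \<open>0\<close> become nontrivial. If all these bounds are attained, \<open>E\<close> consists of points inside loops
  at \<open>0\<close>, and \<open>y\<^sub>0 = k/3\<close> is the required sum.

  Freeness: let a point \<open>P\<close> be removed, which leaves degree \<open>r + k - 1\<close> after \<open>E\<close> is subtracted. If \<open>P\<close> is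
  not one of the \<open>k\<close> midpoints in the divisor, take \<open>r\<close> midpoints of loops at \<open>0\<close> that do not contain \<open>P\<close>
  in their interior; they give \<open>r + k\<close> nontrivial loops, which is too many. If \<open>P\<close> is such a midpoint, let
  \<open>E\<close> consist of \<open>P\<close> and of \<open>r - 1\<close> midpoints of loops at \<open>0\<close>. The number of nontrivial loops is then
  \<open>r + k - 1\<close>, but \<open>y\<^sub>0\<close> has moved by \<open>- 1/3 - 1/3\<close>, which is not an integer. Freeness also bounds the rank
  above by \<open>r\<close>, since removing a point lowers the rank by at most 1.
\<close>

section \<open>Rays at a point\<close>

text \<open>
  A star chart with its abstract star replaced by a family of geodesic rays indexed by an arbitrary set.
  In a concrete graph the rays are at hand, while enumerating them as rays of a star in the complex plane is
  awkward; the lemmas below translate between the two notions.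
\<close>

definition ray_system ::
  "'a metric \<Rightarrow> 'a \<Rightarrow> 'j set \<Rightarrow> ('j \<Rightarrow> real \<Rightarrow> 'a) \<Rightarrow> real \<Rightarrow> bool" where
  "ray_system \<Gamma> P J c \<rho> \<longleftrightarrow>
     P \<in> mspace \<Gamma> \<and> finite J \<and> J \<noteq> {} \<and> \<rho> > 0 \<and> (\<forall>j\<in>J. c j 0 = P) \<and>
     (\<forall>j\<in>J. \<forall>s\<in>{0..\<rho>}. c j s \<in> mspace \<Gamma>) \<and>
     (\<forall>j\<in>J. \<forall>l\<in>J. \<forall>s\<in>{0..\<rho>}. \<forall>t\<in>{0..\<rho>}.
        mdist \<Gamma> (c j s) (c l t) = (if j = l then \<bar>s - t\<bar> else s + t)) \<and>
     (\<forall>x\<in>mspace \<Gamma>. mdist \<Gamma> P x < \<rho> \<longrightarrow> (\<exists>j\<in>J. x = c j (mdist \<Gamma> P x)))"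

context
  fixes \<Gamma> :: "'a metric" and P and J :: "'j set" and c \<rho>
  assumes rs: "ray_system \<Gamma> P J c \<rho>"
begin

lemma ray_system_basic: "P \<in> mspace \<Gamma>" "finite J" "J \<noteq> {}" "\<rho> > 0"
  using rs by (auto simp: ray_system_def)

lemma ray_system_origin: "j \<in> J \<Longrightarrow> c j 0 = P"
  using rs by (auto simp: ray_system_def)

lemma ray_system_mem: "j \<in> J \<Longrightarrow> 0 \<le> s \<Longrightarrow> s \<le> \<rho> \<Longrightarrow> c j s \<in> mspace \<Gamma>"
  using rs by (auto simp: ray_system_def)

lemma ray_system_dist: "j \<in> J \<Longrightarrow> l \<in> J \<Longrightarrow> 0 \<le> s \<Longrightarrow> s \<le> \<rho> \<Longrightarrow> 0 \<le> t \<Longrightarrow> t \<le> \<rho> \<Longrightarrow>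
   mdist \<Gamma> (c j s) (c l t) = (if j = l then \<bar>s - t\<bar> else s + t)"
  using rs by (auto simp: ray_system_def)

lemma ray_system_dist_origin: "j \<in> J \<Longrightarrow> 0 \<le> s \<Longrightarrow> s \<le> \<rho> \<Longrightarrow> mdist \<Gamma> P (c j s) = s"
  using ray_system_dist[of j j 0 s] ray_system_origin[of j] ray_system_basic by auto

lemma ray_system_cover: "x \<in> mspace \<Gamma> \<Longrightarrow> mdist \<Gamma> P x < \<rho> \<Longrightarrow> \<exists>j\<in>J. x = c j (mdist \<Gamma> P x)"
  using rs by (auto simp: ray_system_def)

end

lemma ray_point_mod:
  assumes "n \<ge> 1"
  shows "ray_point n k t = ray_point n (int (nat (k mod int n))) t"
proof -
  have "real_of_int k = real_of_int (k mod int n) + real n * real_of_int (k div int n)"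
    by (metis add.commute mult_div_mod_eq of_int_add of_int_mult of_int_of_nat_eq)
  then have "2 * real_of_int k * pi / real n
      = 2 * real_of_int (k mod int n) * pi / real n + 2 * pi * real_of_int (k div int n)"
    using assms by (simp add: field_simps)
  then have "cis (2 * real_of_int k * pi / real n) = cis (2 * real_of_int (k mod int n) * pi / real n)"
    by (simp add: cis_mult[symmetric] cis_multiple_2pi)
  then show ?thesis using assms by (simp add: ray_point_cis)
qed

lemma ray_point_inj:
  assumes "k < n" "l < n" "ray_point n (int k) 1 = ray_point n (int l) 1"
  shows "k = l"
proof -
  have inj: "inj_on (\<lambda>k. cis (2 * pi * real k / real n)) {..<n}"
    using bij_betw_imp_inj_on[OF Complex.bij_betw_roots_unity[of n]] assms(1) by simp
  have "cis (2 * pi * real k / real n) = cis (2 * pi * real l / real n)"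
    using assms(3) by (simp add: ray_point_cis mult_ac)
  from inj_onD[OF inj this] show ?thesis using assms(1,2) by simp
qed

lemma star_chart_of_ray_system:
  assumes rs: "ray_system \<Gamma> P J c \<rho>"
  obtains h \<psi> where "bij_betw h {..<card J} J" "star_chart \<Gamma> P (card J) \<rho> \<psi>"
    "\<And>k t. k < card J \<Longrightarrow> 0 \<le> t \<Longrightarrow> \<psi> (ray_point (card J) (int k) t) = c (h k) t"
proof -
  let ?n = "card J"
  note rsf = ray_system_basic[OF rs]
  have n1: "?n \<ge> 1" using rsf by (simp add: Suc_leI card_gt_0_iff)
  obtain h where h: "bij_betw h {..<?n} J"
    using ex_bij_betw_nat_finite[OF rsf(2)] by (auto simp: atLeast0LessThan)
  have hJ: "h k \<in> J" if "k < ?n" for k using h that by (auto simp: bij_betw_def)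
  define K where "K z = (if z = 0 then 0 else THE k. k < ?n \<and> sgn z = ray_point ?n (int k) 1)" for z
  define \<psi> where "\<psi> z = c (h (K z)) (norm z)" for z
  have K: "K (ray_point ?n (int k) t) = k" if "k < ?n" "t > 0" for k t
  proof -
    have "ray_point ?n (int k) t \<noteq> 0" using norm_ray_point[of ?n "int k" t] that by fastforce
    moreover have "(THE l. l < ?n \<and> ray_point ?n (int k) 1 = ray_point ?n (int l) 1) = k"
      using that ray_point_inj[of k ?n] by (intro the_equality) blast+
    ultimately show ?thesis using that(2) by (simp add: K_def sgn_ray_point)
  qed
  have \<psi>: "\<psi> (ray_point ?n (int k) t) = c (h k) t" if "k < ?n" "0 \<le> t" for k t
  proof (cases "t = 0")
    case True
    then show ?thesis using that n1 hJ ray_system_origin[OF rs]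
      by (simp add: \<psi>_def norm_ray_point ray_point_cis K_def)
  next
    case False
    then show ?thesis using that K by (simp add: \<psi>_def norm_ray_point)
  qed
  have st: "\<exists>k t. k < ?n \<and> 0 \<le> t \<and> t \<le> \<rho> \<and> z = ray_point ?n (int k) t" if "z \<in> star ?n \<rho>" for z
  proof -
    from that obtain k t where "z = ray_point ?n k t" "0 \<le> t" "t \<le> \<rho>" by (auto simp: star_def)
    moreover have "nat (k mod int ?n) < ?n" using n1 by (simp add: nat_less_iff)
    ultimately show ?thesis using ray_point_mod[OF n1, of k t] by blast
  qed
  have in_star: "ray_point ?n k t \<in> star ?n \<rho>" if "0 \<le> t" "t \<le> \<rho>" for k t
    using that by (auto simp: star_def)
  have "star_chart \<Gamma> P ?n \<rho> \<psi>"
    unfolding star_chart_def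
  proof (intro conjI ballI)
    show "1 \<le> ?n" "0 < \<rho>" using n1 rsf by auto
    show "\<psi> ` star ?n \<rho> \<subseteq> mspace \<Gamma>"
    proof
      fix x assume "x \<in> \<psi> ` star ?n \<rho>"
      then obtain z where z: "z \<in> star ?n \<rho>" "x = \<psi> z" by blast
      then obtain k t where "k < ?n" "0 \<le> t" "t \<le> \<rho>" "z = ray_point ?n (int k) t" using st by blast
      then show "x \<in> mspace \<Gamma>" using z \<psi> hJ ray_system_mem[OF rs] by simp
    qed
    show "\<psi> 0 = P" using \<psi>[of 0 0] n1 hJ[of 0] ray_system_origin[OF rs] by (simp add: ray_point_cis)
    fix z w assume "z \<in> star ?n \<rho>" "w \<in> star ?n \<rho>"
    then obtain k s l t where kl: "k < ?n" "0 \<le> s" "s \<le> \<rho>" "z = ray_point ?n (int k) s"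
       "l < ?n" "0 \<le> t" "t \<le> \<rho>" "w = ray_point ?n (int l) t" using st by meson
    have "h k = h l \<longleftrightarrow> k = l" using h kl by (auto simp: bij_betw_def inj_on_def)
    then have "mdist \<Gamma> (\<psi> z) (\<psi> w) = (if ray_point ?n k 1 = ray_point ?n l 1 then \<bar>s - t\<bar> else s + t)"
      using kl \<psi> hJ ray_system_dist[OF rs] ray_point_inj[of k ?n l] by auto
    then show "ereal (mdist \<Gamma> (\<psi> z) (\<psi> w)) = path_metric (star ?n \<rho>) z w"
      unfolding kl using path_metric_star[OF n1, of s \<rho> t] kl by simp
  next
    interpret M: Metric_space "mspace \<Gamma>" "mdist \<Gamma>" by (rule Metric_space_mspace_mdist)
    show "\<exists>U. openin (mtopology_of \<Gamma>) U \<and> P \<in> U \<and> U \<subseteq> \<psi> ` star ?n \<rho>"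
    proof (intro exI conjI)
      show "openin (mtopology_of \<Gamma>) (M.mball P \<rho>)" by (simp add: mtopology_of_def)
      show "P \<in> M.mball P \<rho>" using rsf by simp
      show "M.mball P \<rho> \<subseteq> \<psi> ` star ?n \<rho>"
      proof
        fix x assume x: "x \<in> M.mball P \<rho>"
        then obtain j where j: "j \<in> J" "x = c j (mdist \<Gamma> P x)" using ray_system_cover[OF rs, of x] by auto
        obtain k where k: "k < ?n" "h k = j"
          using bij_betw_imp_surj_on[OF h] j(1) by (metis imageE lessThan_iff)
        have "x = \<psi> (ray_point ?n (int k) (mdist \<Gamma> P x))" using \<psi> k j by simp
        moreover have "ray_point ?n (int k) (mdist \<Gamma> P x) \<in> star ?n \<rho>" using x in_star by simp
        ultimately show "x \<in> \<psi> ` star ?n \<rho>" by blast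
      qed
    qed
  qed
  with h \<psi> show thesis using that by blast
qed

text \<open>
  The neighbourhood in a star chart is an arbitrary open set; only a smaller radius ensures that a whole
  ball is covered by the rays.
\<close>

lemma ray_system_of_star_chart:
  assumes ch: "star_chart \<Gamma> P n \<rho> \<psi>"
  obtains \<rho>' where "ray_system \<Gamma> P {..<n} (\<lambda>k t. \<psi> (ray_point n (int k) t)) \<rho>'"
proof -
  interpret M: Metric_space "mspace \<Gamma>" "mdist \<Gamma>" by (rule Metric_space_mspace_mdist)
  have n1: "n \<ge> 1" and \<rho>: "\<rho> > 0" and img: "\<psi> ` star n \<rho> \<subseteq> mspace \<Gamma>" and P: "\<psi> 0 = P"
    and d: "\<And>z w. z \<in> star n \<rho> \<Longrightarrow> w \<in> star n \<rho> \<Longrightarrow> ereal (mdist \<Gamma> (\<psi> z) (\<psi> w)) = path_metric (star n \<rho>) z w"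
    using ch by (auto simp: star_chart_def)
  obtain U where U: "openin M.mtopology U" "P \<in> U" "U \<subseteq> \<psi> ` star n \<rho>"
    using ch by (auto simp: star_chart_def mtopology_of_def)
  obtain r where r: "r > 0" "M.mball P r \<subseteq> U" using U by (meson M.openin_mtopology)
  define \<rho>' where "\<rho>' = min r \<rho>"
  have rho': "0 < \<rho>'" "\<rho>' \<le> r" "\<rho>' \<le> \<rho>" using r \<rho> by (auto simp: \<rho>'_def)
  have in_star: "ray_point n k t \<in> star n \<rho>" if "0 \<le> t" "t \<le> \<rho>" for k t
    using that by (auto simp: star_def)
  have dist: "mdist \<Gamma> (\<psi> (ray_point n (int k) s)) (\<psi> (ray_point n (int l) t)) = (if k = l then \<bar>s - t\<bar> else s + t)"
    if "k < n" "l < n" "0 \<le> s" "s \<le> \<rho>" "0 \<le> t" "t \<le> \<rho>" for k l s t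
    using d[OF in_star in_star, of s t "int k" "int l"] path_metric_star[OF n1, of s \<rho> t "int k" "int l"] that
      ray_point_inj[of k n l] by (auto split: if_splits)
  have "0 \<in> star n \<rho>" using in_star[of 0 0] \<rho> by (simp add: ray_point_cis)
  have "ray_system \<Gamma> P {..<n} (\<lambda>k t. \<psi> (ray_point n (int k) t)) \<rho>'"
    unfolding ray_system_def
  proof (intro conjI ballI impI)
    show "P \<in> mspace \<Gamma>" using \<open>0 \<in> star n \<rho>\<close> P img by auto
    show "finite {..<n}" "0 < \<rho>'" using rho' by auto
    show "{..<n} \<noteq> {}" using n1 by (auto simp: lessThan_empty_iff)
    show "\<psi> (ray_point n (int k) 0) = P" for k using P by (simp add: ray_point_cis)
    show "\<psi> (ray_point n (int j) s) \<in> mspace \<Gamma>" if "s \<in> {0..\<rho>'}" for j s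
      using that img in_star[of s "int j"] rho' by auto
    show "mdist \<Gamma> (\<psi> (ray_point n (int j) s)) (\<psi> (ray_point n (int l) t)) = (if j = l then \<bar>s - t\<bar> else s + t)"
      if "j \<in> {..<n}" "l \<in> {..<n}" "s \<in> {0..\<rho>'}" "t \<in> {0..\<rho>'}" for j l s t
      using that rho' by (intro dist) auto
    fix x assume x: "x \<in> mspace \<Gamma>" "mdist \<Gamma> P x < \<rho>'"
    then have "x \<in> M.mball P r" using rho' \<open>P \<in> mspace \<Gamma>\<close> by simp
    then obtain z where z: "z \<in> star n \<rho>" "x = \<psi> z" using r(2) U(3) by blast
    then obtain k t where kt: "z = ray_point n k t" "0 \<le> t" "t \<le> \<rho>" by (auto simp: star_def)
    define k' where "k' = nat (k mod int n)"
    have k': "k' < n" "z = ray_point n (int k') t" using n1 ray_point_mod[OF n1, of k t] kt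
      by (auto simp: k'_def nat_less_iff)
    have "ray_point n (int k') 0 = 0" by (simp add: ray_point_cis)
    then have "mdist \<Gamma> P x = t"
      using dist[of k' k' 0 t] k' kt(2,3) z(2) P \<rho> by simp
    with k' z show "\<exists>j\<in>{..<n}. x = \<psi> (ray_point n (int j) (mdist \<Gamma> P x))" by auto
  qed
  then show thesis using that by blast
qed

text \<open>
  A point at distance \<open>u\<close> from \<open>P\<close> lies at parameter \<open>u\<close> on a ray of either system. Points on different
  rays have distance \<open>s + t\<close>, which differs from \<open>|s - t|\<close> away from \<open>P\<close>; hence a ray of one system cannot
  change between rays of the other. So valence and divisor coefficients can be computed
  from any ray system.
\<close>

lemma ray_systems_match:
  assumes rs: "ray_system \<Gamma> P J c \<rho>" and rs': "ray_system \<Gamma> P J' c' \<rho>'"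
  obtains h \<epsilon> where "bij_betw h J J'" "\<epsilon> > 0" "\<And>j u. j \<in> J \<Longrightarrow> 0 \<le> u \<Longrightarrow> u \<le> \<epsilon> \<Longrightarrow> c j u = c' (h j) u"
proof -
  define \<epsilon> where "\<epsilon> = min \<rho> \<rho>' / 2"
  have \<epsilon>: "0 < \<epsilon>" "\<epsilon> < \<rho>" "\<epsilon> < \<rho>'"
    using ray_system_basic(4)[OF rs] ray_system_basic(4)[OF rs'] by (auto simp: \<epsilon>_def)
  have ex: "\<exists>j'\<in>J'. c j u = c' j' u" if "j \<in> J" "0 \<le> u" "u \<le> \<epsilon>" for j u
  proof -
    have "c j u \<in> mspace \<Gamma>" "mdist \<Gamma> P (c j u) = u"
      using ray_system_mem[OF rs] ray_system_dist_origin[OF rs] that \<epsilon> by auto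
    then show ?thesis using ray_system_cover[OF rs', of "c j u"] that \<epsilon> by auto
  qed
  have ex': "\<exists>j\<in>J. c j u = c' j' u" if "j' \<in> J'" "0 \<le> u" "u \<le> \<epsilon>" for j' u
  proof -
    have "c' j' u \<in> mspace \<Gamma>" "mdist \<Gamma> P (c' j' u) = u"
      using ray_system_mem[OF rs'] ray_system_dist_origin[OF rs'] that \<epsilon> by auto
    then show ?thesis using ray_system_cover[OF rs, of "c' j' u"] that \<epsilon> by auto
  qed
  have "\<forall>j\<in>J. \<exists>j'. j' \<in> J' \<and> c j \<epsilon> = c' j' \<epsilon>"
    using ex[of _ \<epsilon>] \<epsilon> by auto
  then obtain h where h: "\<And>j. j \<in> J \<Longrightarrow> h j \<in> J' \<and> c j \<epsilon> = c' (h j) \<epsilon>"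
    using bchoice[of J "\<lambda>j j'. j' \<in> J' \<and> c j \<epsilon> = c' j' \<epsilon>"] by blast
  have eq: "c j u = c' (h j) u" if j: "j \<in> J" and u: "0 \<le> u" "u \<le> \<epsilon>" for j u
  proof (cases "u = 0")
    case True
    then show ?thesis using j h ray_system_origin[OF rs] ray_system_origin[OF rs'] by simp
  next
    case False
    obtain l where l: "l \<in> J'" "c j u = c' l u" using ex j u by blast
    have "mdist \<Gamma> (c j u) (c j \<epsilon>) = \<bar>u - \<epsilon>\<bar>" using ray_system_dist[OF rs, of j j u \<epsilon>] j u \<epsilon> by simp
    moreover have "mdist \<Gamma> (c' l u) (c' (h j) \<epsilon>) = (if l = h j then \<bar>u - \<epsilon>\<bar> else u + \<epsilon>)"
      using ray_system_dist[OF rs', of l "h j" u \<epsilon>] u \<epsilon> l(1) h[OF j] by simp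
    ultimately have "l = h j" using l h[OF j] u False \<epsilon> by (auto split: if_splits)
    with l show ?thesis by simp
  qed
  have "inj_on h J"
  proof (rule inj_onI)
    fix j l assume jl: "j \<in> J" "l \<in> J" "h j = h l"
    then have "c j \<epsilon> = c l \<epsilon>" using h by metis
    moreover have "mdist \<Gamma> (c j \<epsilon>) (c l \<epsilon>) = (if j = l then 0 else 2 * \<epsilon>)"
      using ray_system_dist[OF rs, of j l \<epsilon> \<epsilon>] jl(1,2) \<epsilon> by simp
    ultimately show "j = l" using \<epsilon> jl ray_system_dist[OF rs, of j j \<epsilon> \<epsilon>] by (auto split: if_splits)
  qed
  moreover have "J' \<subseteq> h ` J"
  proof
    fix j' assume j': "j' \<in> J'"
    obtain j where j: "j \<in> J" "c j \<epsilon> = c' j' \<epsilon>" using ex'[of j' \<epsilon>] j' \<epsilon> by auto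
    then have "c' (h j) \<epsilon> = c' j' \<epsilon>" using h by metis
    moreover have "mdist \<Gamma> (c' (h j) \<epsilon>) (c' j' \<epsilon>) = (if h j = j' then 0 else 2 * \<epsilon>)"
      using ray_system_dist[OF rs', of "h j" j' \<epsilon> \<epsilon>] h[OF j(1)] j' \<epsilon> by simp
    ultimately have "h j = j'" using \<epsilon> j' ray_system_dist[OF rs', of j' j' \<epsilon> \<epsilon>] by (auto split: if_splits)
    with j show "j' \<in> h ` J" by blast
  qed
  ultimately have "bij_betw h J J'" using h by (auto simp: bij_betw_def)
  with eq \<epsilon> show thesis using that by blast
qed

lemma valence_ray_system:
  assumes rs: "ray_system \<Gamma> P J c \<rho>"
  shows "valence \<Gamma> P = card J"
  unfolding valence_def
proof (rule the_equality)
  show "\<exists>\<rho> \<psi>. star_chart \<Gamma> P (card J) \<rho> \<psi>" using star_chart_of_ray_system[OF rs] by blast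
  fix n assume "\<exists>\<rho> \<psi>. star_chart \<Gamma> P n \<rho> \<psi>"
  then obtain \<rho>' \<psi> where "star_chart \<Gamma> P n \<rho>' \<psi>" by blast
  then obtain \<rho>'' where rs': "ray_system \<Gamma> P {..<n} (\<lambda>k t. \<psi> (ray_point n (int k) t)) \<rho>''"
    by (rule ray_system_of_star_chart)
  obtain h \<epsilon> where "bij_betw h J {..<n}" by (rule ray_systems_match[OF rs rs'])
  then show "n = card J" by (simp add: bij_betw_same_card)
qed

text \<open>
  Divisor coefficients are defined by one-sided derivatives; the next two lemmas replace them by slopes of
  functions that are affine near the point.
\<close>

lemma has_real_derivative_right_if_affine:
  assumes "\<epsilon> > 0" "\<And>u. 0 \<le> u \<Longrightarrow> u \<le> \<epsilon> \<Longrightarrow> F u = F 0 + m * u"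
  shows "(F has_real_derivative m) (at 0 within {0..})"
proof -
  have "((\<lambda>u. F 0 + m * u) has_real_derivative m) (at 0 within {0..})"
    by (auto intro!: derivative_eq_intros)
  moreover have "eventually (\<lambda>u. F 0 + m * u = F u) (at 0 within {0..})"
    unfolding eventually_at
  proof (intro exI[of _ \<epsilon>] conjI ballI impI assms(1))
    fix u :: real assume "u \<in> {0..}" "u \<noteq> 0 \<and> dist u 0 < \<epsilon>"
    then show "F 0 + m * u = F u" using assms(2)[of u] by (simp add: dist_real_def)
  qed
  ultimately show ?thesis
    using has_field_derivative_cong_eventually[of "\<lambda>u. F 0 + m * u" F 0 "{0..}" m] by simp
qed

lemma has_real_derivative_right_unique:
  assumes "(F has_real_derivative a) (at 0 within {0..})" "(F has_real_derivative b) (at 0 within {0..})"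
  shows "a = b"
proof -
  have nt: "at 0 within {0::real..} \<noteq> bot"
    by (simp add: at_within_Ici_at_right)
  show ?thesis using assms unfolding has_field_derivative_iff
    using tendsto_unique[OF nt] by blast
qed

lemma div_coeff_ray_system:
  fixes m :: "'j \<Rightarrow> int"
  assumes rs: "ray_system \<Gamma> P J c \<rho>"
    and m: "\<And>j. j \<in> J \<Longrightarrow> \<exists>\<epsilon>>0. \<forall>u. 0 \<le> u \<and> u \<le> \<epsilon> \<longrightarrow> f (c j u) = f P + of_int (m j) * u"
  shows "div_coeff \<Gamma> f P = (\<Sum>j\<in>J. m j)"
  unfolding div_coeff_def
proof (rule the_equality)
  have der: "((\<lambda>t. f (c j t)) has_real_derivative of_int (m j)) (at 0 within {0..})" if j: "j \<in> J" for j
  proof -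
    obtain \<epsilon> where "\<epsilon> > 0" "\<And>u. 0 \<le> u \<Longrightarrow> u \<le> \<epsilon> \<Longrightarrow> f (c j u) = f P + of_int (m j) * u"
      using m[OF j] by blast
    then show ?thesis
      using ray_system_origin[OF rs j] by (intro has_real_derivative_right_if_affine[of \<epsilon>]) auto
  qed
  obtain h \<psi> where h: "bij_betw h {..<card J} J" "star_chart \<Gamma> P (card J) \<rho> \<psi>"
    "\<And>k t. k < card J \<Longrightarrow> 0 \<le> t \<Longrightarrow> \<psi> (ray_point (card J) (int k) t) = c (h k) t"
    using star_chart_of_ray_system[OF rs] by blast
  have hJ: "h k \<in> J" if "k < card J" for k using h(1) that by (auto simp: bij_betw_def)
  show "\<exists>n \<rho> \<psi> slope. star_chart \<Gamma> P n \<rho> \<psi> \<and>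
       (\<forall>k<n. ((\<lambda>t. f (\<psi> (ray_point n (int k) t))) has_real_derivative real_of_int (slope k)) (at 0 within {0..})) \<and>
       sum m J = sum slope {..<n}"
  proof (intro exI[of _ "card J"] exI[of _ \<rho>] exI[of _ \<psi>] exI[of _ "\<lambda>k. m (h k)"] conjI allI impI)
    show "sum m J = (\<Sum>k<card J. m (h k))" using sum.reindex_bij_betw[OF h(1), of m] by simp
    fix k assume k: "k < card J"
    have "((\<lambda>t. f (\<psi> (ray_point (card J) (int k) t))) has_real_derivative of_int (m (h k))) (at 0 within {0..})
        \<longleftrightarrow> ((\<lambda>t. f (c (h k) t)) has_real_derivative of_int (m (h k))) (at 0 within {0..})"
      using h(3) k by (intro has_field_derivative_cong_eventually) (auto simp: eventually_at intro: exI[of _ 1])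
    then show "((\<lambda>t. f (\<psi> (ray_point (card J) (int k) t))) has_real_derivative of_int (m (h k))) (at 0 within {0..})"
      using der[OF hJ[OF k]] by simp
  qed (use h in auto)
  fix M assume "\<exists>n \<rho> \<psi> slope. star_chart \<Gamma> P n \<rho> \<psi> \<and>
       (\<forall>k<n. ((\<lambda>t. f (\<psi> (ray_point n (int k) t))) has_real_derivative real_of_int (slope k)) (at 0 within {0..})) \<and>
       M = sum slope {..<n}"
  then obtain n \<rho>' \<psi>' slope where ch: "star_chart \<Gamma> P n \<rho>' \<psi>'" and
    sl: "\<And>k. k < n \<Longrightarrow> ((\<lambda>t. f (\<psi>' (ray_point n (int k) t))) has_real_derivative real_of_int (slope k)) (at 0 within {0..})"
    and M: "M = sum slope {..<n}" by blast
  obtain \<rho>'' where rs': "ray_system \<Gamma> P {..<n} (\<lambda>k t. \<psi>' (ray_point n (int k) t)) \<rho>''"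
    using ray_system_of_star_chart[OF ch] by blast
  obtain h' \<epsilon> where h': "bij_betw h' {..<n} J" "\<epsilon> > 0"
      "\<And>k u. k \<in> {..<n} \<Longrightarrow> 0 \<le> u \<Longrightarrow> u \<le> \<epsilon> \<Longrightarrow> \<psi>' (ray_point n (int k) u) = c (h' k) u"
    using ray_systems_match[OF rs' rs] by blast
  have "slope k = m (h' k)" if k: "k < n" for k
  proof -
    have "((\<lambda>t. f (c (h' k) t)) has_real_derivative real_of_int (slope k)) (at 0 within {0..})
       \<longleftrightarrow> ((\<lambda>t. f (\<psi>' (ray_point n (int k) t))) has_real_derivative real_of_int (slope k)) (at 0 within {0..})"
      using h' k by (intro has_field_derivative_cong_eventually) (auto simp: eventually_at dist_real_def intro!: exI[of _ \<epsilon>])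
    with sl[OF k] have "((\<lambda>t. f (c (h' k) t)) has_real_derivative real_of_int (slope k)) (at 0 within {0..})" by simp
    moreover have "h' k \<in> J" using h' k by (auto simp: bij_betw_def)
    ultimately show ?thesis using der has_real_derivative_right_unique by (metis of_int_eq_iff)
  qed
  then have "M = (\<Sum>k<n. m (h' k))" using M by simp
  also have "\<dots> = sum m J" by (rule sum.reindex_bij_betw[OF h'(1)])
  finally show "M = sum m J" .
qed

section \<open>Rational functions along rays\<close>

text \<open>
  The local slopes are locally constant, hence constant, by a compactness argument: the property of having
  equal slopes at both ends and matching values passes to adjacent intervals.
\<close>

lemma affine_if_locally_affine:
  fixes F :: "real \<Rightarrow> real"
  assumes loc: "\<And>u. a < u \<Longrightarrow> u < b \<Longrightarrow>
     \<exists>m::int. \<exists>\<eta>>0. \<forall>v. \<bar>v - u\<bar> < \<eta> \<longrightarrow> F v = F u + of_int m * (v - u)"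
  shows "\<exists>m::int. \<forall>u v. a < u \<longrightarrow> u \<le> v \<longrightarrow> v < b \<longrightarrow> F v = F u + of_int m * (v - u)"
proof (cases "a < b")
  case True
  have "\<exists>m::int. \<exists>\<eta>>0. a < u \<longrightarrow> u < b \<longrightarrow> (\<forall>v. \<bar>v - u\<bar> < \<eta> \<longrightarrow> F v = F u + of_int m * (v - u))" for u
    using loc[of u] by (cases "a < u \<and> u < b") (auto intro: exI[of _ 1])
  then obtain \<mu> \<eta> where \<mu>: "\<And>u. \<eta> u > 0"
      "\<And>u v. a < u \<Longrightarrow> u < b \<Longrightarrow> \<bar>v - u\<bar> < \<eta> u \<Longrightarrow> F v = F u + of_int (\<mu> u :: int) * (v - u)"
    by metis
  have same: "\<mu> v = \<mu> x" if x: "a < x" "x < b" and v: "a < v" "v < b" "\<bar>v - x\<bar> < \<eta> x" for x v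
  proof -
    define t where "t = min (\<eta> v) (\<eta> x - \<bar>v - x\<bar>) / 2"
    have t: "t > 0" "t < \<eta> v" "t < \<eta> x - \<bar>v - x\<bar>"
      using \<mu>(1)[of v] v by (auto simp: t_def min_def field_simps)
    have "F (v + t) = F v + of_int (\<mu> v) * t" using \<mu>(2)[of v "v + t"] v t by simp
    moreover have "F (v + t) = F x + of_int (\<mu> x) * (v + t - x)" using \<mu>(2)[of x "v + t"] x t by simp
    moreover have "F v = F x + of_int (\<mu> x) * (v - x)" using \<mu>(2)[of x v] x v by simp
    ultimately have "(of_int (\<mu> v) - of_int (\<mu> x)) * t = (0::real)" by (simp add: algebra_simps)
    then show ?thesis using t by simp
  qed
  have main: "\<mu> u = \<mu> v \<and> F v = F u + of_int (\<mu> u) * (v - u)" if uv: "a < u" "u \<le> v" "v < b" for u v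
    using uv(2)
  proof (induct rule: Bolzano)
    case (trans x y z)
    then show ?case by (auto simp: algebra_simps)
  next
    case (local x)
    then have x: "a < x" "x < b" using uv by auto
    define d where "d = min (\<eta> x) (min (x - a) (b - x))"
    have d: "d > 0" "d \<le> \<eta> x" "d \<le> x - a" "d \<le> b - x" using \<mu>(1)[of x] x by (auto simp: d_def)
    show ?case
    proof (intro exI[of _ d] conjI allI impI d(1))
      fix y z assume yz: "y \<le> x \<and> x \<le> z \<and> z - y < d"
      have "F y = F x + of_int (\<mu> x) * (y - x)" "F z = F x + of_int (\<mu> x) * (z - x)"
        using \<mu>(2)[of x y] \<mu>(2)[of x z] x yz d by auto
      moreover have e: "\<mu> y = \<mu> x" "\<mu> z = \<mu> x"
        using same[OF x, of y] same[OF x, of z] yz d by auto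
      ultimately show "F z = F y + of_int (\<mu> y) * (z - y)" by (simp add: algebra_simps)
      show "\<mu> y = \<mu> z" using e by simp
    qed
  qed
  show ?thesis
  proof (intro exI[of _ "\<mu> ((a + b) / 2)"] allI impI)
    fix u v assume uv: "a < u" "u \<le> v" "v < b"
    have "\<mu> u = \<mu> ((a + b) / 2)"
    proof (cases "u \<le> (a + b) / 2")
      case True
      show ?thesis by (rule conjunct1[OF main]) (use True uv in auto)
    next
      case False
      have "\<mu> ((a + b) / 2) = \<mu> u" by (rule conjunct1[OF main]) (use False uv in auto)
      then show ?thesis by simp
    qed
    then show "F v = F u + of_int (\<mu> ((a + b) / 2)) * (v - u)" using conjunct2[OF main[OF uv]] by metis
  qed
qed auto

text \<open>
  An isometry of an interval fixing 0 preserves absolute values, and comparison with one fixed point \<open>k > 0\<close>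
  determines the sign for all points at once.
\<close>

lemma isometry_interval_sign:
  fixes \<theta> :: "real \<Rightarrow> real"
  assumes "\<And>h k. \<bar>h\<bar> < \<eta> \<Longrightarrow> \<bar>k\<bar> < \<eta> \<Longrightarrow> \<bar>\<theta> h - \<theta> k\<bar> = \<bar>h - k\<bar>" "\<theta> 0 = 0" "\<eta> > 0"
  obtains \<sigma> :: int where "\<sigma> = 1 \<or> \<sigma> = -1" "\<And>h. \<bar>h\<bar> < \<eta> \<Longrightarrow> \<theta> h = of_int \<sigma> * h"
proof -
  have abs: "\<bar>\<theta> h\<bar> = \<bar>h\<bar>" if "\<bar>h\<bar> < \<eta>" for h using assms(1)[of h 0] assms(2,3) that by simp
  define k where "k = \<eta> / 2"
  have k: "\<bar>k\<bar> < \<eta>" "k > 0" using assms(3) by (auto simp: k_def)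
  show thesis
  proof (cases "\<theta> k = k")
    case True
    have "\<theta> h = h" if "\<bar>h\<bar> < \<eta>" for h
      using abs[OF that] assms(1)[OF that k(1)] True k(2) by (auto simp: abs_if split: if_splits)
    then show thesis using that[of 1] by simp
  next
    case False
    then have "\<theta> k = -k" using abs[OF k(1)] by auto
    then have "\<theta> h = -h" if "\<bar>h\<bar> < \<eta>" for h
      using abs[OF that] assms(1)[OF that k(1)] k(2) by (auto simp: abs_if split: if_splits)
    then show thesis using that[of "-1"] by simp
  qed
qed

text \<open>
  A segment and a ray through a common interior point coincide nearby, up to orientation: a point of the
  segment near \<open>c j u\<close> is less than \<open>u\<close> away from it, so it cannot lie on another ray.
\<close>

lemma segment_affine_on_ray:
  assumes rs: "ray_system \<Gamma> P J c \<rho>" and j: "j \<in> J" and u: "0 < u" "2 * u < \<rho>"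
    and seg: "segment \<Gamma> \<gamma> L" and w: "0 < w" "w < L" and eq: "c j u = \<gamma> w"
    and aff: "\<forall>t\<in>{0..L}. f (\<gamma> t) = f (\<gamma> 0) + of_int m * t"
  shows "\<exists>m'::int. \<exists>\<eta>>0. \<forall>v. \<bar>v - u\<bar> < \<eta> \<longrightarrow> f (c j v) = f (c j u) + of_int m' * (v - u)"
proof -
  interpret M: Metric_space "mspace \<Gamma>" "mdist \<Gamma>" by (rule Metric_space_mspace_mdist)
  define \<eta> where "\<eta> = min u (min w (L - w))"
  have \<eta>: "\<eta> > 0" "\<eta> \<le> u" "\<eta> \<le> w" "\<eta> \<le> L - w" using u w by (auto simp: \<eta>_def)
  have rng: "w + h \<in> {0..L}" if "\<bar>h\<bar> < \<eta>" for h using that \<eta> by auto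
  have g: "\<gamma> (w + h) \<in> mspace \<Gamma>" "\<bar>h\<bar> < \<eta> \<Longrightarrow> \<bar>k\<bar> < \<eta> \<Longrightarrow> mdist \<Gamma> (\<gamma> (w + h)) (\<gamma> (w + k)) = \<bar>h - k\<bar>"
    if "\<bar>h\<bar> < \<eta>" for h k
    using seg rng that by (simp_all add: segment_def image_subset_iff)
  define \<theta> where "\<theta> h = mdist \<Gamma> P (\<gamma> (w + h)) - u" for h
  have on_ray: "\<gamma> (w + h) = c j (u + \<theta> h) \<and> 0 \<le> u + \<theta> h \<and> u + \<theta> h < \<rho>" if h: "\<bar>h\<bar> < \<eta>" for h
  proof -
    let ?x = "\<gamma> (w + h)"
    have x: "?x \<in> mspace \<Gamma>" using g h by blast
    have cm: "c j u \<in> mspace \<Gamma>" "P \<in> mspace \<Gamma>" using ray_system_mem[OF rs j] ray_system_basic(1)[OF rs] u by auto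
    have dx: "mdist \<Gamma> (c j u) ?x = \<bar>h\<bar>" using g(2)[of 0 h] h eq \<eta> by simp
    have lt: "mdist \<Gamma> P ?x < \<rho>"
      using M.triangle[OF cm(2) cm(1) x] dx ray_system_dist_origin[OF rs j, of u] u h \<eta> by linarith
    obtain l where l: "l \<in> J" "?x = c l (mdist \<Gamma> P ?x)" using ray_system_cover[OF rs x lt] by blast
    have "mdist \<Gamma> (c j u) (c l (mdist \<Gamma> P ?x)) = (if j = l then \<bar>u - mdist \<Gamma> P ?x\<bar> else u + mdist \<Gamma> P ?x)"
      using ray_system_dist[OF rs j l(1), of u "mdist \<Gamma> P ?x"] u lt by simp
    with dx l have "\<bar>h\<bar> = (if j = l then \<bar>u - mdist \<Gamma> P ?x\<bar> else u + mdist \<Gamma> P ?x)" by simp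
    moreover have "0 \<le> mdist \<Gamma> P ?x" by simp
    ultimately have "j = l" using h \<eta> by (smt (verit))
    then show ?thesis using l lt by (simp add: \<theta>_def)
  qed
  have iso: "\<bar>\<theta> h - \<theta> k\<bar> = \<bar>h - k\<bar>" if "\<bar>h\<bar> < \<eta>" "\<bar>k\<bar> < \<eta>" for h k
  proof -
    have "mdist \<Gamma> (c j (u + \<theta> h)) (c j (u + \<theta> k)) = \<bar>h - k\<bar>" using on_ray g(2) that by metis
    then show ?thesis using ray_system_dist[OF rs j j, of "u + \<theta> h" "u + \<theta> k"] on_ray[OF that(1)] on_ray[OF that(2)]
      by simp
  qed
  have "\<theta> 0 = 0" using eq ray_system_dist_origin[OF rs j, of u] u by (simp add: \<theta>_def flip: eq)
  then obtain \<sigma> :: int where \<sigma>: "\<sigma> = 1 \<or> \<sigma> = -1" "\<And>h. \<bar>h\<bar> < \<eta> \<Longrightarrow> \<theta> h = of_int \<sigma> * h"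
    using isometry_interval_sign[of \<eta> \<theta>] iso \<eta>(1) by blast
  show ?thesis
  proof (intro exI[of _ "m * \<sigma>"] exI[of _ \<eta>] conjI allI impI \<eta>(1))
    fix v assume v: "\<bar>v - u\<bar> < \<eta>"
    define h where "h = of_int \<sigma> * (v - u)"
    have h: "\<bar>h\<bar> < \<eta>" "\<theta> h = v - u" using \<sigma> v by (auto simp: h_def abs_mult)
    have "f (c j v) = f (\<gamma> (w + h))" using on_ray[OF h(1)] h by simp
    also have "\<dots> = f (\<gamma> 0) + of_int m * (w + h)"
      using bspec[OF aff rng[OF h(1)]] .
    also have "\<dots> = f (\<gamma> w) + of_int m * h"
      using bspec[OF aff, of w] w by (simp add: algebra_simps del: eq)
    finally show "f (c j v) = f (c j u) + of_int (m * \<sigma>) * (v - u)" by (simp add: h_def eq)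
  qed
qed

text \<open>
  The edges are covered by finitely many segments on which \<open>f\<close> is affine. On a short initial piece of a ray,
  without the point \<open>P\<close> itself, there are neither vertices nor ends of these segments, so \<open>f\<close> is locally
  affine there; continuity of \<open>f\<close> gives the value at \<open>P\<close>.
\<close>

lemma rational_function_affine_on_rays:
  assumes rat: "rational_function \<Gamma> f" and fin: "finite (vertices \<Gamma>)" "finite (edges \<Gamma>)"
    and rs: "ray_system \<Gamma> P J c \<rho>" and j: "j \<in> J"
  shows "\<exists>m::int. \<exists>\<epsilon>>0. \<forall>u. 0 \<le> u \<and> u \<le> \<epsilon> \<longrightarrow> f (c j u) = f P + of_int m * u"
proof -
  interpret M: Metric_space "mspace \<Gamma>" "mdist \<Gamma>" by (rule Metric_space_mspace_mdist)
  have \<rho>: "\<rho> > 0" using ray_system_basic[OF rs] by simp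
  have "\<forall>e\<in>edges \<Gamma>. \<exists>S. finite S \<and> e = (\<Union>(\<gamma>, L) \<in> S. \<gamma> ` {0..L}) \<and>
        (\<forall>(\<gamma>, L) \<in> S. segment \<Gamma> \<gamma> L \<and> (\<exists>m::int. \<forall>t \<in> {0..L}. f (\<gamma> t) = f (\<gamma> 0) + of_int m * t))"
    using rat by (simp add: rational_function_def)
  from bchoice[OF this] obtain S where S: "\<forall>e\<in>edges \<Gamma>. finite (S e) \<and> e = (\<Union>(\<gamma>, L) \<in> S e. \<gamma> ` {0..L}) \<and>
        (\<forall>(\<gamma>, L) \<in> S e. segment \<Gamma> \<gamma> L \<and> (\<exists>m::int. \<forall>t \<in> {0..L}. f (\<gamma> t) = f (\<gamma> 0) + of_int m * t))"
    by blast
  define T where "T = (\<Union>e\<in>edges \<Gamma>. S e)"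
  have T: "finite T" unfolding T_def using S fin(2) by blast
  have Tseg': "segment \<Gamma> \<gamma> L \<and> (\<exists>m::int. \<forall>t \<in> {0..L}. f (\<gamma> t) = f (\<gamma> 0) + of_int m * t)"
    if gL: "(\<gamma>, L) \<in> T" for \<gamma> L
  proof -
    obtain e where e: "e \<in> edges \<Gamma>" "(\<gamma>, L) \<in> S e" using gL unfolding T_def by blast
    from bspec[OF conjunct2[OF conjunct2[OF bspec[OF S e(1)]]] e(2), unfolded split_conv]
    show ?thesis .
  qed
  note Tseg = conjunct1[OF Tseg'] conjunct2[OF Tseg']
  have cov: "\<exists>(\<gamma>, L)\<in>T. x \<in> \<gamma> ` {0..L}" if x: "x \<in> mspace \<Gamma>" "x \<notin> vertices \<Gamma>" for x
  proof -
    let ?X = "subtopology (mtopology_of \<Gamma>) (mspace \<Gamma> - vertices \<Gamma>)"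
    have "x \<in> topspace ?X" using x by simp
    then obtain C where C: "C \<in> connected_components_of ?X" "x \<in> C"
      using Union_connected_components_of[of ?X] by blast
    have "C \<subseteq> mspace \<Gamma>" using connected_components_of_subset[OF C(1)] by auto
    then have "x \<in> mtopology_of \<Gamma> closure_of C"
      using C(2) closure_of_subset[of C "mtopology_of \<Gamma>"] by auto
    moreover have "mtopology_of \<Gamma> closure_of C \<in> edges \<Gamma>" using C by (auto simp: edges_def)
    ultimately obtain e where e: "e \<in> edges \<Gamma>" "x \<in> e" by blast
    have "x \<in> (\<Union>(\<gamma>, L) \<in> S e. \<gamma> ` {0..L})"
      by (rule subst[where P = "\<lambda>A. x \<in> A", OF conjunct1[OF conjunct2[OF bspec[OF S e(1)]]] e(2)])
    then show ?thesis using e(1) unfolding T_def by blast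
  qed
  define B where "B = vertices \<Gamma> \<union> (\<lambda>(\<gamma>, L). \<gamma> 0) ` T \<union> (\<lambda>(\<gamma>, L). \<gamma> L) ` T"
  have finB: "finite B" using T fin by (simp add: B_def)
  \<comment> \<open>A ray meets the finite set \<open>B\<close> only at the distances from \<open>P\<close> that occur in \<open>B\<close>.\<close>
  define Z where "Z = mdist \<Gamma> P ` B"
  have "finite Z" using finB by (simp add: Z_def)
  then obtain d where d: "d > 0" "\<And>z. z \<in> Z \<Longrightarrow> z \<noteq> 0 \<Longrightarrow> d \<le> dist 0 z"
    using finite_set_avoid[of Z 0] by blast
  define \<epsilon> where "\<epsilon> = min d (\<rho> / 2)"
  have \<epsilon>: "0 < \<epsilon>" "\<epsilon> \<le> d" "\<epsilon> \<le> \<rho> / 2" using d \<rho> by (auto simp: \<epsilon>_def)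
  have notB: "c j u \<notin> B" if "0 < u" "u < \<epsilon>" for u
  proof
    assume "c j u \<in> B"
    then have "mdist \<Gamma> P (c j u) \<in> Z" by (simp add: Z_def)
    moreover have "mdist \<Gamma> P (c j u) = u" using ray_system_dist_origin[OF rs j, of u] that \<epsilon> \<rho> by simp
    ultimately have "u \<in> Z" by simp
    then show False using d(2)[of u] that \<epsilon> by (simp add: dist_real_def)
  qed
  have loc: "\<exists>m::int. \<exists>\<eta>>0. \<forall>v. \<bar>v - u\<bar> < \<eta> \<longrightarrow> f (c j v) = f (c j u) + of_int m * (v - u)"
    if u: "0 < u" "u < \<epsilon>" for u
  proof -
    have mem: "c j u \<in> mspace \<Gamma>" using ray_system_mem[OF rs j, of u] u \<epsilon> \<rho> by simp
    have "c j u \<notin> vertices \<Gamma>" using notB[OF u] by (simp add: B_def)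
    then obtain \<gamma> L where gL: "(\<gamma>, L) \<in> T" "c j u \<in> \<gamma> ` {0..L}" using cov[OF mem] by blast
    then obtain w where w: "0 \<le> w" "w \<le> L" "c j u = \<gamma> w" by auto
    have "c j u \<noteq> \<gamma> 0" "c j u \<noteq> \<gamma> L" using notB[OF u] gL(1) by (force simp: B_def)+
    then have w': "0 < w" "w < L" using w by (auto simp: less_le)
    obtain m :: int where m: "\<forall>t \<in> {0..L}. f (\<gamma> t) = f (\<gamma> 0) + of_int m * t" using Tseg(2)[OF gL(1)] by blast
    show ?thesis
      by (rule segment_affine_on_ray[OF rs j _ _ Tseg(1)[OF gL(1)] w' w(3) m]) (use u \<epsilon> in auto)
  qed
  obtain m :: int where m: "\<And>u v. 0 < u \<Longrightarrow> u \<le> v \<Longrightarrow> v < \<epsilon> \<Longrightarrow> f (c j v) = f (c j u) + of_int m * (v - u)"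
    using affine_if_locally_affine[of 0 \<epsilon> "\<lambda>u. f (c j u)"] loc by blast
  have lim: "((\<lambda>u. f (c j u)) \<longlongrightarrow> f P) (at_right 0)"
  proof -
    have cont: "continuous_map (mtopology_of \<Gamma>) euclideanreal f" using rat by (simp add: rational_function_def)
    have "limitin (mtopology_of \<Gamma>) (c j) P (at_right 0)"
      unfolding mtopology_of_def M.limitin_metric
    proof (intro conjI allI impI)
      show "P \<in> mspace \<Gamma>" using ray_system_basic[OF rs] by simp
      fix e :: real assume "e > 0"
      then show "\<forall>\<^sub>F u in at_right 0. c j u \<in> mspace \<Gamma> \<and> mdist \<Gamma> (c j u) P < e"
        unfolding eventually_at_right_field using \<rho> ray_system_mem[OF rs j] ray_system_dist_origin[OF rs j]
        by (intro exI[of _ "min e \<rho>"]) (auto simp: M.commute)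
    qed
    from continuous_map_limit[OF cont this]
    show ?thesis by (simp add: o_def)
  qed
  define u0 where "u0 = \<epsilon> / 2"
  have u0: "0 < u0" "u0 < \<epsilon>" using \<epsilon> by (auto simp: u0_def)
  have f0: "f (c j u) = f (c j u0) + of_int m * (u - u0)" if "0 < u" "u < \<epsilon>" for u
  proof (cases "u \<le> u0")
    case True
    have "f (c j u0) = f (c j u) + of_int m * (u0 - u)" by (rule m) (use True that u0 in auto)
    then show ?thesis by (simp add: algebra_simps)
  next
    case False
    show ?thesis by (rule m) (use False that u0 in auto)
  qed
  have "((\<lambda>u. f (c j u)) \<longlongrightarrow> f (c j u0) + of_int m * (0 - u0)) (at_right 0)"
  proof (rule Lim_transform_eventually)
    show "((\<lambda>u. f (c j u0) + of_int m * (u - u0)) \<longlongrightarrow> f (c j u0) + of_int m * (0 - u0)) (at_right 0)"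
      by (intro tendsto_intros)
    show "\<forall>\<^sub>F u in at_right 0. f (c j u0) + of_int m * (u - u0) = f (c j u)"
      unfolding eventually_at_right_field using f0 \<epsilon>(1) by (intro exI[of _ \<epsilon>]) auto
  qed
  then have P0: "f P = f (c j u0) + of_int m * (0 - u0)"
    using lim tendsto_unique[of "at_right (0::real)"] by (metis trivial_limit_at_right_real)
  show ?thesis
  proof (intro exI[of _ m] exI[of _ u0] conjI allI impI u0(1))
    fix u assume "0 \<le> u \<and> u \<le> u0"
    then show "f (c j u) = f P + of_int m * u"
      using f0[of u] P0 u0(2) ray_system_origin[OF rs j] by (cases "u = 0") (simp_all add: algebra_simps)
  qed
qed

section \<open>Functions on the circle\<close>

lemma Ints_unit_interval_eq:
  fixes x y :: real
  assumes "0 \<le> x" "x < 1" "0 \<le> y" "y < 1" "x - y \<in> \<int>"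
  shows "x = y"
proof -
  obtain m :: int where "x - y = of_int m" using assms(5) by (auto elim: Ints_cases)
  then have "m = 0" using assms by linarith
  then show ?thesis using \<open>x - y = of_int m\<close> by simp
qed

lemma Ints_diff_cong: "x - y \<in> \<int> \<Longrightarrow> x \<in> \<int> \<longleftrightarrow> y \<in> (\<int> :: real set)"
  using Ints_diff[of x "x - y"] Ints_add[of "x - y" y] by auto

text \<open>The distance of \<open>x\<close> to 0 in \<open>\<real>/\<int>\<close>.\<close>

definition circle_norm :: "real \<Rightarrow> real" where
  "circle_norm x = \<bar>x - of_int (round x)\<bar>"

lemma circle_norm_le: "circle_norm x \<le> \<bar>x - of_int m\<bar>"
  unfolding circle_norm_def by (rule round_diff_minimal)

lemma circle_norm_nonneg [simp]: "0 \<le> circle_norm x"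
  by (simp add: circle_norm_def)

lemma circle_norm_le_abs: "circle_norm x \<le> \<bar>x\<bar>"
  using circle_norm_le[of x 0] by simp

lemma circle_norm_triangle: "circle_norm (x + y) \<le> circle_norm x + circle_norm y"
proof -
  have "circle_norm (x + y) \<le> \<bar>x + y - of_int (round x + round y)\<bar>" by (rule circle_norm_le)
  also have "\<dots> \<le> circle_norm x + circle_norm y" unfolding circle_norm_def by simp
  finally show ?thesis .
qed

lemma circle_norm_minus_le: "circle_norm (- x) \<le> circle_norm x"
  using circle_norm_le[of "-x" "- round x"] by (simp add: circle_norm_def)

lemma circle_norm_minus [simp]: "circle_norm (- x) = circle_norm x"
  using circle_norm_minus_le[of x] circle_norm_minus_le[of "-x"] by simp

lemma circle_norm_commute: "circle_norm (x - y) = circle_norm (y - x)"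
  using circle_norm_minus[of "x - y"] by simp

lemma circle_norm_eq_0_iff: "circle_norm x = 0 \<longleftrightarrow> x \<in> \<int>"
proof
  show "circle_norm x = 0 \<Longrightarrow> x \<in> \<int>" unfolding circle_norm_def
    by (metis Ints_of_int abs_eq_0 eq_iff_diff_eq_0)
  show "x \<in> \<int> \<Longrightarrow> circle_norm x = 0"
    by (auto simp: circle_norm_def elim!: Ints_cases)
qed

lemma circle_norm_cong: assumes "x - y \<in> \<int>" shows "circle_norm x = circle_norm y"
proof -
  have "circle_norm (y - x) = 0" "circle_norm (x - y) = 0"
    using assms circle_norm_eq_0_iff circle_norm_commute by metis+
  then show ?thesis
    using circle_norm_triangle[of "x - y" y] circle_norm_triangle[of "y - x" x] by simp
qed

lemma circle_norm_eq_abs: assumes "\<bar>x\<bar> \<le> 1/2" shows "circle_norm x = \<bar>x\<bar>"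
proof (rule antisym[OF circle_norm_le_abs])
  show "\<bar>x\<bar> \<le> circle_norm x"
  proof (cases "round x = 0")
    case False
    then have "1 \<le> \<bar>real_of_int (round x)\<bar>" by linarith
    then show ?thesis using assms unfolding circle_norm_def by linarith
  qed (simp add: circle_norm_def)
qed

text \<open>
  Both slopes are outgoing, as in the definition of the divisor of a function; so \<open>a + b\<close> is the
  contribution of \<open>t\<close> to the divisor, and it vanishes where \<open>F\<close> is affine.
\<close>

definition pl_germ :: "(real \<Rightarrow> real) \<Rightarrow> real \<Rightarrow> int \<Rightarrow> int \<Rightarrow> bool" where
  "pl_germ F t a b \<longleftrightarrow> (\<exists>\<epsilon>>0. \<forall>u. 0 \<le> u \<and> u \<le> \<epsilon> \<longrightarrow>
      F (t + u) = F t + of_int a * u \<and> F (t - u) = F t + of_int b * u)"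

lemma pl_germ_unique:
  assumes "pl_germ F t a b" "pl_germ F t a' b'"
  shows "a = a'" "b = b'"
proof -
  obtain \<epsilon> \<epsilon>' where e: "\<epsilon> > 0" "\<epsilon>' > 0"
    "\<forall>u. 0 \<le> u \<and> u \<le> \<epsilon> \<longrightarrow> F (t + u) = F t + of_int a * u \<and> F (t - u) = F t + of_int b * u"
    "\<forall>u. 0 \<le> u \<and> u \<le> \<epsilon>' \<longrightarrow> F (t + u) = F t + of_int a' * u \<and> F (t - u) = F t + of_int b' * u"
    using assms unfolding pl_germ_def by blast
  define u where "u = min \<epsilon> \<epsilon>'"
  have u: "0 < u" "u \<le> \<epsilon>" "u \<le> \<epsilon>'" using e(1,2) by (auto simp: u_def)
  have "F t + of_int a * u = F t + of_int a' * u" "F t + of_int b * u = F t + of_int b' * u"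
    using spec[OF e(3), of u] spec[OF e(4), of u] u by (metis less_imp_le)+
  then show "a = a'" "b = b'" using u by simp_all
qed

text \<open>
  The jumps telescope to the difference of the slopes at the two ends. The second sum is summation by
  parts: jumps paired with positions give boundary terms minus the increments of \<open>F\<close>. Both identities are
  additive under subdivision and evident on an interval where \<open>F\<close> has at most one break, so compactness yields
  them, together with the finiteness of the set of breaks.
\<close>

lemma slope_jump_sums:
  fixes F :: "real \<Rightarrow> real" and a b :: "real \<Rightarrow> int"
  assumes germ: "\<And>t. pl_germ F t (a t) (b t)" and xy: "x < y"
  defines "jumps \<equiv> \<lambda>x y. {t\<in>{x<..<y}. a t + b t \<noteq> 0}"
  shows "finite (jumps x y) \<and> (\<Sum>t\<in>jumps x y. a t + b t) = - b y - a x \<and>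
     (\<Sum>t\<in>jumps x y. of_int (a t + b t) * t) = - (of_int (b y) * y) - of_int (a x) * x - (F y - F x)"
proof -
  define P where "P x y \<longleftrightarrow> (x < y \<longrightarrow> finite (jumps x y) \<and> (\<Sum>t\<in>jumps x y. a t + b t) = - b y - a x \<and>
     (\<Sum>t\<in>jumps x y. of_int (a t + b t) * t) = - (of_int (b y) * y) - of_int (a x) * x - (F y - F x))" for x y
  have "P x y" using less_imp_le[OF xy]
  proof (induct rule: Bolzano)
    case (trans x y z)
    show ?case
    proof (cases "x = y \<or> y = z")
      case True
      with trans show ?thesis by auto
    next
      case False
      then have xyz: "x < y" "y < z" using trans by auto
      have S: "finite (jumps x y)" "finite (jumps y z)" using trans xyz by (auto simp: P_def)
      let ?U = "insert y (jumps x y \<union> jumps y z)"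
      have sub: "jumps x z \<subseteq> ?U" by (auto simp: jumps_def)
      have z: "\<forall>t \<in> ?U - jumps x z. a t + b t = 0" using xyz by (auto simp: jumps_def)
      have dis: "y \<notin> jumps x y \<union> jumps y z" "jumps x y \<inter> jumps y z = {}" by (auto simp: jumps_def)
      have s: "sum h (jumps x z) = h y + (sum h (jumps x y) + sum h (jumps y z))"
        if "\<And>t. a t + b t = 0 \<Longrightarrow> h t = 0" for h :: "real \<Rightarrow> 'b::comm_monoid_add"
      proof -
        have "sum h (jumps x z) = sum h ?U"
          by (rule sum.mono_neutral_left) (use S sub z that in auto)
        also have "\<dots> = h y + sum h (jumps x y \<union> jumps y z)"
          by (rule sum.insert) (use S dis in auto)
        also have "sum h (jumps x y \<union> jumps y z) = sum h (jumps x y) + sum h (jumps y z)"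
          by (rule sum.union_disjoint) (use S dis in auto)
        finally show ?thesis .
      qed
      have "finite (jumps x z)" using S sub finite_subset by blast
      moreover have "(\<Sum>t\<in>jumps x z. a t + b t) = - b z - a x"
        using trans(1,2) xyz by (subst s) (auto simp: P_def)
      moreover have "(\<Sum>t\<in>jumps x z. of_int (a t + b t) * t) = - (of_int (b z) * z) - of_int (a x) * x - (F z - F x)"
        using trans(1,2) xyz by (subst s) (auto simp: P_def algebra_simps)
      ultimately show ?thesis by (simp add: P_def)
    qed
  next
    case (local p)
    obtain \<epsilon> where e: "\<epsilon> > 0"
      "\<And>u. 0 \<le> u \<Longrightarrow> u \<le> \<epsilon> \<Longrightarrow> F (p + u) = F p + of_int (a p) * u"
      "\<And>u. 0 \<le> u \<Longrightarrow> u \<le> \<epsilon> \<Longrightarrow> F (p - u) = F p + of_int (b p) * u"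
      using germ[of p] unfolding pl_germ_def by blast
    have right: "a t = a p \<and> b t = - a p" if t: "p < t" "t < p + \<epsilon>" for t
    proof -
      have "pl_germ F t (a p) (- a p)" unfolding pl_germ_def
      proof (intro exI[of _ "min (t - p) (p + \<epsilon> - t)"] conjI allI impI)
        show "0 < min (t - p) (p + \<epsilon> - t)" using t by simp
        fix u assume u: "0 \<le> u \<and> u \<le> min (t - p) (p + \<epsilon> - t)"
        have "F t = F p + of_int (a p) * (t - p)" using e(2)[of "t - p"] t by simp
        moreover have "F (t + u) = F p + of_int (a p) * (t + u - p)" using e(2)[of "t + u - p"] t u by simp
        moreover have "F (t - u) = F p + of_int (a p) * (t - u - p)" using e(2)[of "t - u - p"] t u by simp
        ultimately show "F (t + u) = F t + of_int (a p) * u" "F (t - u) = F t + of_int (- a p) * u"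
          by (simp_all add: algebra_simps)
      qed
      then show ?thesis using pl_germ_unique[OF germ] by metis
    qed
    have left: "a t = - b p \<and> b t = b p" if t: "t < p" "p - \<epsilon> < t" for t
    proof -
      have "pl_germ F t (- b p) (b p)" unfolding pl_germ_def
      proof (intro exI[of _ "min (p - t) (t - (p - \<epsilon>))"] conjI allI impI)
        show "0 < min (p - t) (t - (p - \<epsilon>))" using t by simp
        fix u assume u: "0 \<le> u \<and> u \<le> min (p - t) (t - (p - \<epsilon>))"
        have "F t = F p + of_int (b p) * (p - t)" using e(3)[of "p - t"] t by simp
        moreover have "F (t + u) = F p + of_int (b p) * (p - (t + u))" using e(3)[of "p - (t + u)"] t u by simp
        moreover have "F (t - u) = F p + of_int (b p) * (p - (t - u))" using e(3)[of "p - (t - u)"] t u by simp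
        ultimately show "F (t + u) = F t + of_int (- b p) * u" "F (t - u) = F t + of_int (b p) * u"
          by (simp_all add: algebra_simps)
      qed
      then show ?thesis using pl_germ_unique[OF germ] by metis
    qed
    show ?case
    proof (intro exI[of _ \<epsilon>] conjI allI impI e(1))
      fix x y assume xy: "x \<le> p \<and> p \<le> y \<and> y - x < \<epsilon>"
      have Fx: "F x = F p + of_int (b p) * (p - x)" using e(3)[of "p - x"] xy by simp
      have Fy: "F y = F p + of_int (a p) * (y - p)" using e(2)[of "y - p"] xy by simp
      have sub: "jumps x y \<subseteq> {p} \<inter> {x<..<y}"
      proof
        fix t assume t: "t \<in> jumps x y"
        show "t \<in> {p} \<inter> {x<..<y}"
          using right[of t] left[of t] t xy by (cases t p rule: linorder_cases) (auto simp: jumps_def)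
      qed
      have ay: "b y = - a p" if "p < y" using right[of y] that xy by simp
      have bx: "a x = - b p" if "x < p" using left[of x] that xy by simp
      show "P x y" unfolding P_def
      proof (intro impI)
        assume "x < y"
        have fin: "finite (jumps x y)" using sub finite_subset by blast
        show "finite (jumps x y) \<and> (\<Sum>t\<in>jumps x y. a t + b t) = - b y - a x \<and>
          (\<Sum>t\<in>jumps x y. of_int (a t + b t) * t) = - (of_int (b y) * y) - of_int (a x) * x - (F y - F x)"
        proof (cases "x < p \<and> p < y")
          case True
          have s: "sum h (jumps x y) = h p" if "a p + b p = 0 \<Longrightarrow> h p = 0" for h :: "real \<Rightarrow> 'b::comm_monoid_add"
          proof (cases "a p + b p = 0")
            case z: True
            have "p \<notin> jumps x y" using z by (simp add: jumps_def)
            then have "jumps x y = {}" using sub by blast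
            then show ?thesis using that z by simp
          next
            case False
            then have "p \<in> jumps x y" using True by (simp add: jumps_def)
            then have "jumps x y = {p}" using sub by blast
            then show ?thesis by simp
          qed
          have 1: "(\<Sum>t\<in>jumps x y. a t + b t) = a p + b p" by (rule s) simp
          have 2: "(\<Sum>t\<in>jumps x y. of_int (a t + b t) * t) = of_int (a p + b p) * p" by (rule s) simp
          show ?thesis unfolding 1 2 using fin Fx Fy ay bx True by (simp add: algebra_simps)
        next
          case False
          then have "x = p \<and> p < y \<or> x < p \<and> p = y" using xy \<open>x < y\<close> by auto
          moreover have "jumps x y = {}" using sub False by auto
          ultimately show ?thesis using Fx Fy ay bx by (auto simp: algebra_simps)
        qed
      qed
    qed
  qed
  with xy show ?thesis by (simp add: P_def)
qed

text \<open>
  On a full period the boundary terms cancel in the first sum; in the second sum they reduce to the integer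
  slope at the end of the period.
\<close>

lemma circle_jump_sums:
  fixes F :: "real \<Rightarrow> real" and a b :: "real \<Rightarrow> int"
  assumes germ: "\<And>t. pl_germ F t (a t) (b t)" and per: "\<And>t. F (t + 1) = F t"
  defines "T \<equiv> {t\<in>{0..<1}. a t + b t \<noteq> 0}"
  shows "finite T" "(\<Sum>t\<in>T. a t + b t) = 0" "(\<Sum>t\<in>T. of_int (a t + b t) * t) \<in> \<int>"
proof -
  define S where "S = {t\<in>{0<..<1}. a t + b t \<noteq> 0}"
  have s: "finite S" "(\<Sum>t\<in>S. a t + b t) = - b 1 - a 0"
    "(\<Sum>t\<in>S. of_int (a t + b t) * t) = - of_int (b 1) - (F 1 - F 0)"
    using slope_jump_sums[of F a b 0 1] germ unfolding S_def by simp_all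
  have per': "F (1 - u) = F (- u)" "F (1 + u) = F u" for u using per[of "-u"] per[of u] by (simp_all add: add.commute)
  have "pl_germ F 0 (a 1) (b 1)" using germ[of 1] per[of 0] unfolding pl_germ_def per' by simp
  then have 1: "a 1 = a 0" "b 1 = b 0" using pl_germ_unique[OF germ] by metis+
  have sub: "T \<subseteq> insert 0 S" and zero: "\<forall>t\<in>insert 0 S - T. a t + b t = 0"
    by (auto simp: T_def S_def)
  show fin: "finite T" using s sub finite_subset by blast
  have "(\<Sum>t\<in>T. a t + b t) = (\<Sum>t\<in>insert 0 S. a t + b t)"
    by (rule sum.mono_neutral_left) (use s sub zero in auto)
  also have "\<dots> = 0" using s 1 by (subst sum.insert) (auto simp: S_def)
  finally show "(\<Sum>t\<in>T. a t + b t) = 0" .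
  have "(\<Sum>t\<in>T. of_int (a t + b t) * t) = (\<Sum>t\<in>insert 0 S. of_int (a t + b t) * t)"
    by (rule sum.mono_neutral_left) (use s sub zero in auto)
  also have "\<dots> = (\<Sum>t\<in>S. of_int (a t + b t) * t)" using s by (subst sum.insert) (auto simp: S_def)
  also have "\<dots> = of_int (- b 1)" using s per[of 0] by simp
  finally show "(\<Sum>t\<in>T. of_int (a t + b t) * t) \<in> \<int>" by (metis Ints_of_int)
qed

text \<open>
  The Green function of the circle, up to a constant: its second derivative is \<open>1\<close> minus the Dirac
  distribution at the integers. In a combination whose coefficients sum to 0 the quadratic parts cancel,
  leaving a piecewise affine function with prescribed jumps.
\<close>

definition circle_green :: "real \<Rightarrow> real" where
  "circle_green x = (frac x)\<^sup>2 / 2 - frac x / 2"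

lemma circle_green_right:
  "\<exists>\<epsilon>>0. \<forall>u. 0 \<le> u \<and> u \<le> \<epsilon> \<longrightarrow>
     circle_green (t + u) = circle_green t + (frac t - 1/2) * u + u\<^sup>2 / 2"
proof (intro exI[of _ "(1 - frac t) / 2"] conjI allI impI)
  have f: "0 \<le> frac t" "frac t < 1" by (simp_all add: frac_lt_1)
  then show "0 < (1 - frac t) / 2" by simp
  fix u assume u: "0 \<le> u \<and> u \<le> (1 - frac t) / 2"
  have "frac (t + u) = frac t + u"
    using f u by (subst frac_unique_iff) (auto simp: frac_def)
  then show "circle_green (t + u) = circle_green t + (frac t - 1/2) * u + u\<^sup>2 / 2"
    by (simp add: circle_green_def power2_eq_square field_simps)
qed

text \<open>
  Approaching an integer from the left, the fractional part tends to 1; this is the source of the jump.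
\<close>

lemma circle_green_left:
  "\<exists>\<epsilon>>0. \<forall>u. 0 \<le> u \<and> u \<le> \<epsilon> \<longrightarrow>
     circle_green (t - u) = circle_green t - ((if t \<in> \<int> then 1 else frac t) - 1/2) * u + u\<^sup>2 / 2"
proof (cases "t \<in> \<int>")
  case True
  show ?thesis
  proof (intro exI[of _ "1/2"] conjI allI impI)
    fix u :: real assume u: "0 \<le> u \<and> u \<le> 1/2"
    show "circle_green (t - u) = circle_green t - ((if t \<in> \<int> then 1 else frac t) - 1/2) * u + u\<^sup>2 / 2"
    proof (cases "u = 0")
      case False
      have "frac (t - u) = 1 - u"
        using True u False by (subst frac_unique_iff) auto
      moreover have "frac t = 0" using True by (simp add: frac_eq_0_iff)
      ultimately have fr: "frac (t - u) = 1 - u" "frac t = 0" by auto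
      show ?thesis using True unfolding circle_green_def fr by (simp add: power2_eq_square field_simps)
    qed simp
  qed simp
next
  case False
  have f: "0 < frac t" "frac t < 1" using False by (simp_all add: frac_lt_1 frac_gt_0_iff)
  show ?thesis
  proof (intro exI[of _ "frac t"] conjI allI impI f(1))
    fix u assume u: "0 \<le> u \<and> u \<le> frac t"
    have fr: "frac (t - u) = frac t - u"
      using f u by (subst frac_unique_iff) (auto simp: frac_def)
    show "circle_green (t - u) = circle_green t - ((if t \<in> \<int> then 1 else frac t) - 1/2) * u + u\<^sup>2 / 2"
      using False unfolding circle_green_def fr by (simp add: power2_eq_square field_simps)
  qed
qed

lemma finite_common_radius:
  assumes "finite K" "\<And>k. k \<in> K \<Longrightarrow> \<exists>\<epsilon>>0::real. \<forall>u. 0 \<le> u \<and> u \<le> \<epsilon> \<longrightarrow> Q k u"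
  shows "\<exists>\<epsilon>>0. \<forall>k\<in>K. \<forall>u. 0 \<le> u \<and> u \<le> \<epsilon> \<longrightarrow> Q k u"
  using assms
proof (induct K)
  case empty
  show ?case by (intro exI[of _ 1]) auto
next
  case (insert k K)
  obtain e where e: "e > 0" "\<forall>k\<in>K. \<forall>u. 0 \<le> u \<and> u \<le> e \<longrightarrow> Q k u" using insert by blast
  obtain e' where e': "e' > 0" "\<forall>u. 0 \<le> u \<and> u \<le> e' \<longrightarrow> Q k u" using insert by blast
  show ?case using e e' by (intro exI[of _ "min e e'"]) auto
qed

text \<open>
  The right slope at \<open>t\<close> is \<open>\<Sum>k. n k * frac (t - q k)\<close>. Writing the fractional part as
  \<open>t - q k\<close> minus an integer, the first condition removes \<open>t\<close> and the second one makes the rest an integer.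
\<close>

lemma circle_green_sum_germ:
  fixes n :: "'k \<Rightarrow> int" and q :: "'k \<Rightarrow> real"
  assumes K: "finite K" "(\<Sum>k\<in>K. n k) = 0" "(\<Sum>k\<in>K. of_int (n k) * q k) \<in> \<int>"
  shows "\<exists>a b. pl_germ (\<lambda>x. \<Sum>k\<in>K. of_int (n k) * circle_green (x - q k)) t a b \<and>
           a + b = - (\<Sum>k\<in>{k\<in>K. t - q k \<in> \<int>}. n k)"
proof -
  let ?F = "\<lambda>x. \<Sum>k\<in>K. of_int (n k) * circle_green (x - q k)"
  obtain m :: int where m: "(\<Sum>k\<in>K. of_int (n k) * q k) = of_int m" using K(3) by (auto elim: Ints_cases)
  define a where "a = - m - (\<Sum>k\<in>K. n k * \<lfloor>t - q k\<rfloor>)"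
  define J where "J = (\<Sum>k\<in>{k\<in>K. t - q k \<in> \<int>}. n k)"
  have n0: "(\<Sum>k\<in>K. real_of_int (n k)) = 0" using K(2) by (metis of_int_0 of_int_sum)
  have a: "real_of_int a = (\<Sum>k\<in>K. of_int (n k) * frac (t - q k))"
  proof -
    have "(\<Sum>k\<in>K. of_int (n k) * frac (t - q k))
       = (\<Sum>k\<in>K. of_int (n k) * t - of_int (n k) * q k - of_int (n k) * of_int \<lfloor>t - q k\<rfloor>)"
      by (simp add: frac_def algebra_simps)
    also have "\<dots> = (\<Sum>k\<in>K. real_of_int (n k)) * t - of_int m - (\<Sum>k\<in>K. of_int (n k) * of_int \<lfloor>t - q k\<rfloor>)"
      by (simp only: sum_subtractf m sum_distrib_right)
    finally show ?thesis by (simp add: n0 a_def)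
  qed
  have J: "real_of_int J = (\<Sum>k\<in>K. if t - q k \<in> \<int> then of_int (n k) else 0)"
    unfolding J_def of_int_sum using K(1) by (rule sum.inter_filter)
  have b: "real_of_int (- a - J) = - (\<Sum>k\<in>K. of_int (n k) * (if t - q k \<in> \<int> then 1 else frac (t - q k)))"
  proof -
    have "(\<Sum>k\<in>K. of_int (n k) * (if t - q k \<in> \<int> then 1 else frac (t - q k)))
      = (\<Sum>k\<in>K. of_int (n k) * frac (t - q k) + (if t - q k \<in> \<int> then of_int (n k) else 0))"
      by (intro sum.cong refl) (auto simp: frac_eq_0_iff)
    also have "\<dots> = of_int a + of_int J"
      by (simp add: sum.distrib a J)
    finally show ?thesis by simp
  qed
  have "\<exists>\<epsilon>>0. \<forall>k\<in>K. \<forall>u. 0 \<le> u \<and> u \<le> \<epsilon> \<longrightarrow>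
     circle_green (t - q k + u) = circle_green (t - q k) + (frac (t - q k) - 1/2) * u + u\<^sup>2 / 2"
    by (rule finite_common_radius[OF K(1)]) (rule circle_green_right)
  then obtain e1 where e1: "e1 > 0" "\<forall>k\<in>K. \<forall>u. 0 \<le> u \<and> u \<le> e1 \<longrightarrow>
     circle_green (t - q k + u) = circle_green (t - q k) + (frac (t - q k) - 1/2) * u + u\<^sup>2 / 2"
    by (elim exE conjE)
  have "\<exists>\<epsilon>>0. \<forall>k\<in>K. \<forall>u. 0 \<le> u \<and> u \<le> \<epsilon> \<longrightarrow>
     circle_green (t - q k - u) = circle_green (t - q k) - ((if t - q k \<in> \<int> then 1 else frac (t - q k)) - 1/2) * u + u\<^sup>2 / 2"
    by (rule finite_common_radius[OF K(1)]) (rule circle_green_left)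
  then obtain e2 where e2: "e2 > 0" "\<forall>k\<in>K. \<forall>u. 0 \<le> u \<and> u \<le> e2 \<longrightarrow>
     circle_green (t - q k - u) = circle_green (t - q k) - ((if t - q k \<in> \<int> then 1 else frac (t - q k)) - 1/2) * u + u\<^sup>2 / 2"
    by (elim exE conjE)
  have "pl_germ ?F t a (- a - J)" unfolding pl_germ_def
  proof (intro exI[of _ "min e1 e2"] conjI allI impI)
    show "0 < min e1 e2" using e1 e2 by simp
    fix u assume u: "0 \<le> u \<and> u \<le> min e1 e2"
    have "?F (t + u) = (\<Sum>k\<in>K. of_int (n k) * circle_green (t - q k) + of_int (n k) * frac (t - q k) * u
          + of_int (n k) * (u\<^sup>2 / 2 - u / 2))"
    proof (intro sum.cong refl)
      fix k assume k: "k \<in> K"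
      have eq: "circle_green (t + u - q k) = circle_green (t - q k) + (frac (t - q k) - 1/2) * u + u\<^sup>2 / 2"
      proof -
        have "t + u - q k = t - q k + u" by simp
        then show ?thesis using bspec[OF e1(2) k, THEN spec, of u] u by (simp only:) simp
      qed
      show "of_int (n k) * circle_green (t + u - q k) = of_int (n k) * circle_green (t - q k) +
         of_int (n k) * frac (t - q k) * u + of_int (n k) * (u\<^sup>2 / 2 - u / 2)" unfolding eq by (simp add: algebra_simps)
    qed
    then show "?F (t + u) = ?F t + of_int a * u"
      unfolding a sum.distrib by (simp add: n0 flip: sum_distrib_right)
    have "?F (t - u) = (\<Sum>k\<in>K. of_int (n k) * circle_green (t - q k)
          - of_int (n k) * (if t - q k \<in> \<int> then 1 else frac (t - q k)) * u
          + of_int (n k) * (u\<^sup>2 / 2 + u / 2))"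
    proof (intro sum.cong refl)
      fix k assume k: "k \<in> K"
      have eq: "circle_green (t - u - q k) = circle_green (t - q k) - ((if t - q k \<in> \<int> then 1 else frac (t - q k)) - 1/2) * u + u\<^sup>2 / 2"
      proof -
        have "t - u - q k = t - q k - u" by simp
        then show ?thesis using bspec[OF e2(2) k, THEN spec, of u] u by (simp only:) simp
      qed
      show "of_int (n k) * circle_green (t - u - q k) = of_int (n k) * circle_green (t - q k) -
         of_int (n k) * (if t - q k \<in> \<int> then 1 else frac (t - q k)) * u + of_int (n k) * (u\<^sup>2 / 2 + u / 2)"
        unfolding eq by (simp add: algebra_simps)
    qed
    then show "?F (t - u) = ?F t + of_int (- a - J) * u"
      unfolding b sum.distrib sum_subtractf
      by (simp add: n0 flip: sum_distrib_right)
  qed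
  then show ?thesis by (intro exI[of _ a] exI[of _ "- a - J"]) (simp add: J_def)
qed

lemma pl_germ_add_const:
  assumes "pl_germ G t a b" "\<And>x. F x = G x + c" shows "pl_germ F t a b"
  using assms unfolding pl_germ_def by auto

section \<open>Divisors and sums over them\<close>

lemma divisor_sum_superset:
  fixes \<phi> :: "'a \<Rightarrow> 'b::ring_1"
  assumes "finite K" "Poly_Mapping.keys D \<subseteq> K"
  shows "(\<Sum>P\<in>Poly_Mapping.keys D. of_int (Poly_Mapping.lookup D P) * \<phi> P) =
     (\<Sum>P\<in>K. of_int (Poly_Mapping.lookup D P) * \<phi> P)"
  by (rule sum.mono_neutral_left) (use assms in \<open>auto simp: in_keys_iff\<close>)

text \<open>
  The degree and the coordinate sums that classify divisors up to equivalence are both of this form.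
\<close>

definition divisor_sum :: "('a \<Rightarrow> 'b::comm_ring_1) \<Rightarrow> 'a divisor \<Rightarrow> 'b" where
  "divisor_sum \<phi> D = (\<Sum>P\<in>Poly_Mapping.keys D. of_int (Poly_Mapping.lookup D P) * \<phi> P)"

lemma divisor_sum_eq:
  assumes "finite K" "Poly_Mapping.keys D \<subseteq> K"
  shows "divisor_sum \<phi> D = (\<Sum>P\<in>K. of_int (Poly_Mapping.lookup D P) * \<phi> P)"
  unfolding divisor_sum_def using assms by (rule divisor_sum_superset)

lemma divisor_sum_add: "divisor_sum \<phi> (D + E) = divisor_sum \<phi> D + divisor_sum \<phi> E"
proof -
  let ?K = "Poly_Mapping.keys D \<union> Poly_Mapping.keys E"
  have "Poly_Mapping.keys (D + E) \<subseteq> ?K" by (rule Poly_Mapping.keys_add)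
  then show ?thesis
    by (simp add: divisor_sum_eq[of ?K] lookup_add algebra_simps sum.distrib)
qed

lemma divisor_sum_0 [simp]: "divisor_sum \<phi> 0 = 0"
  by (simp add: divisor_sum_def)

lemma divisor_sum_diff: "divisor_sum \<phi> (D - E) = divisor_sum \<phi> D - divisor_sum \<phi> E"
  using divisor_sum_add[of \<phi> "D - E" E] by simp

lemma divisor_sum_single [simp]: "divisor_sum \<phi> (Poly_Mapping.single P n) = of_int n * \<phi> P"
  by (simp add: divisor_sum_def)

lemma divisor_sum_sum: "divisor_sum \<phi> (\<Sum>i\<in>I. D i) = (\<Sum>i\<in>I. divisor_sum \<phi> (D i))"
  by (induct I rule: infinite_finite_induct) (simp_all add: divisor_sum_add)

lemma divisor_degree_eq: "divisor_degree D = divisor_sum (\<lambda>_. 1) D"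
  by (simp add: divisor_degree_def divisor_sum_def)

lemma of_int_divisor_degree: "of_int (divisor_degree D) = (divisor_sum (\<lambda>_. 1) D :: 'b::comm_ring_1)"
  by (simp add: divisor_degree_def divisor_sum_def)

lemma effective_add: "effective D \<Longrightarrow> effective E \<Longrightarrow> effective (D + E)"
  by (simp add: effective_def lookup_add)

lemma effective_single: "0 \<le> n \<Longrightarrow> effective (Poly_Mapping.single P n)"
  by (simp add: effective_def lookup_single when_def)

lemma effective_sum: "(\<And>i. i \<in> I \<Longrightarrow> effective (D i)) \<Longrightarrow> effective (\<Sum>i\<in>I. D i)"
  by (simp add: effective_def lookup_sum sum_nonneg)

lemma divisor_on_add: "divisor_on \<Gamma> D \<Longrightarrow> divisor_on \<Gamma> E \<Longrightarrow> divisor_on \<Gamma> (D + E)"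
  using Poly_Mapping.keys_add[of D E] by (auto simp: divisor_on_def)

lemma divisor_on_diff: "divisor_on \<Gamma> D \<Longrightarrow> divisor_on \<Gamma> E \<Longrightarrow> divisor_on \<Gamma> (D - E)"
  using keys_diff[of D E] by (auto simp: divisor_on_def)

lemma divisor_on_single: "P \<in> mspace \<Gamma> \<Longrightarrow> divisor_on \<Gamma> (Poly_Mapping.single P n)"
  by (simp add: divisor_on_def)

lemma divisor_on_sum: "(\<And>i. i \<in> I \<Longrightarrow> divisor_on \<Gamma> (D i)) \<Longrightarrow> divisor_on \<Gamma> (\<Sum>i\<in>I. D i)"
  by (induct I rule: infinite_finite_induct) (simp_all add: divisor_on_add, simp_all add: divisor_on_def)

lemma divisor_degree_add: "divisor_degree (D + E) = divisor_degree D + divisor_degree E"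
  by (simp add: divisor_degree_eq divisor_sum_add)

lemma divisor_degree_diff: "divisor_degree (D - E) = divisor_degree D - divisor_degree E"
  by (simp add: divisor_degree_eq divisor_sum_diff)

lemma divisor_degree_single [simp]: "divisor_degree (Poly_Mapping.single P n) = n"
  by (simp add: divisor_degree_eq)

lemma divisor_degree_sum: "divisor_degree (\<Sum>i\<in>I. D i) = (\<Sum>i\<in>I. divisor_degree (D i))"
  by (simp add: divisor_degree_eq divisor_sum_sum)

lemma effective_degree_nonneg: "effective D \<Longrightarrow> 0 \<le> divisor_degree D"
  by (simp add: divisor_degree_def effective_def sum_nonneg)

section \<open>A circle with circles_through attached to it\<close>

text \<open>
  For finite partitions closed pieces are also open, and closedness is what compactness of the arcs of the
  graph provides.
\<close>

lemma connected_components_of_closed_partition: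
  assumes fin: "finite \<A>" and cov: "\<Union>\<A> = topspace X" and dis: "pairwise disjnt \<A>"
    and A: "\<And>A. A \<in> \<A> \<Longrightarrow> A \<noteq> {} \<and> connectedin X A \<and> closedin X A"
  shows "connected_components_of X = \<A>"
proof -
  have uniq: "A = B" if "A \<in> \<A>" "B \<in> \<A>" "x \<in> A" "x \<in> B" for A B x
    using dis that unfolding pairwise_def disjnt_iff by metis
  have op: "openin X A" if "A \<in> \<A>" for A
  proof -
    have "topspace X - A = \<Union>(\<A> - {A})"
      unfolding cov[symmetric] using uniq that by blast
    moreover have "closedin X (\<Union>(\<A> - {A}))" using fin A by (intro closedin_Union) auto
    ultimately show ?thesis using A that by (metis closedin_subset openin_closedin_eq)
  qed
  have eq: "connected_component_of_set X x = A" if "A \<in> \<A>" "x \<in> A" for x A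
  proof
    show "A \<subseteq> connected_component_of_set X x"
      using connected_component_of_maximal A that by metis
    have "connectedin X (connected_component_of_set X x)" by (rule connectedin_connected_component_of)
    then have "connected_component_of_set X x \<subseteq> A \<or> disjnt (connected_component_of_set X x) A"
      using connectedin_clopen_cases A op that by metis
    moreover have "x \<in> connected_component_of_set X x"
      using that cov connected_component_of_refl[of X x] by auto
    ultimately show "connected_component_of_set X x \<subseteq> A" using that by (auto simp: disjnt_iff)
  qed
  show ?thesis
  proof
    show "connected_components_of X \<subseteq> \<A>"
      using eq cov by (fastforce simp: connected_components_of_def)
    show "\<A> \<subseteq> connected_components_of X"
    proof
      fix A assume "A \<in> \<A>"
      then obtain x where "x \<in> A" using A by blast
      with \<open>A \<in> \<A>\<close> have "connected_component_of_set X x = A" "x \<in> topspace X" using eq cov by auto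
      then show "A \<in> connected_components_of X" by (metis connected_component_in_connected_components_of)
    qed
  qed
qed

text \<open>
  A central circle, with index 0, and for \<open>0 < i < g\<close> a loop attached to it at the point \<open>b i\<close>. Requiring an
  attachment at 0 makes the end \<open>1\<close> of the parameter interval of the central circle a vertex, so that no
  edge wraps around it.
\<close>

locale loop_tree =
  fixes g :: nat and b :: "nat \<Rightarrow> real"
  assumes b: "0 \<le> b i" "b i < 1"
    and base: "\<exists>i. 0 < i \<and> i < g \<and> b i = 0"
begin

lemma g_pos: "0 < g" using base by auto

text \<open>
  The pair \<open>(i, t)\<close> is the point with parameter \<open>t\<close> on the circle \<open>i\<close>. The parameter 0 is left out
  for \<open>0 < i\<close> since it denotes the point \<open>(0, b i)\<close> of the central circle.
\<close>

definition pts :: "(nat \<times> real) set" where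
  "pts = {(i, t). i < g \<and> 0 \<le> t \<and> t < 1 \<and> (0 < i \<longrightarrow> 0 < t)}"

text \<open>
  The retraction onto the circle \<open>j\<close>: everything else is mapped to the point at which it hangs on that
  circle, which is 0 on a loop and the attaching point on the central circle.
\<close>

definition coord :: "nat \<Rightarrow> nat \<times> real \<Rightarrow> real" where
  "coord j P = (if fst P = j then snd P else if j = 0 then b (fst P) else 0)"

text \<open>The parametrization of the circle \<open>i\<close> by the real line, with period 1.\<close>

definition loop :: "nat \<Rightarrow> real \<Rightarrow> nat \<times> real" where
  "loop i t = (if 0 < i \<and> frac t = 0 then (0, b i) else (i, frac t))"

definition circles_through :: "nat \<times> real \<Rightarrow> nat set" where
  "circles_through P = {i. i < g \<and> (i = fst P \<or> fst P = 0 \<and> b i = snd P)}"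

text \<open>
  A shortest path between two points moves along each circle once, from one retracted position to the other.
  So the path metric is the metric induced from the \<open>l\<^sup>1\<close> metric on \<open>(\<real>/\<int>)\<^sup>g\<close>.
\<close>

definition gdist :: "nat \<times> real \<Rightarrow> nat \<times> real \<Rightarrow> real" where
  "gdist P Q = (\<Sum>j<g. circle_norm (coord j P - coord j Q))"

definition graph :: "(nat \<times> real) metric" where
  "graph = metric (pts, gdist)"

lemma loop_mem: "i < g \<Longrightarrow> loop i t \<in> pts"
  using b[of i] frac_lt_1[of t] frac_ge_0[of t] g_pos by (auto simp: loop_def pts_def simp del: frac_ge_0)

lemma coord_range: "P \<in> pts \<Longrightarrow> 0 \<le> coord j P" "P \<in> pts \<Longrightarrow> coord j P < 1"
  using b by (auto simp: pts_def coord_def)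

lemma coord_loop_same: "coord i (loop i t) = frac t"
  by (auto simp: loop_def coord_def)

lemma coord_loop_other: "j \<noteq> i \<Longrightarrow> coord j (loop i t) = (if j = 0 then b i else 0)"
  by (auto simp: loop_def coord_def)

lemma coord_loop_other_const: "j \<noteq> i \<Longrightarrow> coord j (loop i t) = coord j (loop i s)"
  by (simp add: coord_loop_other)

lemma loop_cong: "s - t \<in> \<int> \<Longrightarrow> loop i s = loop i t"
proof -
  assume "s - t \<in> \<int>"
  then obtain m :: int where "s - t = of_int m" by (auto elim: Ints_cases)
  then have "s = t + of_int m" by simp
  then have "frac s = frac t" by simp
  then show ?thesis by (simp add: loop_def)
qed

lemma loop_interior: "0 < t \<Longrightarrow> t < 1 \<Longrightarrow> loop i t = (i, t)"
  by (simp add: loop_def frac_eq[THEN iffD2])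

lemma loop_0: "0 \<le> t \<Longrightarrow> t < 1 \<Longrightarrow> loop 0 t = (0, t)"
  by (simp add: loop_def frac_eq[THEN iffD2])

lemma coord_eq_iff_cong:
  "P \<in> pts \<Longrightarrow> Q \<in> pts \<Longrightarrow> coord j P - coord j Q \<in> \<int> \<longleftrightarrow> coord j P = coord j Q"
  using Ints_unit_interval_eq[of "coord j P" "coord j Q"] coord_range by auto

lemma circles_through_coord: assumes "P \<in> pts" "i \<in> circles_through P" shows "loop i (coord i P) = P"
proof (cases "i = fst P")
  case True
  then show ?thesis using assms
    by (cases P) (auto simp: pts_def loop_def coord_def frac_eq[THEN iffD2])
next
  case False
  then show ?thesis using assms by (cases P) (auto simp: pts_def loop_def coord_def circles_through_def)
qed

lemma circles_through_loop: "i < g \<Longrightarrow> i \<in> circles_through (loop i t)"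
  by (auto simp: circles_through_def loop_def)

lemma circles_through_subset: "circles_through P \<subseteq> {..<g}" by (auto simp: circles_through_def)

lemma finite_circles_through [simp]: "finite (circles_through P)"
  using finite_subset[OF circles_through_subset] by blast

lemma fst_in_circles_through: "P \<in> pts \<Longrightarrow> fst P \<in> circles_through P"
  by (auto simp: circles_through_def pts_def)

text \<open>
  Of the circles through \<open>P\<close> exactly one leads towards a given other point \<open>Q\<close>. This is what makes the
  divisor of a sum of pulled back functions computable in \<open>principal_divisorI\<close>.
\<close>

lemma circles_through_separate:
  assumes P: "P \<in> pts" and Q: "Q \<in> pts" and PQ: "P \<noteq> Q"
  obtains i where "i \<in> circles_through P" "coord i P \<noteq> coord i Q"
    "\<And>j. j \<in> circles_through P \<Longrightarrow> j \<noteq> i \<Longrightarrow> coord j P = coord j Q"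
proof (cases "fst P = 0")
  case False
  then have "circles_through P = {fst P}" using P by (auto simp: circles_through_def pts_def)
  moreover have "coord (fst P) P \<noteq> coord (fst P) Q"
    using P Q PQ False by (cases P; cases Q) (auto simp: coord_def pts_def)
  ultimately show thesis using that by blast
next
  case True
  show thesis
  proof (cases "fst Q = 0")
    case Q0: True
    show thesis
    proof (rule that[of 0])
      show "0 \<in> circles_through P" using True g_pos by (simp add: circles_through_def)
      show "coord 0 P \<noteq> coord 0 Q" using True Q0 PQ by (cases P; cases Q) (auto simp: coord_def)
      show "coord j P = coord j Q" if "j \<noteq> 0" for j using that True Q0 by (simp add: coord_def)
    qed
  next
    case Q0: False
    show thesis
    proof (cases "b (fst Q) = snd P")
      case bq: True
      show thesis
      proof (rule that[of "fst Q"])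
        show "fst Q \<in> circles_through P" using True bq Q by (auto simp: circles_through_def pts_def)
        show "coord (fst Q) P \<noteq> coord (fst Q) Q" using True Q0 Q by (auto simp: coord_def pts_def)
        show "coord j P = coord j Q" if "j \<noteq> fst Q" for j using that True Q0 bq by (auto simp: coord_def)
      qed
    next
      case bq: False
      show thesis
      proof (rule that[of 0])
        show "0 \<in> circles_through P" using True g_pos by (simp add: circles_through_def)
        show "coord 0 P \<noteq> coord 0 Q" using True Q0 bq by (auto simp: coord_def)
        show "coord j P = coord j Q" if "j \<in> circles_through P" "j \<noteq> 0" for j
          using that True bq Q0 by (auto simp: coord_def circles_through_def)
      qed
    qed
  qed
qed

lemma coord_eqI: "P \<in> pts \<Longrightarrow> Q \<in> pts \<Longrightarrow> (\<And>j. j < g \<Longrightarrow> coord j P = coord j Q) \<Longrightarrow> P = Q"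
  using circles_through_separate[of P Q] circles_through_subset by blast

lemma gdist_coord_le: "j < g \<Longrightarrow> circle_norm (coord j P - coord j Q) \<le> gdist P Q"
  unfolding gdist_def by (rule member_le_sum) auto

lemma gdist_single:
  assumes "i < g" "\<And>j. j < g \<Longrightarrow> j \<noteq> i \<Longrightarrow> coord j P = coord j Q"
  shows "gdist P Q = circle_norm (coord i P - coord i Q)"
proof -
  have "gdist P Q = (\<Sum>j<g. if j = i then circle_norm (coord i P - coord i Q) else 0)"
    unfolding gdist_def using assms(2) by (intro sum.cong) (auto simp: circle_norm_eq_0_iff)
  then show ?thesis using assms(1) by simp
qed

lemma gdist_loop: "i < g \<Longrightarrow> gdist (loop i s) (loop i t) = circle_norm (s - t)"
  by (subst gdist_single[of i])
     (auto simp: coord_loop_same frac_def coord_loop_other intro!: circle_norm_cong)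

sublocale M: Metric_space pts gdist
proof
  show "0 \<le> gdist P Q" for P Q unfolding gdist_def by (rule sum_nonneg) simp
  show "gdist P Q = gdist Q P" for P Q
    unfolding gdist_def by (intro sum.cong refl circle_norm_commute)
  show "gdist P Q = 0 \<longleftrightarrow> P = Q" if PQ: "P \<in> pts" "Q \<in> pts" for P Q
  proof
    assume 0: "gdist P Q = 0"
    show "P = Q"
    proof (rule coord_eqI[OF PQ])
      fix j assume "j < g"
      then have "circle_norm (coord j P - coord j Q) = 0"
        using gdist_coord_le[of j P Q] 0 circle_norm_nonneg[of "coord j P - coord j Q"] by linarith
      then show "coord j P = coord j Q"
        using coord_eq_iff_cong[OF PQ] by (simp add: circle_norm_eq_0_iff)
    qed
  qed (simp add: gdist_def circle_norm_eq_0_iff)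
  show "gdist P R \<le> gdist P Q + gdist Q R" for P Q R
    unfolding gdist_def sum.distrib[symmetric]
  proof (rule sum_mono)
    fix j
    show "circle_norm (coord j P - coord j R) \<le> circle_norm (coord j P - coord j Q) + circle_norm (coord j Q - coord j R)"
      using circle_norm_triangle[of "coord j P - coord j Q" "coord j Q - coord j R"] by simp
  qed
qed

lemma mspace_graph [simp]: "mspace graph = pts"
  unfolding graph_def by (rule M.mspace_metric)

lemma mdist_graph [simp]: "mdist graph = gdist"
  unfolding graph_def by (rule M.mdist_metric)

lemma mtopology_graph: "mtopology_of graph = M.mtopology"
  unfolding graph_def by (rule M.mtopology_of)

lemma coord_loop_shift:
  assumes "P \<in> pts" "i \<in> circles_through P"
  shows "coord j (loop i (coord i P + x)) - (coord j P + (if j = i then x else 0)) \<in> \<int>"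
proof (cases "j = i")
  case True
  then show ?thesis by (simp add: coord_loop_same frac_def)
next
  case False
  then have "coord j (loop i (coord i P + x)) = coord j (loop i (coord i P))" by (rule coord_loop_other_const)
  then show ?thesis using False circles_through_coord[OF assms] by simp
qed

text \<open>Two rays, distinguished by the sign \<open>\<sigma>\<close>, leave \<open>P\<close> on each circle through \<open>P\<close>.\<close>

definition ray :: "nat \<times> real \<Rightarrow> nat \<times> real \<Rightarrow> real \<Rightarrow> nat \<times> real" where
  "ray P = (\<lambda>(i, \<sigma>) u. loop i (coord i P + \<sigma> * u))"

lemma gdist_rays:
  assumes P: "P \<in> pts" and i: "i \<in> circles_through P" "i' \<in> circles_through P" and s: "\<sigma> = 1 \<or> \<sigma> = -1" "\<sigma>' = 1 \<or> \<sigma>' = -1"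
    and st: "0 \<le> s" "s \<le> 1/4" "0 \<le> t" "t \<le> 1/4"
  shows "gdist (ray P (i, \<sigma>) s) (ray P (i', \<sigma>') t) = (if (i, \<sigma>) = (i', \<sigma>') then \<bar>s - t\<bar> else s + t)"
proof (cases "i = i'")
  case True
  have "i < g" using i circles_through_subset by blast
  then have "gdist (ray P (i, \<sigma>) s) (ray P (i', \<sigma>') t) = circle_norm (\<sigma> * s - \<sigma>' * t)"
    using gdist_loop True by (simp add: ray_def)
  also have "\<dots> = \<bar>\<sigma> * s - \<sigma>' * t\<bar>" using s st by (intro circle_norm_eq_abs) (auto simp: abs_if)
  finally show ?thesis using s st True by auto
next
  case False
  have ig: "i < g" "i' < g" using i circles_through_subset by blast+
  have eq: "circle_norm (coord j (ray P (i, \<sigma>) s) - coord j (ray P (i', \<sigma>') t)) = (if j = i then s else 0) + (if j = i' then t else 0)" for j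
  proof -
    let ?x = "coord j (loop i (coord i P + \<sigma> * s))" and ?y = "coord j (loop i' (coord i' P + \<sigma>' * t))"
    let ?a = "if j = i then \<sigma> * s else 0" and ?b = "if j = i' then \<sigma>' * t else 0"
    have "(?x - (coord j P + ?a)) - (?y - (coord j P + ?b)) \<in> \<int>"
      by (intro Ints_diff coord_loop_shift P i)
    then have "(?x - ?y) - (?a - ?b) \<in> \<int>" by (simp add: algebra_simps)
    then have "circle_norm (?x - ?y) = circle_norm (?a - ?b)" by (rule circle_norm_cong)
    also have "\<dots> = \<bar>?a - ?b\<bar>" using s st by (intro circle_norm_eq_abs) (auto simp: abs_if)
    also have "\<dots> = (if j = i then s else 0) + (if j = i' then t else 0)" using s st False by auto
    finally show ?thesis by (simp add: ray_def)
  qed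
  show ?thesis unfolding gdist_def eq using False ig by (simp add: sum.distrib)
qed

text \<open>
  Circles not containing \<open>P\<close> stay away from \<open>P\<close>, because some coordinate is constant on such a circle with a
  value different from that of \<open>P\<close>. A point close to \<open>P\<close> therefore lies on a circle through \<open>P\<close>, and differs
  from \<open>P\<close> in one coordinate only.
\<close>

lemma ray_system_graph:
  assumes P: "P \<in> pts"
  obtains \<rho> where "ray_system graph P (circles_through P \<times> {1, -1}) (ray P) \<rho>"
proof -
  have far: "\<exists>e>0. \<forall>t. e \<le> gdist P (loop i t)" if i: "i < g" "i \<notin> circles_through P" for i
  proof -
    let ?Q = "loop i (coord i P)"
    have "P \<noteq> ?Q" using circles_through_loop[of i "coord i P"] i by metis
    then obtain j where j: "j < g" "coord j P \<noteq> coord j ?Q"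
      using coord_eqI[OF P loop_mem[OF i(1)]] by blast
    have "frac (coord i P) = coord i P" using coord_range[OF P] by (simp add: frac_eq)
    then have ji: "j \<noteq> i" using j(2) coord_loop_same by metis
    let ?e = "circle_norm (coord j P - coord j ?Q)"
    have "?e \<noteq> 0" using j(2) coord_eq_iff_cong[OF P loop_mem[OF i(1)]] by (simp add: circle_norm_eq_0_iff)
    then have "?e > 0" using circle_norm_nonneg[of "coord j P - coord j ?Q"] by linarith
    moreover have "?e \<le> gdist P (loop i t)" for t
      using gdist_coord_le[OF j(1), of P "loop i t"] coord_loop_other_const[OF ji] by metis
    ultimately show ?thesis by blast
  qed
  have "\<exists>e>0. \<forall>i \<in> {..<g} - circles_through P. \<forall>u. 0 \<le> u \<and> u \<le> e \<longrightarrow> (\<forall>t. u \<le> gdist P (loop i t))"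
  proof (rule finite_common_radius)
    fix i assume "i \<in> {..<g} - circles_through P"
    then obtain e where "e > 0" "\<forall>t. e \<le> gdist P (loop i t)" using far by auto
    then show "\<exists>e>0. \<forall>u. 0 \<le> u \<and> u \<le> e \<longrightarrow> (\<forall>t. u \<le> gdist P (loop i t))"
      by (intro exI[of _ e]) (auto intro: order_trans)
  qed simp
  then obtain e where e: "e > 0" "\<And>i t. i < g \<Longrightarrow> i \<notin> circles_through P \<Longrightarrow> e \<le> gdist P (loop i t)" by fastforce
  define \<rho> where "\<rho> = min e (1/4)"
  have \<rho>: "\<rho> > 0" "\<rho> \<le> e" "\<rho> \<le> 1/4" using e by (auto simp: \<rho>_def)
  have "ray_system graph P (circles_through P \<times> {1, -1}) (ray P) \<rho>"
    unfolding ray_system_def mspace_graph mdist_graph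
  proof (intro conjI ballI impI)
    show "P \<in> pts" "0 < \<rho>" by fact+
    show "finite (circles_through P \<times> {1, -1 :: real})" by simp
    show "circles_through P \<times> {1, -1 :: real} \<noteq> {}" using fst_in_circles_through[OF P] by auto
    fix j :: "nat \<times> real" assume j: "j \<in> circles_through P \<times> {1, -1}"
    then obtain i \<sigma> where i: "j = (i, \<sigma>)" "i \<in> circles_through P" "\<sigma> = 1 \<or> \<sigma> = -1" by auto
    have ig: "i < g" using i circles_through_subset by blast
    show "ray P j 0 = P" using i circles_through_coord[OF P] by (simp add: ray_def)
    show "ray P j s \<in> pts" for s using i loop_mem[OF ig] by (simp add: ray_def)
    fix l :: "nat \<times> real" assume l: "l \<in> circles_through P \<times> {1, -1}"
    then obtain i' \<sigma>' where i': "l = (i', \<sigma>')" "i' \<in> circles_through P" "\<sigma>' = 1 \<or> \<sigma>' = -1" by auto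
    fix s t assume "s \<in> {0..\<rho>}" "t \<in> {0..\<rho>}"
    then show "gdist (ray P j s) (ray P l t) = (if j = l then \<bar>s - t\<bar> else s + t)"
      using gdist_rays[OF P i(2) i'(2) i(3) i'(3), of s t] \<rho> i(1) i'(1) by auto
  next
    fix Q assume Q: "Q \<in> pts" "gdist P Q < \<rho>"
    define i where "i = fst Q"
    have ig: "i < g" using Q by (auto simp: pts_def i_def)
    have Qi: "Q = loop i (coord i Q)" using circles_through_coord[OF Q(1) fst_in_circles_through[OF Q(1)]] by (simp add: i_def)
    have iP: "i \<in> circles_through P" using e(2)[OF ig] Q(2) \<rho> Qi by (metis not_le order_trans)
    define x where "x = coord i Q - coord i P"
    have d: "gdist P Q = circle_norm x"
      using gdist_loop[OF ig, of "coord i P" "coord i Q"] circles_through_coord[OF P iP] Qi circle_norm_commute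
      by (simp add: x_def)
    define \<sigma> :: real where "\<sigma> = (if x - of_int (round x) \<ge> 0 then 1 else -1)"
    have "x = \<sigma> * gdist P Q + of_int (round x)" unfolding d circle_norm_def \<sigma>_def by auto
    then have "coord i Q - (coord i P + \<sigma> * gdist P Q) = of_int (round x)" by (simp add: x_def)
    then have "loop i (coord i Q) = loop i (coord i P + \<sigma> * gdist P Q)" by (intro loop_cong) auto
    then have "Q = ray P (i, \<sigma>) (gdist P Q)" using Qi by (simp add: ray_def)
    moreover have "(i, \<sigma>) \<in> circles_through P \<times> {1, -1}" using iP by (simp add: \<sigma>_def)
    ultimately show "\<exists>j\<in>circles_through P \<times> {1, -1}. Q = ray P j (gdist P Q)" by blast
  qed
  then show thesis using that by blast
qed

lemma valence_graph: "P \<in> pts \<Longrightarrow> valence graph P = 2 * card (circles_through P)"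
  by (rule ray_system_graph[of P]) (simp_all add: valence_ray_system card_cartesian_product)

definition attachments :: "real set" where
  "attachments = b ` {0<..<g}"

lemma finite_attachments [simp]: "finite attachments"
  by (simp add: attachments_def)

lemma attachments_range: "s \<in> attachments \<Longrightarrow> 0 \<le> s" "s \<in> attachments \<Longrightarrow> s < 1"
  using b by (auto simp: attachments_def)

lemma zero_attachment: "0 \<in> attachments"
  using base by (force simp: attachments_def)

lemma vertices_graph: "vertices graph = Pair 0 ` attachments"
proof -
  have "card (circles_through P) \<noteq> 1 \<longleftrightarrow> P \<in> Pair 0 ` attachments" if P: "P \<in> pts" for P
  proof
    assume "card (circles_through P) \<noteq> 1"
    then have "circles_through P \<noteq> {fst P}" by auto
    then obtain i where "i \<in> circles_through P" "i \<noteq> fst P" using fst_in_circles_through[OF P] by blast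
    then have "fst P = 0" "0 < i" "i < g" "b i = snd P" by (auto simp: circles_through_def)
    then show "P \<in> Pair 0 ` attachments" by (cases P) (auto simp: attachments_def)
  next
    assume "P \<in> Pair 0 ` attachments"
    then obtain i where i: "0 < i" "i < g" "P = (0, b i)" by (auto simp: attachments_def)
    then have "{0, i} \<subseteq> circles_through P" using g_pos by (auto simp: circles_through_def)
    then have "card {0, i} \<le> card (circles_through P)" by (intro card_mono) auto
    then show "card (circles_through P) \<noteq> 1" using i by simp
  qed
  moreover have "Pair 0 ` attachments \<subseteq> pts"
    using attachments_range g_pos by (auto simp: pts_def)
  moreover have "vertices graph = {P \<in> pts. card (circles_through P) \<noteq> 1}"
    unfolding vertices_def mspace_graph
    by (rule Collect_cong) (use valence_graph in \<open>auto simp del: One_nat_def\<close>)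
  ultimately show ?thesis by blast
qed

lemma continuous_loop:
  assumes "i < g" shows "continuous_map euclideanreal (mtopology_of graph) (loop i)"
  unfolding mtopology_graph
proof (rule M.continuous_map_to_metric[THEN iffD2], intro ballI allI impI)
  fix x :: real and \<epsilon> :: real assume "\<epsilon> > 0"
  show "\<exists>U. openin euclideanreal U \<and> x \<in> U \<and> (\<forall>y\<in>U. loop i y \<in> M.mball (loop i x) \<epsilon>)"
  proof (intro exI conjI ballI)
    show "openin euclideanreal (ball x \<epsilon>)" "x \<in> ball x \<epsilon>" using \<open>\<epsilon> > 0\<close> by auto
    fix y assume "y \<in> ball x \<epsilon>"
    then show "loop i y \<in> M.mball (loop i x) \<epsilon>"
      using circle_norm_le_abs[of "x - y"] loop_mem[OF assms] by (simp add: gdist_loop[OF assms] dist_real_def)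
  qed
qed

lemma compactin_loop: "i < g \<Longrightarrow> compact K \<Longrightarrow> compactin (mtopology_of graph) (loop i ` K)"
  using image_compactin[OF _ continuous_loop, of K] by simp

lemma connectedin_loop: "i < g \<Longrightarrow> connected K \<Longrightarrow> connectedin (mtopology_of graph) (loop i ` K)"
  using connectedin_continuous_map_image[OF continuous_loop, of i K] by simp

lemma closedin_loop: "i < g \<Longrightarrow> compact K \<Longrightarrow> closedin (mtopology_of graph) (loop i ` K)"
  using compactin_imp_closedin[OF M.Hausdorff_space_mtopology] compactin_loop by (simp add: mtopology_graph)

lemma pts_eq_Union_loops: "pts = (\<Union>i<g. loop i ` {0..1})"
proof
  show "pts \<subseteq> (\<Union>i<g. loop i ` {0..1})"
  proof
    fix P assume P: "P \<in> pts"
    have "P = loop (fst P) (coord (fst P) P)" "coord (fst P) P \<in> {0..1}" "fst P < g"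
      using circles_through_coord[OF P fst_in_circles_through[OF P]] coord_range[OF P, of "fst P"] P by (auto simp: pts_def)
    then show "P \<in> (\<Union>i<g. loop i ` {0..1})" by blast
  qed
qed (use loop_mem in auto)

lemma metric_graph_graph: "metric_graph graph"
  unfolding metric_graph_def mspace_graph
proof (intro conjI ballI)
  show "pts \<noteq> {}" using loop_mem[OF g_pos] by blast
  have "compactin (mtopology_of graph) pts"
    unfolding pts_eq_Union_loops by (intro compactin_Union) (auto intro: compactin_loop)
  then show "compact_space (mtopology_of graph)" by (simp add: compact_space_def)
  have "connectedin (mtopology_of graph) (\<Union>((\<lambda>i. loop 0 ` {0..1} \<union> loop i ` {0..1}) ` {..<g}))"
  proof (rule connectedin_Union)
    fix S assume "S \<in> (\<lambda>i. loop 0 ` {0..1} \<union> loop i ` {0..1}) ` {..<g}"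
    then obtain i where i: "i < g" "S = loop 0 ` {0..1} \<union> loop i ` {0..1}" by auto
    have "loop 0 (b i) = loop i 0 \<or> i = 0" using b[of i] by (simp add: loop_def frac_eq[THEN iffD2])
    moreover have "b i \<in> {0..1}" using b[of i] by simp
    ultimately have "loop 0 ` {0..1} \<inter> loop i ` {0..1} \<noteq> {}"
      by (metis atLeastAtMost_iff disjoint_iff image_eqI le_numeral_extra(3) zero_less_one_class.zero_le_one)
    then show "connectedin (mtopology_of graph) S" unfolding i(2)
      by (intro connectedin_Un connectedin_loop i g_pos) auto
  next
    have "loop 0 0 \<in> \<Inter>((\<lambda>i. loop 0 ` {0..1} \<union> loop i ` {0..1}) ` {..<g})" by auto
    then show "\<Inter>((\<lambda>i. loop 0 ` {0..1} \<union> loop i ` {0..1}) ` {..<g}) \<noteq> {}" by blast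
  qed
  also have "(\<Union>((\<lambda>i. loop 0 ` {0..1} \<union> loop i ` {0..1}) ` {..<g})) = pts"
    unfolding pts_eq_Union_loops using g_pos by blast
  finally show "connected_space (mtopology_of graph)"
    using connectedin_topspace[of "mtopology_of graph"] by simp
  show "\<exists>n \<rho> \<psi>. star_chart graph P n \<rho> \<psi>" if "P \<in> pts" for P
    using ray_system_graph[OF that] star_chart_of_ray_system by metis
qed

text \<open>
  The value 1 stands for the return to the attaching point 0. Each arc of the central circle is indexed by
  the attaching point at its beginning, which shows that there are as many arcs as attaching points.
\<close>

definition next_attachment :: "real \<Rightarrow> real" where
  "next_attachment s = Min (insert 1 {x\<in>attachments. s < x})"

definition arcs :: "(nat \<times> real \<times> real) set" where
  "arcs = (\<lambda>i. (i, 0, 1)) ` {0<..<g} \<union> (\<lambda>s. (0, s, next_attachment s)) ` attachments"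

lemma next_attachment:
  assumes "s \<in> attachments"
  shows "s < next_attachment s" "next_attachment s \<le> 1" "next_attachment s \<in> insert 1 attachments"
    "\<And>x. x \<in> attachments \<Longrightarrow> s < x \<Longrightarrow> next_attachment s \<le> x"
proof -
  have fin: "finite (insert 1 {x\<in>attachments. s < x})" by simp
  have m: "next_attachment s \<in> insert 1 {x\<in>attachments. s < x}"
    unfolding next_attachment_def by (rule Min_in[OF fin]) simp
  then show "s < next_attachment s" "next_attachment s \<in> insert 1 attachments"
    using attachments_range[OF assms] by auto
  show "next_attachment s \<le> 1" unfolding next_attachment_def by (rule Min_le[OF fin]) simp
  show "next_attachment s \<le> x" if "x \<in> attachments" "s < x" for x
    unfolding next_attachment_def by (rule Min_le[OF fin]) (use that in simp)
qed

lemma finite_arcs: "finite arcs" by (simp add: arcs_def)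

lemma arcsD:
  assumes "(i, \<alpha>, \<beta>) \<in> arcs"
  shows "i < g" "0 \<le> \<alpha>" "\<alpha> < \<beta>" "\<beta> \<le> 1" "loop i \<alpha> \<in> vertices graph" "loop i \<beta> \<in> vertices graph"
    "\<And>t. \<alpha> < t \<Longrightarrow> t < \<beta> \<Longrightarrow> loop i t = (i, t)"
    "\<And>t. \<alpha> < t \<Longrightarrow> t < \<beta> \<Longrightarrow> (i, t) \<in> pts - vertices graph"
proof -
  consider (loop) "0 < i" "i < g" "\<alpha> = 0" "\<beta> = 1"
    | (centre) "i = 0" "\<alpha> \<in> attachments" "\<beta> = next_attachment \<alpha>"
    using assms by (auto simp: arcs_def)
  then have *: "i < g \<and> 0 \<le> \<alpha> \<and> \<alpha> < \<beta> \<and> \<beta> \<le> 1 \<and> loop i \<alpha> \<in> vertices graph \<and> loop i \<beta> \<in> vertices graph \<and>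
     (\<forall>t. \<alpha> < t \<longrightarrow> t < \<beta> \<longrightarrow> (i, t) \<in> pts - vertices graph)"
  proof cases
    case loop
    then show ?thesis by (auto simp: loop_def vertices_graph attachments_def pts_def)
  next
    case centre
    note n = next_attachment[OF centre(2)]
    have a: "0 \<le> \<alpha>" "\<alpha> < 1" using attachments_range centre by auto
    have "loop 0 \<beta> \<in> vertices graph"
    proof (cases "\<beta> = 1")
      case True
      then show ?thesis using zero_attachment by (auto simp: loop_def vertices_graph)
    next
      case False
      then have "\<beta> \<in> attachments" using n centre by auto
      then show ?thesis using loop_0 attachments_range[of \<beta>] by (auto simp: vertices_graph)
    qed
    moreover have "loop 0 \<alpha> \<in> vertices graph" using centre a loop_0 by (auto simp: vertices_graph)
    moreover have "(0, t) \<in> pts - vertices graph" if "\<alpha> < t" "t < \<beta>" for t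
      using that n(1,2) n(4)[of t] centre a g_pos by (auto simp: vertices_graph pts_def)
    ultimately show ?thesis using centre n a g_pos by auto
  qed
  then show "i < g" "0 \<le> \<alpha>" "\<alpha> < \<beta>" "\<beta> \<le> 1" "loop i \<alpha> \<in> vertices graph" "loop i \<beta> \<in> vertices graph"
    "\<And>t. \<alpha> < t \<Longrightarrow> t < \<beta> \<Longrightarrow> (i, t) \<in> pts - vertices graph" by blast+
  show "loop i t = (i, t)" if "\<alpha> < t" "t < \<beta>" for t using loop_interior that * by auto
qed

definition open_arc :: "nat \<times> real \<times> real \<Rightarrow> (nat \<times> real) set" where
  "open_arc = (\<lambda>(i, \<alpha>, \<beta>). loop i ` {\<alpha><..<\<beta>})"

definition closed_arc :: "nat \<times> real \<times> real \<Rightarrow> (nat \<times> real) set" where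
  "closed_arc = (\<lambda>(i, \<alpha>, \<beta>). loop i ` {\<alpha>..\<beta>})"

lemma open_arc_eq: "(i, \<alpha>, \<beta>) \<in> arcs \<Longrightarrow> open_arc (i, \<alpha>, \<beta>) = Pair i ` {\<alpha><..<\<beta>}"
  unfolding open_arc_def using arcsD(7) by auto

lemma open_arc_closed_arc: "A \<in> arcs \<Longrightarrow> open_arc A = closed_arc A - vertices graph"
proof -
  assume A: "A \<in> arcs"
  obtain i \<alpha> \<beta> where A': "A = (i, \<alpha>, \<beta>)" by (cases A)
  note D = arcsD[OF A[unfolded A']]
  have e: "{\<alpha>..\<beta>} = insert \<alpha> (insert \<beta> {\<alpha><..<\<beta>})" using D(3) by auto
  have "closed_arc A = insert (loop i \<alpha>) (insert (loop i \<beta>) (open_arc A))"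
    unfolding closed_arc_def open_arc_def A' by (simp add: e)
  moreover have "open_arc A \<inter> vertices graph = {}" using D(8) open_arc_eq[of i \<alpha> \<beta>] A A' by auto
  ultimately show ?thesis using D(5,6) by auto
qed

lemma open_arc_nonempty: "A \<in> arcs \<Longrightarrow> open_arc A \<noteq> {}"
  by (cases A) (use arcsD(3) in \<open>auto simp: open_arc_def not_le[symmetric]\<close>)

lemma open_arcs_disjoint:
  assumes A: "A \<in> arcs" "A' \<in> arcs" and x: "x \<in> open_arc A" "x \<in> open_arc A'"
  shows "A = A'"
proof -
  obtain i \<alpha> \<beta> i' \<alpha>' \<beta>' where e: "A = (i, \<alpha>, \<beta>)" "A' = (i', \<alpha>', \<beta>')" by (cases A; cases A')
  obtain t where t: "x = (i, t)" "i' = i" "\<alpha> < t" "t < \<beta>" "\<alpha>' < t" "t < \<beta>'"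
    using A x unfolding e by (auto simp: open_arc_eq)
  show ?thesis
  proof (cases "i = 0")
    case False
    then show ?thesis using A t(2) unfolding e by (auto simp: arcs_def)
  next
    case True
    then have a: "\<alpha> \<in> attachments" "\<beta> = next_attachment \<alpha>" "\<alpha>' \<in> attachments" "\<beta>' = next_attachment \<alpha>'"
      using A t(2) unfolding e by (auto simp: arcs_def)
    have "\<alpha> = \<alpha>'"
      using next_attachment(4)[OF a(1) a(3)] next_attachment(4)[OF a(3) a(1)] t a
      by (cases \<alpha> \<alpha>' rule: linorder_cases) auto
    then show ?thesis using a t(2) e by simp
  qed
qed

lemma open_arcs_cover: "\<Union>(open_arc ` arcs) = pts - vertices graph"
proof
  show "\<Union>(open_arc ` arcs) \<subseteq> pts - vertices graph"
    using arcsD(8) by (fastforce simp: open_arc_eq)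
  show "pts - vertices graph \<subseteq> \<Union>(open_arc ` arcs)"
  proof
    fix P assume P: "P \<in> pts - vertices graph"
    obtain i t where it: "P = (i, t)" by (cases P)
    have r: "i < g" "0 \<le> t" "t < 1" "0 < i \<longrightarrow> 0 < t" using P it by (auto simp: pts_def)
    have "\<exists>\<alpha> \<beta>. (i, \<alpha>, \<beta>) \<in> arcs \<and> \<alpha> < t \<and> t < \<beta>"
    proof (cases "i = 0")
      case False
      then have "(i, 0, 1) \<in> arcs" using r by (auto simp: arcs_def)
      then show ?thesis using False r by auto
    next
      case True
      have t: "t \<notin> attachments" using P it True by (auto simp: vertices_graph)
      define s where "s = Max {x\<in>attachments. x \<le> t}"
      have fin: "finite {x\<in>attachments. x \<le> t}" by simp
      have s: "s \<in> {x\<in>attachments. x \<le> t}" unfolding s_def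
        by (rule Max_in[OF fin]) (use zero_attachment r in auto)
      then have st: "s \<in> attachments" "s < t" using t by (auto simp: less_le)
      have "t < next_attachment s"
      proof (rule ccontr)
        assume "\<not> t < next_attachment s"
        then have "next_attachment s \<in> {x\<in>attachments. x \<le> t}" using next_attachment(3)[OF st(1)] r by auto
        then have "next_attachment s \<le> s" unfolding s_def by (rule Max_ge[OF fin])
        then show False using next_attachment(1)[OF st(1)] by simp
      qed
      then show ?thesis using st True by (auto simp: arcs_def)
    qed
    then obtain \<alpha> \<beta> where "(i, \<alpha>, \<beta>) \<in> arcs" "\<alpha> < t" "t < \<beta>" by blast
    then have "P \<in> open_arc (i, \<alpha>, \<beta>)" by (simp add: open_arc_eq it)
    then show "P \<in> \<Union>(open_arc ` arcs)" using \<open>(i, \<alpha>, \<beta>) \<in> arcs\<close> by blast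
  qed
qed

lemma components_graph:
  "connected_components_of (subtopology (mtopology_of graph) (pts - vertices graph)) = open_arc ` arcs"
proof (rule connected_components_of_closed_partition)
  let ?X = "subtopology (mtopology_of graph) (pts - vertices graph)"
  show "finite (open_arc ` arcs)" using finite_arcs by simp
  show "\<Union>(open_arc ` arcs) = topspace ?X" by (simp add: open_arcs_cover) blast
  show "pairwise disjnt (open_arc ` arcs)"
    using open_arcs_disjoint unfolding pairwise_def disjnt_iff by blast
  fix B assume "B \<in> open_arc ` arcs"
  then obtain A where A: "A \<in> arcs" "B = open_arc A" by blast
  obtain i \<alpha> \<beta> where A': "A = (i, \<alpha>, \<beta>)" by (cases A)
  have i: "i < g" using arcsD(1) A A' by blast
  have sub: "B \<subseteq> pts - vertices graph" using A open_arcs_cover by blast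
  show "B \<noteq> {} \<and> connectedin ?X B \<and> closedin ?X B"
  proof (intro conjI)
    show "B \<noteq> {}" using open_arc_nonempty A by simp
    show "connectedin ?X B" using sub connectedin_loop[OF i, of "{\<alpha><..<\<beta>}"] A A'
      by (simp add: connectedin_subtopology open_arc_def)
    have "closedin (mtopology_of graph) (closed_arc A)"
      unfolding closed_arc_def A' using closedin_loop[OF i] by simp
    moreover have "B = closed_arc A \<inter> (pts - vertices graph)"
      using A sub open_arc_closed_arc[OF A(1)] by auto
    ultimately show "closedin ?X B" by (auto simp: closedin_subtopology)
  qed
qed

lemma closure_open_arc:
  assumes "A \<in> arcs" shows "mtopology_of graph closure_of (open_arc A) = closed_arc A"
proof -
  obtain i \<alpha> \<beta> where A': "A = (i, \<alpha>, \<beta>)" by (cases A)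
  note D = arcsD[OF assms[unfolded A']]
  show ?thesis
  proof
    show "mtopology_of graph closure_of (open_arc A) \<subseteq> closed_arc A"
      by (rule closure_of_minimal) (use closedin_loop[OF D(1)] in \<open>auto simp: A' open_arc_def closed_arc_def\<close>)
    have "loop i ` (euclideanreal closure_of {\<alpha><..<\<beta>}) \<subseteq> mtopology_of graph closure_of (loop i ` {\<alpha><..<\<beta>})"
      by (rule continuous_map_image_closure_subset[OF continuous_loop[OF D(1)]])
    then show "closed_arc A \<subseteq> mtopology_of graph closure_of (open_arc A)"
      using D(3) by (simp add: A' open_arc_def closed_arc_def)
  qed
qed

lemma edges_graph: "edges graph = closed_arc ` arcs"
  unfolding edges_def mspace_graph components_graph image_image
  by (rule image_cong) (simp_all add: closure_open_arc)

lemma finite_edges: "finite (edges graph)" by (simp add: edges_graph finite_arcs)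

lemma finite_vertices: "finite (vertices graph)" by (simp add: vertices_graph)

text \<open>
  Besides the \<open>g - 1\<close> loops there are as many edges as vertices, namely the arcs of the central circle.
\<close>

lemma genus_graph: "genus graph = int g"
proof -
  have "inj_on closed_arc arcs"
  proof (rule inj_onI)
    fix A A' assume A: "A \<in> arcs" "A' \<in> arcs" "closed_arc A = closed_arc A'"
    then have "open_arc A = open_arc A'" using open_arc_closed_arc by metis
    then show "A = A'" using open_arcs_disjoint[OF A(1,2)] open_arc_nonempty[OF A(1)] by blast
  qed
  then have "card (edges graph) = card arcs" by (simp add: edges_graph card_image)
  also have "\<dots> = (g - 1) + card attachments"
    unfolding arcs_def by (subst card_Un_disjoint) (auto simp: card_image inj_on_def)
  finally have e: "card (edges graph) = (g - 1) + card attachments" .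
  have v: "card (vertices graph) = card attachments" by (simp add: vertices_graph card_image inj_on_def)
  have "vertices graph \<noteq> {}" using zero_attachment by (auto simp: vertices_graph)
  then show ?thesis using e v g_pos by (simp add: genus_def)
qed

end

section \<open>Linear equivalence\<close>

context loop_tree
begin

lemma rational_function_germ:
  assumes f: "rational_function graph f" and i: "i < g"
  shows "\<exists>a b. pl_germ (\<lambda>x. f (loop i x)) t a b"
proof -
  let ?P = "loop i t"
  have P: "?P \<in> pts" "i \<in> circles_through ?P" using loop_mem circles_through_loop i by auto
  obtain \<rho> where rs: "ray_system graph ?P (circles_through ?P \<times> {1, -1}) (ray ?P) \<rho>"
    using ray_system_graph[OF P(1)] by blast
  have r: "ray ?P (i, \<sigma>) u = loop i (t + \<sigma> * u)" for \<sigma> u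
    unfolding ray_def coord_loop_same split_conv by (rule loop_cong) (simp add: frac_def)
  note aff = rational_function_affine_on_rays[OF f finite_vertices finite_edges rs]
  obtain a :: int and \<epsilon> where a: "\<epsilon> > 0" "\<forall>u. 0 \<le> u \<and> u \<le> \<epsilon> \<longrightarrow> f (loop i (t + 1 * u)) = f ?P + of_int a * u"
    using aff[of "(i, 1)"] P unfolding r by blast
  obtain b' :: int and \<epsilon>' where b': "\<epsilon>' > 0" "\<forall>u. 0 \<le> u \<and> u \<le> \<epsilon>' \<longrightarrow> f (loop i (t + (-1) * u)) = f ?P + of_int b' * u"
    using aff[of "(i, -1)"] P unfolding r by blast
  have "pl_germ (\<lambda>x. f (loop i x)) t a b'" unfolding pl_germ_def
  proof (intro exI[of _ "min \<epsilon> \<epsilon>'"] conjI allI impI)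
    show "0 < min \<epsilon> \<epsilon>'" using a b' by simp
    fix u assume u: "0 \<le> u \<and> u \<le> min \<epsilon> \<epsilon>'"
    show "f (loop i (t + u)) = f ?P + of_int a * u" using spec[OF a(2), of u] u by simp
    show "f (loop i (t - u)) = f ?P + of_int b' * u" using spec[OF b'(2), of u] u by simp
  qed
  then show ?thesis by blast
qed

lemma div_coeff_graph:
  assumes P: "P \<in> pts" and germ: "\<And>i. i \<in> circles_through P \<Longrightarrow> pl_germ (\<lambda>x. f (loop i x)) (coord i P) (a i) (b' i)"
  shows "div_coeff graph f P = (\<Sum>i\<in>circles_through P. a i + b' i)"
proof -
  define m :: "nat \<times> real \<Rightarrow> int" where "m = (\<lambda>(i, \<sigma>). if \<sigma> = 1 then a i else b' i)"
  obtain \<rho> where rs: "ray_system graph P (circles_through P \<times> {1, -1}) (ray P) \<rho>"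
    using ray_system_graph[OF P] by blast
  have "div_coeff graph f P = (\<Sum>j\<in>circles_through P \<times> {1, -1}. m j)"
  proof (rule div_coeff_ray_system[OF rs])
    fix j :: "nat \<times> real" assume "j \<in> circles_through P \<times> {1, -1}"
    then obtain i \<sigma> where j: "j = (i, \<sigma>)" "i \<in> circles_through P" "\<sigma> = 1 \<or> \<sigma> = -1" by auto
    obtain \<epsilon> where e: "\<epsilon> > 0" "\<forall>u. 0 \<le> u \<and> u \<le> \<epsilon> \<longrightarrow>
      f (loop i (coord i P + u)) = f (loop i (coord i P)) + of_int (a i) * u \<and>
      f (loop i (coord i P - u)) = f (loop i (coord i P)) + of_int (b' i) * u"
      using germ[OF j(2)] unfolding pl_germ_def by blast
    show "\<exists>\<epsilon>>0. \<forall>u. 0 \<le> u \<and> u \<le> \<epsilon> \<longrightarrow> f (ray P j u) = f P + of_int (m j) * u"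
    proof (intro exI[of _ \<epsilon>] conjI allI impI e(1))
      fix u assume u: "0 \<le> u \<and> u \<le> \<epsilon>"
      show "f (ray P j u) = f P + of_int (m j) * u"
        using spec[OF e(2), of u] u j(3) circles_through_coord[OF P j(2)] by (auto simp: j(1) m_def ray_def)
    qed
  qed
  also have "\<dots> = (\<Sum>i\<in>circles_through P. \<Sum>\<sigma>\<in>{1, -1}. m (i, \<sigma>))"
    by (simp only: sum.cartesian_product case_prod_eta)
  also have "\<dots> = (\<Sum>i\<in>circles_through P. a i + b' i)" by (simp add: m_def)
  finally show ?thesis .
qed

text \<open>
  The coefficient of \<open>div f\<close> at a point is the sum, over the circles through it, of the slope jumps of \<open>f\<close>
  along the circle. So a weighted sum over \<open>div f\<close> splits into one sum for each circle (\<open>main\<close>). The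
  coordinate \<open>j\<close> is constant on each circle other than \<open>j\<close>, where it contributes 0 like the degree; on
  the circle \<open>j\<close> it is the position of the jump, and the contribution is an integer.
\<close>

lemma principal_divisor_sums:
  assumes f: "rational_function graph f" and D: "is_div graph f D"
  shows "divisor_degree D = 0" "\<And>j. j < g \<Longrightarrow> divisor_sum (coord j) D \<in> \<int>"
proof -
  have "\<forall>i t. \<exists>a b. i < g \<longrightarrow> pl_germ (\<lambda>x. f (loop i x)) t a b"
    using rational_function_germ[OF f] by blast
  then obtain a b' where ab: "\<And>i t. i < g \<Longrightarrow> pl_germ (\<lambda>x. f (loop i x)) t (a i t) (b' i t)"
    by metis
  define \<delta> where "\<delta> i t = a i t + b' i t" for i t
  define T where "T i = {t\<in>{0..<1}. \<delta> i t \<noteq> 0}" for i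
  have per: "f (loop i (t + 1)) = f (loop i t)" for i t
    by (intro arg_cong[where f = f] loop_cong) simp
  have T: "finite (T i)" "(\<Sum>t\<in>T i. \<delta> i t) = 0" "(\<Sum>t\<in>T i. of_int (\<delta> i t) * t) \<in> \<int>" if "i < g" for i
    using circle_jump_sums[OF ab[OF that] per] unfolding T_def \<delta>_def by auto
  have lk: "Poly_Mapping.lookup D P = (\<Sum>i\<in>circles_through P. \<delta> i (coord i P))" if P: "P \<in> pts" for P
  proof -
    have "div_coeff graph f P = (\<Sum>i\<in>circles_through P. a i (coord i P) + b' i (coord i P))"
      by (rule div_coeff_graph[OF P]) (use ab circles_through_subset in blast)
    then show ?thesis using D P by (simp add: is_div_def \<delta>_def)
  qed
  define K where "K = Poly_Mapping.keys D \<union> (\<Union>i<g. loop i ` T i)"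
  have K: "finite K" "K \<subseteq> pts"
    using D T(1) loop_mem by (auto simp: K_def is_div_def divisor_on_def)
  have coord_T: "coord i (loop i t) = t" if "t \<in> T i" for i t
    using that by (simp add: coord_loop_same T_def frac_eq)
  have main: "divisor_sum \<phi> D = (\<Sum>i<g. \<Sum>t\<in>T i. of_int (\<delta> i t) * \<phi> (loop i t))" for \<phi> :: "nat \<times> real \<Rightarrow> real"
  proof -
    have "divisor_sum \<phi> D = (\<Sum>P\<in>K. of_int (Poly_Mapping.lookup D P) * \<phi> P)"
      by (rule divisor_sum_eq) (use K in \<open>auto simp: K_def\<close>)
    also have "\<dots> = (\<Sum>P\<in>K. \<Sum>i<g. if i \<in> circles_through P then of_int (\<delta> i (coord i P)) * \<phi> P else 0)"
    proof (rule sum.cong[OF refl])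
      fix P assume P: "P \<in> K"
      have "P \<in> pts" using P K by blast
      then have "of_int (Poly_Mapping.lookup D P) * \<phi> P = (\<Sum>i\<in>circles_through P. of_int (\<delta> i (coord i P)) * \<phi> P)"
        by (simp add: lk sum_distrib_right)
      also have "\<dots> = (\<Sum>i<g. if i \<in> circles_through P then of_int (\<delta> i (coord i P)) * \<phi> P else 0)"
        using circles_through_subset[of P] by (subst sum.inter_restrict[symmetric]) (auto simp: Int_absorb1)
      finally show "of_int (Poly_Mapping.lookup D P) * \<phi> P = \<dots>" .
    qed
    also have "\<dots> = (\<Sum>i<g. \<Sum>P\<in>K. if i \<in> circles_through P then of_int (\<delta> i (coord i P)) * \<phi> P else 0)"
      by (rule sum.swap)
    also have "\<dots> = (\<Sum>i<g. \<Sum>t\<in>T i. of_int (\<delta> i t) * \<phi> (loop i t))"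
    proof (rule sum.cong[OF refl])
      fix i assume i: "i \<in> {..<g}"
      have img: "loop i ` T i \<subseteq> K" using i by (auto simp: K_def)
      have z: "(if i \<in> circles_through P then of_int (\<delta> i (coord i P)) * \<phi> P else 0) = 0" if "P \<in> K - loop i ` T i" for P
      proof (rule ccontr)
        assume nz: "\<not> ?thesis"
        then have iP: "i \<in> circles_through P" and "\<delta> i (coord i P) \<noteq> 0" by (auto split: if_splits)
        have Pp: "P \<in> pts" using that K by auto
        have "coord i P \<in> T i" using \<open>\<delta> i (coord i P) \<noteq> 0\<close> coord_range[OF Pp] by (simp add: T_def)
        then have "loop i (coord i P) \<in> loop i ` T i" by blast
        then show False using that circles_through_coord[OF Pp iP] by simp
      qed
      have "(\<Sum>P\<in>K. if i \<in> circles_through P then of_int (\<delta> i (coord i P)) * \<phi> P else 0)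
         = (\<Sum>P\<in>loop i ` T i. if i \<in> circles_through P then of_int (\<delta> i (coord i P)) * \<phi> P else 0)"
        by (rule sum.mono_neutral_right) (use K img z in auto)
      also have "\<dots> = (\<Sum>t\<in>T i. if i \<in> circles_through (loop i t) then of_int (\<delta> i (coord i (loop i t))) * \<phi> (loop i t) else 0)"
        by (rule sum.reindex_cong[OF _ refl refl]) (metis coord_T inj_onI)
      also have "\<dots> = (\<Sum>t\<in>T i. of_int (\<delta> i t) * \<phi> (loop i t))"
        using i by (intro sum.cong) (auto simp: coord_T circles_through_loop)
      finally show "(\<Sum>P\<in>K. if i \<in> circles_through P then of_int (\<delta> i (coord i P)) * \<phi> P else 0) = \<dots>" .
    qed
    finally show ?thesis .
  qed
  have T2: "(\<Sum>t\<in>T i. real_of_int (\<delta> i t)) = 0" if "i < g" for i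
    using T(2)[OF that] by (metis of_int_0 of_int_sum)
  have "real_of_int (divisor_degree D) = (\<Sum>i<g. \<Sum>t\<in>T i. real_of_int (\<delta> i t))"
    unfolding of_int_divisor_degree main by simp
  also have "\<dots> = 0" using T2 by simp
  finally show "divisor_degree D = 0" by simp
  fix j assume j: "j < g"
  have "(\<Sum>t\<in>T i. of_int (\<delta> i t) * coord j (loop i t)) \<in> \<int>" if i: "i < g" for i
  proof (cases "i = j")
    case True
    have "(\<Sum>t\<in>T i. of_int (\<delta> i t) * coord j (loop i t)) = (\<Sum>t\<in>T i. of_int (\<delta> i t) * t)"
      using True by (intro sum.cong) (auto simp: coord_T)
    then show ?thesis using T(3)[OF i] by simp
  next
    case False
    have "(\<Sum>t\<in>T i. of_int (\<delta> i t) * coord j (loop i t)) = (\<Sum>t\<in>T i. of_int (\<delta> i t)) * coord j (loop i 0)"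
      unfolding sum_distrib_right using False coord_loop_other_const[of j i] by (intro sum.cong) metis+
    then show ?thesis using T2[OF i] by simp
  qed
  then show "divisor_sum (coord j) D \<in> \<int>" unfolding main by (rule Ints_sum) simp
qed

text \<open>
  Continuity holds because \<open>f\<close> is affine on finitely many rays around each point. The covering of an
  arc by segments with \<open>f\<close> affine exists locally and can be concatenated; the bound \<open>1/2\<close> on lengths is
  needed since a longer piece of a circle of length 1 is not a geodesic.
\<close>

lemma rational_functionI:
  assumes germ: "\<And>i t. i < g \<Longrightarrow> \<exists>a b. pl_germ (\<lambda>x. f (loop i x)) t a b"
  shows "rational_function graph f"
  unfolding rational_function_def
proof (intro conjI ballI)
  have "continuous_map (mtopology_of graph) Met_TC.mtopology f"
    unfolding Met_TC.continuous_map_to_metric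
  proof (intro ballI allI impI)
    fix P \<epsilon> assume "P \<in> topspace (mtopology_of graph)" and \<epsilon>: "(\<epsilon>::real) > 0"
    then have P: "P \<in> pts" by simp
    obtain \<rho> where rs: "ray_system graph P (circles_through P \<times> {1, -1}) (ray P) \<rho>"
      using ray_system_graph[OF P] by blast
    have "\<exists>\<eta>>0. \<forall>j\<in>circles_through P \<times> {1, -1}. \<forall>u. 0 \<le> u \<and> u \<le> \<eta> \<longrightarrow> \<bar>f (ray P j u) - f P\<bar> < \<epsilon>"
    proof (rule finite_common_radius)
      show "finite (circles_through P \<times> {1, -1::real})" by simp
      fix j :: "nat \<times> real" assume "j \<in> circles_through P \<times> {1, -1}"
      then obtain i \<sigma> where j: "j = (i, \<sigma>)" "i \<in> circles_through P" "\<sigma> = 1 \<or> \<sigma> = -1" by auto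
      have i: "i < g" using j circles_through_subset by blast
      obtain a b' where "pl_germ (\<lambda>x. f (loop i x)) (coord i P) a b'" using germ[OF i] by blast
      then obtain e where e: "e > 0" "\<forall>u. 0 \<le> u \<and> u \<le> e \<longrightarrow>
        f (loop i (coord i P + u)) = f (loop i (coord i P)) + of_int a * u \<and>
        f (loop i (coord i P - u)) = f (loop i (coord i P)) + of_int b' * u"
        unfolding pl_germ_def by blast
      define m where "m = (if \<sigma> = 1 then a else b')"
      have jm: "f (ray P j u) = f P + of_int m * u" if "0 \<le> u" "u \<le> e" for u
        using spec[OF e(2), of u] that j(3) circles_through_coord[OF P j(2)] by (auto simp: j(1) m_def ray_def)
      define \<eta> where "\<eta> = min e (\<epsilon> / (2 * (\<bar>of_int m\<bar> + 1)))"
      have \<eta>: "\<eta> > 0" "\<eta> \<le> e" "\<eta> \<le> \<epsilon> / (2 * (\<bar>of_int m\<bar> + 1))"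
        using e \<epsilon> by (auto simp: \<eta>_def intro!: divide_pos_pos)
      show "\<exists>\<eta>>0. \<forall>u. 0 \<le> u \<and> u \<le> \<eta> \<longrightarrow> \<bar>f (ray P j u) - f P\<bar> < \<epsilon>"
      proof (intro exI[of _ \<eta>] conjI allI impI \<eta>(1))
        fix u assume u: "0 \<le> u \<and> u \<le> \<eta>"
        have "\<bar>f (ray P j u) - f P\<bar> = \<bar>of_int m\<bar> * u"
          using jm[of u] u \<eta> by (simp add: abs_mult)
        also have "\<dots> \<le> (\<bar>of_int m\<bar> + 1) * \<eta>" using u by (intro mult_mono) auto
        also have "\<dots> \<le> (\<bar>of_int m\<bar> + 1) * (\<epsilon> / (2 * (\<bar>of_int m\<bar> + 1)))"
          using \<eta>(3) by (intro mult_left_mono) auto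
        also have "\<dots> = \<epsilon> / 2" by (simp add: field_simps)
        also have "\<dots> < \<epsilon>" using \<epsilon> by simp
        finally show "\<bar>f (ray P j u) - f P\<bar> < \<epsilon>" .
      qed
    qed
    then obtain \<eta> where \<eta>: "\<eta> > 0" "\<forall>j\<in>circles_through P \<times> {1, -1}. \<forall>u. 0 \<le> u \<and> u \<le> \<eta> \<longrightarrow> \<bar>f (ray P j u) - f P\<bar> < \<epsilon>"
      by blast
    show "\<exists>U. openin (mtopology_of graph) U \<and> P \<in> U \<and> (\<forall>y\<in>U. f y \<in> Met_TC.mball (f P) \<epsilon>)"
    proof (intro exI conjI ballI)
      show "openin (mtopology_of graph) (M.mball P (min \<eta> \<rho>))" by (simp add: mtopology_graph)
      show "P \<in> M.mball P (min \<eta> \<rho>)" using \<eta> ray_system_basic[OF rs] P by simp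
      fix Q assume "Q \<in> M.mball P (min \<eta> \<rho>)"
      then have Q: "Q \<in> pts" "gdist P Q < \<rho>" "gdist P Q \<le> \<eta>" by auto
      obtain j where j: "j \<in> circles_through P \<times> {1, -1}" "Q = ray P j (gdist P Q)"
        using ray_system_cover[OF rs, of Q] Q by auto
      have "\<bar>f (ray P j (gdist P Q)) - f P\<bar> < \<epsilon>" using bspec[OF \<eta>(2) j(1)] Q(3) M.nonneg by blast
      then show "f Q \<in> Met_TC.mball (f P) \<epsilon>"
        using j(2) by (simp add: dist_real_def abs_minus_commute)
    qed
  qed
  then show "continuous_map (mtopology_of graph) euclideanreal f"
    using mtopology_of_euclidean[where 'a = real]
    by (simp add: mtopology_of_def del: mtopology_of_euclidean)
next
  fix e assume "e \<in> edges graph"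
  then obtain A where A: "A \<in> arcs" "e = closed_arc A" by (auto simp: edges_graph)
  obtain i \<alpha> \<beta> where A': "A = (i, \<alpha>, \<beta>)" by (cases A)
  note Ad = arcsD[OF A(1)[unfolded A']]
  define OK where "OK = (\<lambda>(\<gamma>, L). segment graph \<gamma> L \<and> (\<exists>m::int. \<forall>t \<in> {0..L}. f (\<gamma> t) = f (\<gamma> 0) + of_int m * t))"
  define Q where "Q x y \<longleftrightarrow> (x < y \<longrightarrow> (\<exists>S. finite S \<and> loop i ` {x..y} = (\<Union>(\<gamma>, L)\<in>S. \<gamma> ` {0..L}) \<and> (\<forall>s\<in>S. OK s)))" for x y
  have single: "Q x y" if xy: "y - x \<le> 1/2" and aff: "\<And>t. 0 \<le> t \<Longrightarrow> t \<le> y - x \<Longrightarrow> f (loop i (x + t)) = f (loop i x) + of_int m * t"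
    for x y and m :: int
    unfolding Q_def
  proof (intro impI exI[of _ "{(\<lambda>t. loop i (x + t), y - x)}"] conjI)
    assume lt: "x < y"
    have "(\<lambda>t. x + t) ` {0..y - x} = {x..y}" by simp
    then show "loop i ` {x..y} = (\<Union>(\<gamma>, L)\<in>{(\<lambda>t. loop i (x + t), y - x)}. \<gamma> ` {0..L})"
      by (simp flip: image_image)
    have "OK (\<lambda>t. loop i (x + t), y - x)"
      unfolding OK_def split_conv
    proof
      show "segment graph (\<lambda>t. loop i (x + t)) (y - x)" unfolding segment_def mspace_graph mdist_graph
      proof (intro conjI ballI)
        show "0 < y - x" using lt by simp
        show "(\<lambda>t. loop i (x + t)) ` {0..y - x} \<subseteq> pts" using loop_mem[OF Ad(1)] by blast
        fix s t assume "s \<in> {0..y - x}" "t \<in> {0..y - x}"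
        then have "\<bar>s - t\<bar> \<le> 1/2" using xy by (auto simp: abs_if)
        then show "gdist (loop i (x + s)) (loop i (x + t)) = \<bar>s - t\<bar>"
          by (simp add: gdist_loop[OF Ad(1)] circle_norm_eq_abs)
      qed
      show "\<exists>m::int. \<forall>t\<in>{0..y - x}. f (loop i (x + t)) = f (loop i (x + 0)) + of_int m * t"
        by (intro exI[of _ m] ballI) (use aff in simp)
    qed
    then show "\<forall>s\<in>{(\<lambda>t. loop i (x + t), y - x)}. OK s" by blast
  qed simp
  have trans: "Q x z" if Q: "Q x y" "Q y z" and le: "x \<le> y" "y \<le> z" for x y z
  proof (cases "x = y \<or> y = z")
    case True
    then show ?thesis using Q by auto
  next
    case False
    then have "x < y" "y < z" using le by auto
    then have "\<exists>S. finite S \<and> loop i ` {x..y} = (\<Union>(\<gamma>, L)\<in>S. \<gamma> ` {0..L}) \<and> (\<forall>s\<in>S. OK s)"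
      "\<exists>S. finite S \<and> loop i ` {y..z} = (\<Union>(\<gamma>, L)\<in>S. \<gamma> ` {0..L}) \<and> (\<forall>s\<in>S. OK s)"
      by - (erule Q(1)[unfolded Q_def, THEN mp], erule Q(2)[unfolded Q_def, THEN mp])
    then obtain S S' where S: "finite S" "loop i ` {x..y} = (\<Union>(\<gamma>, L)\<in>S. \<gamma> ` {0..L})" "\<forall>s\<in>S. OK s"
      "finite S'" "loop i ` {y..z} = (\<Union>(\<gamma>, L)\<in>S'. \<gamma> ` {0..L})" "\<forall>s\<in>S'. OK s"
      by (elim exE conjE)
    have "{x..z} = {x..y} \<union> {y..z}" using le by auto
    then have "loop i ` {x..z} = (\<Union>(\<gamma>, L)\<in>S \<union> S'. \<gamma> ` {0..L})"
      using S(2,5) by (simp add: image_Un)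
    moreover have "finite (S \<union> S')" "\<forall>s\<in>S \<union> S'. OK s" using S(1,3,4,6) by auto
    ultimately show ?thesis unfolding Q_def by blast
  qed
  have "Q \<alpha> \<beta>" using less_imp_le[OF Ad(3)]
  proof (induct rule: Bolzano)
    case (trans x y z)
    then show ?case using \<open>\<And>z y x. Q x y \<Longrightarrow> Q y z \<Longrightarrow> x \<le> y \<Longrightarrow> y \<le> z \<Longrightarrow> Q x z\<close> by blast
  next
    case (local p)
    obtain a b' where "pl_germ (\<lambda>x. f (loop i x)) p a b'" using germ[OF Ad(1)] by blast
    then obtain \<epsilon> where e: "\<epsilon> > 0"
      "\<forall>u. 0 \<le> u \<and> u \<le> \<epsilon> \<longrightarrow> f (loop i (p + u)) = f (loop i p) + of_int a * u \<and>
         f (loop i (p - u)) = f (loop i p) + of_int b' * u"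
      unfolding pl_germ_def by blast
    show ?case
    proof (intro exI[of _ "min \<epsilon> (1/2)"] conjI allI impI)
      show "0 < min \<epsilon> (1/2)" using e by simp
      fix x y assume xy: "x \<le> p \<and> p \<le> y \<and> y - x < min \<epsilon> (1/2)"
      have "Q x p"
      proof (rule single[of _ _ "- b'"])
        show "p - x \<le> 1/2" using xy by auto
        fix t assume t: "0 \<le> t" "t \<le> p - x"
        have "f (loop i (x + t)) = f (loop i p) + of_int b' * (p - x - t)"
          using spec[OF e(2), of "p - x - t"] t xy by simp
        moreover have "f (loop i x) = f (loop i p) + of_int b' * (p - x)"
          using spec[OF e(2), of "p - x"] t xy by simp
        ultimately show "f (loop i (x + t)) = f (loop i x) + of_int (- b') * t" by (simp add: algebra_simps)
      qed
      moreover have "Q p y"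
      proof (rule single[of _ _ a])
        show "y - p \<le> 1/2" using xy by auto
        fix t assume t: "0 \<le> t" "t \<le> y - p"
        then show "f (loop i (p + t)) = f (loop i p) + of_int a * t"
          using spec[OF e(2), of t] xy by auto
      qed
      ultimately show "Q x y" using trans xy by blast
    qed
  qed
  then have "\<exists>S. finite S \<and> loop i ` {\<alpha>..\<beta>} = (\<Union>(\<gamma>, L)\<in>S. \<gamma> ` {0..L}) \<and> (\<forall>s\<in>S. OK s)"
    unfolding Q_def by (rule mp) (rule Ad(3))
  then obtain S where S: "finite S" "loop i ` {\<alpha>..\<beta>} = (\<Union>(\<gamma>, L)\<in>S. \<gamma> ` {0..L})" "\<forall>s\<in>S. OK s"
    by (elim exE conjE)
  have "e = loop i ` {\<alpha>..\<beta>}" using A(2) A' by (simp add: closed_arc_def)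
  then show "\<exists>S. finite S \<and> e = (\<Union>(\<gamma>, L) \<in> S. \<gamma> ` {0..L}) \<and>
        (\<forall>(\<gamma>, L) \<in> S. segment graph \<gamma> L \<and> (\<exists>m::int. \<forall>t \<in> {0..L}. f (\<gamma> t) = f (\<gamma> 0) + of_int m * t))"
    using S unfolding OK_def by (intro exI[of _ S] conjI) (simp_all only:)
qed

text \<open>
  Each circle carries the function \<open>G j\<close> whose jumps are the coefficients of the retraction of \<open>D\<close>, and
  \<open>f\<close> is the sum of their pullbacks. At \<open>P\<close> a coefficient of \<open>D\<close> at \<open>Q \<noteq> P\<close> is counted by all circles
  through \<open>P\<close> except the one that leads to \<open>Q\<close>, and the coefficient at \<open>P\<close> itself by all of them. As the
  degree is 0, the surplus is exactly the coefficient at \<open>P\<close>.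
\<close>

lemma principal_divisorI:
  assumes D: "divisor_on graph D" and deg: "divisor_degree D = 0"
    and jac: "\<And>j. j < g \<Longrightarrow> divisor_sum (coord j) D \<in> \<int>"
  shows "\<exists>f. rational_function graph f \<and> is_div graph f D"
proof -
  define K where "K = Poly_Mapping.keys D"
  have K: "finite K" "K \<subseteq> pts" using D by (auto simp: K_def divisor_on_def)
  define n where "n Q = - Poly_Mapping.lookup D Q" for Q
  have n0: "(\<Sum>Q\<in>K. n Q) = 0" using deg by (simp add: n_def K_def divisor_degree_def sum_negf)
  have nj: "(\<Sum>Q\<in>K. of_int (n Q) * coord j Q) \<in> \<int>" if "j < g" for j
    using jac[OF that] by (simp add: n_def K_def divisor_sum_def sum_negf)
  define G where "G j x = (\<Sum>Q\<in>K. of_int (n Q) * circle_green (x - coord j Q))" for j x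
  define f where "f P = (\<Sum>j<g. G j (coord j P))" for P
  define good where "good i t p \<longleftrightarrow> pl_germ (G i) t (fst p) (snd p) \<and>
      fst p + snd p = - (\<Sum>Q\<in>{Q\<in>K. t - coord i Q \<in> \<int>}. n Q)" for i t p
  define a where "a i t = fst (SOME p. good i t p)" for i t
  define b' where "b' i t = snd (SOME p. good i t p)" for i t
  have "good i t (SOME p. good i t p)" if "i < g" for i t
  proof -
    have "\<exists>p. good i t p"
      using circle_green_sum_germ[OF K(1) n0 nj[OF that], of t] unfolding G_def good_def by simp
    then show ?thesis by (rule someI_ex)
  qed
  then have ab: "\<And>i t. i < g \<Longrightarrow> pl_germ (G i) t (a i t) (b' i t)"
     "\<And>i t. i < g \<Longrightarrow> a i t + b' i t = - (\<Sum>Q\<in>{Q\<in>K. t - coord i Q \<in> \<int>}. n Q)"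
    unfolding good_def a_def b'_def by blast+
  have green_frac: "circle_green (frac x - c) = circle_green (x - c)" for x c
  proof -
    have "frac x - c = (x - c) - of_int \<lfloor>x\<rfloor>" by (simp add: frac_def)
    then have "frac (frac x - c) = frac (x - c)" by (metis frac_add_of_int_right diff_conv_add_uminus of_int_minus)
    then show ?thesis by (simp add: circle_green_def)
  qed
  have floop: "f (loop i x) = G i x + (\<Sum>j\<in>{..<g} - {i}. G j (coord j (loop i 0)))" if i: "i < g" for i x
  proof -
    have "f (loop i x) = G i (coord i (loop i x)) + (\<Sum>j\<in>{..<g} - {i}. G j (coord j (loop i x)))"
      unfolding f_def by (rule sum.remove) (use i in auto)
    also have "G i (coord i (loop i x)) = G i x"
      by (simp add: G_def coord_loop_same green_frac)
    also have "(\<Sum>j\<in>{..<g} - {i}. G j (coord j (loop i x))) = (\<Sum>j\<in>{..<g} - {i}. G j (coord j (loop i 0)))"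
      using coord_loop_other_const[of _ i x 0] by (intro sum.cong) auto
    finally show ?thesis .
  qed
  have germ: "pl_germ (\<lambda>x. f (loop i x)) t (a i t) (b' i t)" if "i < g" for i t
    using ab(1)[OF that] floop[OF that] by (rule pl_germ_add_const)
  have "rational_function graph f" by (rule rational_functionI) (use germ in blast)
  moreover have "is_div graph f D"
    unfolding is_div_def mspace_graph
  proof (intro conjI ballI D)
    fix P assume P: "P \<in> pts"
    have "div_coeff graph f P = (\<Sum>i\<in>circles_through P. a i (coord i P) + b' i (coord i P))"
      by (rule div_coeff_graph[OF P]) (use germ circles_through_subset in blast)
    also have "\<dots> = (\<Sum>i\<in>circles_through P. \<Sum>Q\<in>K. if coord i P = coord i Q then Poly_Mapping.lookup D Q else 0)"
    proof (rule sum.cong[OF refl])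
      fix i assume "i \<in> circles_through P"
      then have i: "i < g" using circles_through_subset by blast
      have "{Q\<in>K. coord i P - coord i Q \<in> \<int>} = {Q\<in>K. coord i P = coord i Q}"
        using coord_eq_iff_cong[OF P] K(2) by blast
      then show "a i (coord i P) + b' i (coord i P) = (\<Sum>Q\<in>K. if coord i P = coord i Q then Poly_Mapping.lookup D Q else 0)"
        using ab(2)[OF i, of "coord i P"] K(1) by (simp add: n_def sum_negf sum.inter_filter)
    qed
    also have "\<dots> = (\<Sum>Q\<in>K. \<Sum>i\<in>circles_through P. if coord i P = coord i Q then Poly_Mapping.lookup D Q else 0)"
      by (rule sum.swap)
    also have "\<dots> = (\<Sum>Q\<in>K. (int (card (circles_through P)) - 1) * Poly_Mapping.lookup D Q + (if Q = P then Poly_Mapping.lookup D Q else 0))"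
    proof (rule sum.cong[OF refl])
      fix Q assume Q: "Q \<in> K"
      show "(\<Sum>i\<in>circles_through P. if coord i P = coord i Q then Poly_Mapping.lookup D Q else 0)
         = (int (card (circles_through P)) - 1) * Poly_Mapping.lookup D Q + (if Q = P then Poly_Mapping.lookup D Q else 0)"
      proof (cases "Q = P")
        case True
        then show ?thesis by (simp add: algebra_simps)
      next
        case False
        obtain i where i: "i \<in> circles_through P" "coord i P \<noteq> coord i Q"
          "\<And>j. j \<in> circles_through P \<Longrightarrow> j \<noteq> i \<Longrightarrow> coord j P = coord j Q"
          using circles_through_separate[OF P, of Q] Q K False by blast
        have "(\<Sum>i\<in>circles_through P. if coord i P = coord i Q then Poly_Mapping.lookup D Q else 0)
            = (\<Sum>j\<in>circles_through P - {i}. if coord j P = coord j Q then Poly_Mapping.lookup D Q else 0)"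
          using i by (subst sum.remove[OF finite_circles_through i(1)]) simp
        also have "\<dots> = (\<Sum>j\<in>circles_through P - {i}. Poly_Mapping.lookup D Q)"
          using i(3) by (intro sum.cong) auto
        also have "\<dots> = (int (card (circles_through P)) - 1) * Poly_Mapping.lookup D Q"
        proof -
          have "card (circles_through P) \<ge> 1" using i(1) card_gt_0_iff[of "circles_through P"] by fastforce
          then show ?thesis using i(1) by (simp add: of_nat_diff)
        qed
        finally show ?thesis using False by simp
      qed
    qed
    also have "\<dots> = (int (card (circles_through P)) - 1) * (\<Sum>Q\<in>K. Poly_Mapping.lookup D Q) + (if P \<in> K then Poly_Mapping.lookup D P else 0)"
      using K(1) by (simp add: sum.distrib sum_distrib_left)
    also have "\<dots> = Poly_Mapping.lookup D P"
      using deg by (simp add: K_def divisor_degree_def in_keys_iff)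
    finally show "Poly_Mapping.lookup D P = div_coeff graph f P" by simp
  qed
  ultimately show ?thesis by blast
qed

theorem linearly_equivalent_iff:
  assumes "divisor_on graph D" "divisor_on graph E"
  shows "linearly_equivalent graph D E \<longleftrightarrow>
    divisor_degree D = divisor_degree E \<and> (\<forall>j<g. divisor_sum (coord j) D - divisor_sum (coord j) E \<in> \<int>)"
proof -
  have on: "divisor_on graph (E - D)"
    using assms keys_diff[of E D] unfolding divisor_on_def by blast
  have 1: "linearly_equivalent graph D E \<longleftrightarrow>
     divisor_degree (E - D) = 0 \<and> (\<forall>j<g. divisor_sum (coord j) (E - D) \<in> \<int>)"
    unfolding linearly_equivalent_def using principal_divisor_sums principal_divisorI[OF on] by blast
  have 2: "x - y \<in> \<int> \<longleftrightarrow> y - x \<in> \<int>" for x y :: real using Ints_minus[of "x - y"] Ints_minus[of "y - x"] by auto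
  show ?thesis unfolding 1 divisor_sum_diff divisor_degree_eq using 2 by auto
qed

end

section \<open>Effective classes and rank\<close>

context loop_tree
begin

text \<open>
  The loops that contain a point in their interior for every effective divisor with coordinate sums \<open>y\<close>.
\<close>

definition nontrivial_loops :: "(nat \<Rightarrow> real) \<Rightarrow> nat set" where
  "nontrivial_loops y = {i. 0 < i \<and> i < g \<and> y i \<notin> \<int>}"

lemma finite_nontrivial_loops [simp]: "finite (nontrivial_loops y)"
  by (rule finite_subset[of _ "{..<g}"]) (auto simp: nontrivial_loops_def)

text \<open>
  One point on each nontrivial loop realizes the coordinates there. A further point, if the degree permits
  it, can be placed on the central circle to correct \<open>y 0\<close>.
\<close>

lemma effective_divisor_with_coords:
  assumes "card (nontrivial_loops y) < n \<or>
    card (nontrivial_loops y) = n \<and> y 0 - (\<Sum>i\<in>nontrivial_loops y. b i) \<in> \<int>"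
  obtains G where "divisor_on graph G" "effective G" "divisor_degree G = int n"
    "\<And>j. j < g \<Longrightarrow> divisor_sum (coord j) G - y j \<in> \<int>"
proof -
  define N where "N = nontrivial_loops y"
  have N: "finite N" "\<And>i. i \<in> N \<Longrightarrow> 0 < i \<and> i < g" by (auto simp: N_def nontrivial_loops_def)
  define z where "z = y 0 - (\<Sum>i\<in>N. b i)"
  define L where "L = (\<Sum>i\<in>N. Poly_Mapping.single (loop i (y i)) (1::int))"
  define R where "R = (if card N < n then
      Poly_Mapping.single (loop 0 z) 1 + Poly_Mapping.single (loop 0 0) (int n - int (card N) - 1) else 0)"
  have L: "divisor_on graph L" "effective L" "divisor_degree L = int (card N)"
    unfolding L_def using N loop_mem
    by (auto intro!: divisor_on_sum effective_sum divisor_on_single effective_single simp: divisor_degree_sum)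
  have R: "divisor_on graph R" "effective R" "divisor_degree R = int n - int (card N)"
    using assms loop_mem[OF g_pos] unfolding R_def N_def[symmetric]
    by (auto intro!: divisor_on_add divisor_on_single effective_add effective_single simp: divisor_degree_add)
       (auto simp: divisor_on_def effective_def divisor_degree_def)
  have zc: "divisor_sum (coord 0) R - z \<in> \<int>"
  proof (cases "card N < n")
    case True
    then have "divisor_sum (coord 0) R - z = frac z - z"
      by (simp add: R_def divisor_sum_add coord_loop_same)
    then show ?thesis by (simp add: frac_def)
  next
    case False
    then have "z \<in> \<int>" using assms by (auto simp: z_def N_def)
    then show ?thesis using False by (simp add: R_def)
  qed
  have "divisor_sum (coord j) (L + R) - y j \<in> \<int>" if j: "j < g" for j
  proof (cases "j = 0")
    case True
    have "divisor_sum (coord 0) L = (\<Sum>i\<in>N. b i)"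
      unfolding L_def divisor_sum_sum using N(2) by (intro sum.cong) (auto simp: coord_loop_other)
    then show ?thesis using zc True by (simp add: divisor_sum_add z_def algebra_simps)
  next
    case False
    have "divisor_sum (coord j) L = (\<Sum>i\<in>N. if i = j then frac (y j) else 0)"
      unfolding L_def divisor_sum_sum using False
      by (intro sum.cong) (auto simp: coord_loop_other coord_loop_same)
    also have "\<dots> = (if j \<in> N then frac (y j) else 0)" using N(1) by simp
    finally have "divisor_sum (coord j) L - y j \<in> \<int>"
      using False j by (auto simp: frac_def N_def nontrivial_loops_def)
    moreover have "divisor_sum (coord j) R = 0"
      using False by (simp add: R_def divisor_sum_add coord_loop_other)
    ultimately show ?thesis by (simp add: divisor_sum_add)
  qed
  then show thesis
    using that[of "L + R"] L R by (simp add: divisor_on_add effective_add divisor_degree_add)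
qed

text \<open>
  The points that make different loops nontrivial are different. If they exhaust the degree, there is one of
  them on each of these loops and no other point, so the coordinates on the central circle are the attaching
  points.
\<close>

lemma nontrivial_loops_of_effective:
  assumes G: "divisor_on graph G" "effective G"
  defines "N \<equiv> nontrivial_loops (\<lambda>i. divisor_sum (coord i) G)"
  shows "int (card N) \<le> divisor_degree G"
    "int (card N) = divisor_degree G \<Longrightarrow> divisor_sum (coord 0) G = (\<Sum>i\<in>N. b i)"
proof -
  let ?K = "Poly_Mapping.keys G"
  have "\<exists>P. P \<in> ?K \<and> fst P = i" if i: "i \<in> N" for i
  proof (rule ccontr)
    assume "\<nexists>P. P \<in> ?K \<and> fst P = i"
    then have "divisor_sum (coord i) G = 0"
      unfolding divisor_sum_def using i
      by (intro sum.neutral) (auto simp: coord_def N_def nontrivial_loops_def)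
    then show False using i by (simp add: N_def nontrivial_loops_def)
  qed
  then obtain p where p: "\<And>i. i \<in> N \<Longrightarrow> p i \<in> ?K \<and> fst (p i) = i" by metis
  have inj: "inj_on p N" using p by (metis inj_onI)
  have img: "p ` N \<subseteq> ?K" using p by blast
  have cK: "card N \<le> card ?K" using card_mono[OF _ img] card_image[OF inj] by simp
  have lk: "1 \<le> Poly_Mapping.lookup G P" if "P \<in> ?K" for P
    using that G(2) by (metis effective_def in_keys_iff int_one_le_iff_zero_less order_le_less)
  have "int (card ?K) = (\<Sum>P\<in>?K. 1)" by simp
  also have "\<dots> \<le> divisor_degree G" unfolding divisor_degree_def by (rule sum_mono) (rule lk)
  finally have deg: "int (card ?K) \<le> divisor_degree G" .
  with cK show "int (card N) \<le> divisor_degree G" by linarith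
  assume eq: "int (card N) = divisor_degree G"
  have K: "?K = p ` N"
    using card_subset_eq[OF _ img] card_image[OF inj] cK deg eq by simp
  have one: "Poly_Mapping.lookup G P = 1" if "P \<in> ?K" for P
  proof (rule ccontr)
    assume "Poly_Mapping.lookup G P \<noteq> 1"
    then have "1 < Poly_Mapping.lookup G P" using lk[OF that] by simp
    then have "(\<Sum>P\<in>?K. (1::int)) < divisor_degree G"
      unfolding divisor_degree_def using that lk by (intro sum_strict_mono_ex1) auto
    then show False using cK eq by simp
  qed
  have "divisor_sum (coord 0) G = (\<Sum>P\<in>p ` N. coord 0 P)"
    unfolding divisor_sum_def K[symmetric] by (intro sum.cong) (simp_all add: one)
  also have "\<dots> = (\<Sum>i\<in>N. coord 0 (p i))" by (simp add: sum.reindex[OF inj])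
  also have "\<dots> = (\<Sum>i\<in>N. b i)"
    using p by (intro sum.cong) (auto simp: coord_def N_def nontrivial_loops_def)
  finally show "divisor_sum (coord 0) G = (\<Sum>i\<in>N. b i)" .
qed

text \<open>
  The condition that defines the rank, with \<open>E\<close> subtracted from \<open>D\<close> instead of being contained in the
  equivalent divisor; in this form only effectiveness of a class has to be decided.
\<close>

definition rank_at_least :: "(nat \<times> real) divisor \<Rightarrow> nat \<Rightarrow> bool" where
  "rank_at_least D r \<longleftrightarrow> (\<forall>E. divisor_on graph E \<and> effective E \<and> divisor_degree E = int r \<longrightarrow>
     (\<exists>G. divisor_on graph G \<and> effective G \<and> linearly_equivalent graph (D - E) G))"

lemma rank_at_least_iff:
  assumes D: "divisor_on graph D"
  shows "rank_at_least D r \<longleftrightarrow> (\<forall>E. divisor_on graph E \<and> effective E \<and> divisor_degree E = int r \<longrightarrow>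
     (\<exists>D'. divisor_on graph D' \<and> effective D' \<and> linearly_equivalent graph D D' \<and> contains D' E))"
proof -
  have "(\<exists>G. divisor_on graph G \<and> effective G \<and> linearly_equivalent graph (D - E) G) \<longleftrightarrow>
     (\<exists>D'. divisor_on graph D' \<and> effective D' \<and> linearly_equivalent graph D D' \<and> contains D' E)"
    if E: "divisor_on graph E" "effective E" for E
  proof
    assume "\<exists>G. divisor_on graph G \<and> effective G \<and> linearly_equivalent graph (D - E) G"
    then obtain G where "divisor_on graph G" "effective G" "linearly_equivalent graph (D - E) G" by blast
    then show "\<exists>D'. divisor_on graph D' \<and> effective D' \<and> linearly_equivalent graph D D' \<and> contains D' E"
      using E D by (intro exI[of _ "G + E"])
        (simp add: divisor_on_add effective_add contains_def linearly_equivalent_def algebra_simps)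
  next
    assume "\<exists>D'. divisor_on graph D' \<and> effective D' \<and> linearly_equivalent graph D D' \<and> contains D' E"
    then obtain D' where "divisor_on graph D'" "effective D'" "linearly_equivalent graph D D'" "contains D' E" by blast
    then show "\<exists>G. divisor_on graph G \<and> effective G \<and> linearly_equivalent graph (D - E) G"
      using E D by (intro exI[of _ "D' - E"])
        (simp add: divisor_on_diff contains_def linearly_equivalent_def algebra_simps)
  qed
  then show ?thesis unfolding rank_at_least_def by blast
qed

lemma origin_mem: "(0, 0) \<in> pts" using g_pos by (simp add: pts_def)

lemma rank_at_least_mono:
  assumes "rank_at_least D s" "r \<le> s" shows "rank_at_least D r"
  unfolding rank_at_least_def
proof (intro allI impI)
  fix E assume E: "divisor_on graph E \<and> effective E \<and> divisor_degree E = int r"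
  let ?F = "Poly_Mapping.single (0, 0) (int (s - r)) :: (nat \<times> real) divisor"
  have F: "divisor_on graph ?F" "effective ?F" by (simp_all add: divisor_on_single origin_mem effective_single)
  have "divisor_on graph (E + ?F)" "effective (E + ?F)" "divisor_degree (E + ?F) = int s"
    using E F assms(2) by (simp_all add: divisor_on_add effective_add divisor_degree_add)
  then obtain G where G: "divisor_on graph G" "effective G" "linearly_equivalent graph (D - (E + ?F)) G"
    using assms(1) unfolding rank_at_least_def by blast
  have eq: "G + ?F - (D - E) = G - (D - (E + ?F))" by simp
  have "linearly_equivalent graph (D - E) (G + ?F)"
    using G(3) unfolding linearly_equivalent_def eq .
  then show "\<exists>G. divisor_on graph G \<and> effective G \<and> linearly_equivalent graph (D - E) G"
    using G F by (intro exI[of _ "G + ?F"]) (simp add: divisor_on_add effective_add)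
qed

lemma rank_at_least_le_degree:
  assumes D: "divisor_on graph D" and "rank_at_least D r"
  shows "int r \<le> divisor_degree D"
proof -
  let ?F = "Poly_Mapping.single (0, 0) (int r) :: (nat \<times> real) divisor"
  have F: "divisor_on graph ?F" "effective ?F" by (simp_all add: divisor_on_single origin_mem effective_single)
  then obtain G where G: "divisor_on graph G" "effective G" "linearly_equivalent graph (D - ?F) G"
    using assms(2) unfolding rank_at_least_def by fastforce
  then have "divisor_degree G = divisor_degree D - int r"
    using linearly_equivalent_iff[OF divisor_on_diff[OF D F(1)] G(1)] by (simp add: divisor_degree_diff)
  then show ?thesis using effective_degree_nonneg[OF G(2)] by simp
qed

lemma effective_degree_0:
  assumes "effective E" "divisor_degree E = 0" shows "E = 0"
proof (rule poly_mapping_eqI)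
  fix P
  have "\<forall>P\<in>Poly_Mapping.keys E. Poly_Mapping.lookup E P = 0"
    using assms sum_nonneg_eq_0_iff[of "Poly_Mapping.keys E" "Poly_Mapping.lookup E"]
    by (simp add: divisor_degree_def effective_def)
  then show "Poly_Mapping.lookup E P = Poly_Mapping.lookup 0 P" by (auto simp: in_keys_iff)
qed

text \<open>
  The greatest element in the definition of the rank exists because the condition bounds the number by the
  degree of \<open>D\<close>, and the condition is inherited by smaller numbers.
\<close>

lemma le_rk_iff:
  assumes D: "divisor_on graph D"
  shows "int r \<le> rk graph D \<longleftrightarrow> rank_at_least D r"
proof -
  have ex: "(\<exists>D'. divisor_on graph D' \<and> effective D' \<and> linearly_equivalent graph D D') \<longleftrightarrow> rank_at_least D 0"
    unfolding rank_at_least_def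
  proof
    assume "\<exists>D'. divisor_on graph D' \<and> effective D' \<and> linearly_equivalent graph D D'"
    then show "\<forall>E. divisor_on graph E \<and> effective E \<and> divisor_degree E = int 0 \<longrightarrow>
       (\<exists>G. divisor_on graph G \<and> effective G \<and> linearly_equivalent graph (D - E) G)"
      using effective_degree_0 by fastforce
  next
    assume "\<forall>E. divisor_on graph E \<and> effective E \<and> divisor_degree E = int 0 \<longrightarrow>
       (\<exists>G. divisor_on graph G \<and> effective G \<and> linearly_equivalent graph (D - E) G)"
    from spec[OF this, of 0] show "\<exists>D'. divisor_on graph D' \<and> effective D' \<and> linearly_equivalent graph D D'"
      by (simp add: divisor_on_def effective_def divisor_degree_def)
  qed
  have rk: "rk graph D = (if rank_at_least D 0 then int (GREATEST r. rank_at_least D r) else -1)"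
    unfolding rk_def ex rank_at_least_iff[OF D, symmetric] by simp
  have bound: "\<And>s. rank_at_least D s \<Longrightarrow> s \<le> nat (divisor_degree D)"
    using rank_at_least_le_degree[OF D] by fastforce
  show ?thesis
  proof
    assume le: "int r \<le> rk graph D"
    then have 0: "rank_at_least D 0" unfolding rk by (simp split: if_splits)
    have "rank_at_least D (GREATEST r. rank_at_least D r)"
      using 0 bound by (rule GreatestI_nat)
    from rank_at_least_mono[OF this] show "rank_at_least D r" using le 0 by (simp add: rk)
  next
    assume r: "rank_at_least D r"
    then have "r \<le> (GREATEST r. rank_at_least D r)" using bound by (rule Greatest_le_nat)
    then show "int r \<le> rk graph D" using rank_at_least_mono[OF r, of 0] by (simp add: rk)
  qed
qed

lemma rank_at_least_Suc:
  assumes "rank_at_least D (Suc r)" "P \<in> pts"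
  shows "rank_at_least (D - Poly_Mapping.single P 1) r"
  unfolding rank_at_least_def
proof (intro allI impI)
  fix E assume E: "divisor_on graph E \<and> effective E \<and> divisor_degree E = int r"
  let ?F = "Poly_Mapping.single P 1 :: (nat \<times> real) divisor"
  have "divisor_on graph (?F + E)" "effective (?F + E)" "divisor_degree (?F + E) = int (Suc r)"
    using E assms(2) by (simp_all add: divisor_on_add effective_add divisor_degree_add divisor_on_single effective_single)
  then have "\<exists>G. divisor_on graph G \<and> effective G \<and> linearly_equivalent graph (D - (?F + E)) G"
    using assms(1) unfolding rank_at_least_def by blast
  then show "\<exists>G. divisor_on graph G \<and> effective G \<and> linearly_equivalent graph (D - ?F - E) G"
    by (simp add: diff_diff_eq)
qed

end

section \<open>A free divisor\<close>

locale two_attachments =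
  fixes g r k :: nat
  assumes r1: "1 \<le> r" and gk: "r + k + 2 \<le> g"
begin

definition att :: "nat \<Rightarrow> real" where
  "att i = (if 0 < i \<and> i \<le> k then 1/3 else 0)"

sublocale loop_tree g att
proof
  show "0 \<le> att i" "att i < 1" for i by (simp_all add: att_def)
  show "\<exists>i. 0 < i \<and> i < g \<and> att i = 0" using gk by (intro exI[of _ "Suc k"]) (simp add: att_def)
qed

definition half :: "nat \<Rightarrow> (nat \<times> real) divisor" where
  "half i = Poly_Mapping.single (i, 1/2) 1"

definition witness :: "(nat \<times> real) divisor" where
  "witness = Poly_Mapping.single (0, 0) (2 * int r) + (\<Sum>i\<in>{1..k}. half i)"

lemma half_on_graph:
  assumes "0 < i" "i < g"
  shows "divisor_on graph (half i)" "effective (half i)"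
  using assms by (simp_all add: half_def divisor_on_single effective_single pts_def)

lemma degree_half [simp]: "divisor_degree (half i) = 1"
  by (simp add: half_def)

lemma sum_half:
  assumes I: "finite I" "I \<subseteq> {0<..<g}"
  shows "divisor_on graph (sum half I)" "effective (sum half I)" "divisor_degree (sum half I) = int (card I)"
    "0 < j \<Longrightarrow> divisor_sum (coord j) (sum half I) = (if j \<in> I then 1/2 else 0)"
    "divisor_sum (coord 0) (sum half I) = sum att I"
proof -
  show "divisor_on graph (sum half I)" "effective (sum half I)"
    using I half_on_graph by (auto intro!: divisor_on_sum effective_sum)
  show "divisor_degree (sum half I) = int (card I)" by (simp add: divisor_degree_sum)
  show "divisor_sum (coord 0) (sum half I) = sum att I"
    unfolding divisor_sum_sum using I by (intro sum.cong) (auto simp: half_def coord_def)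
  assume j: "0 < j"
  have "divisor_sum (coord j) (sum half I) = (\<Sum>i\<in>I. if i = j then 1/2 else 0)"
    unfolding divisor_sum_sum using j by (intro sum.cong) (auto simp: half_def coord_def)
  then show "divisor_sum (coord j) (sum half I) = (if j \<in> I then 1/2 else 0)" using I(1) by simp
qed

lemma sum_att: "finite J \<Longrightarrow> J \<subseteq> {k<..} \<Longrightarrow> sum att ({1..k} \<union> J) = real k / 3"
proof -
  assume J: "finite J" "J \<subseteq> {k<..}"
  have "sum att ({1..k} \<union> J) = sum att {1..k} + sum att J"
    by (rule sum.union_disjoint) (use J in auto)
  also have "sum att J = 0" using J by (intro sum.neutral) (auto simp: att_def)
  also have "sum att {1..k} = (\<Sum>i\<in>{1..k}. 1/3)" by (rule sum.cong) (auto simp: att_def)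
  finally show ?thesis by simp
qed

lemma witness_basic:
  "divisor_on graph witness" "effective witness" "divisor_degree witness = 2 * int r + int k"
  "0 < j \<Longrightarrow> divisor_sum (coord j) witness = (if j \<le> k then 1/2 else 0)"
  "divisor_sum (coord 0) witness = real k / 3"
proof -
  have I: "finite {1..k}" "{1..k} \<subseteq> {0<..<g}" using gk by auto
  note s = sum_half[OF I]
  show "divisor_on graph witness" "effective witness" "divisor_degree witness = 2 * int r + int k"
    unfolding witness_def using s origin_mem
    by (auto intro!: divisor_on_add divisor_on_single effective_add effective_single simp: divisor_degree_add)
  show "0 < j \<Longrightarrow> divisor_sum (coord j) witness = (if j \<le> k then 1/2 else 0)"
    using s(4)[of j] by (simp add: witness_def divisor_sum_add coord_def)
  show "divisor_sum (coord 0) witness = real k / 3"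
    using s(5) sum_att[of "{}"] by (simp add: witness_def divisor_sum_add coord_def)
qed

text \<open>
  The only critical case is that all \<open>k + r\<close> possible loops are nontrivial for \<open>witness - E\<close>. Then every point of
  \<open>E\<close> lies in a loop attached at 0 and contributes nothing to the coordinate on the central circle.
\<close>

lemma witness_rank: "rank_at_least witness r"
  unfolding rank_at_least_def
proof (intro allI impI)
  fix E assume E': "divisor_on graph E \<and> effective E \<and> divisor_degree E = int r"
  then have E: "divisor_on graph E" "effective E" "divisor_degree E = int r" by auto
  define y where "y j = divisor_sum (coord j) (witness - E)" for j
  define N where "N = nontrivial_loops y"
  define NE where "NE = nontrivial_loops (\<lambda>i. divisor_sum (coord i) E)"
  have cE: "card NE \<le> r" "card NE = r \<Longrightarrow> divisor_sum (coord 0) E = sum att NE"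
    using nontrivial_loops_of_effective[OF E(1,2)] E(3) by (auto simp: NE_def)
  define J where "J = NE \<inter> {k<..}"
  have J: "finite J" "J \<subseteq> {k<..}" "J \<subseteq> NE" by (auto simp: J_def NE_def)
  have cJ: "card J \<le> card NE" using J(3) by (intro card_mono) (auto simp: NE_def)
  have sub: "N \<subseteq> {1..k} \<union> J"
  proof
    fix i assume i: "i \<in> N"
    then have i': "0 < i" "i < g" "y i \<notin> \<int>" by (auto simp: N_def nontrivial_loops_def)
    show "i \<in> {1..k} \<union> J"
    proof (cases "i \<le> k")
      case False
      then have "y i = - divisor_sum (coord i) E" using witness_basic(4)[of i] by (simp add: y_def divisor_sum_diff)
      then show ?thesis using i' False by (auto simp: J_def NE_def nontrivial_loops_def minus_in_Ints_iff)
    qed (use i' in simp)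
  qed
  have fin: "finite ({1..k} \<union> J)" using J by simp
  have cU: "card ({1..k} \<union> J) = k + card J"
    using J by (subst card_Un_disjoint) auto
  have cN: "card N \<le> k + card J" using card_mono[OF fin sub] cU by simp
  have "card N < r + k \<or> card N = r + k \<and> y 0 - sum att N \<in> \<int>"
  proof (cases "card N < r + k")
    case False
    then have c: "card N = r + k" "card J = r" "card NE = r" using cN cJ cE(1) by auto
    then have "N = {1..k} \<union> J" using card_subset_eq[OF fin sub] cU by simp
    then have "sum att N = real k / 3" using sum_att J by simp
    moreover have "J = NE" using card_subset_eq[OF _ J(3)] c by (simp add: NE_def)
    then have "divisor_sum (coord 0) E = 0"
      using cE(2) c(3) J(2) by (auto simp: att_def intro!: sum.neutral)
    then have "y 0 = real k / 3" unfolding y_def divisor_sum_diff witness_basic(5) by simp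
    ultimately have "y 0 - sum att N = 0" by simp
    then show ?thesis using c(1) by simp
  qed simp
  then obtain G where G: "divisor_on graph G" "effective G" "divisor_degree G = int (r + k)"
    "\<And>j. j < g \<Longrightarrow> divisor_sum (coord j) G - y j \<in> \<int>"
    using effective_divisor_with_coords[of y "r + k"] unfolding N_def by blast
  have "y j - divisor_sum (coord j) G \<in> \<int>" if "j < g" for j
    using G(4)[OF that] Ints_minus by fastforce
  then have "linearly_equivalent graph (witness - E) G"
    unfolding linearly_equivalent_iff[OF divisor_on_diff[OF witness_basic(1) E(1)] G(1)]
    using G(3) E(3) witness_basic(3) by (simp add: divisor_degree_diff y_def)
  then show "\<exists>G. divisor_on graph G \<and> effective G \<and> linearly_equivalent graph (witness - E) G"
    using G by blast
qed

lemma not_equivalent_to_effective: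
  assumes F: "divisor_on graph F" and J: "J \<subseteq> {k<..<g}"
    and nt: "\<And>i. i \<in> {1..k} \<union> J \<Longrightarrow> divisor_sum (coord i) F \<notin> \<int>"
    and deg: "divisor_degree F < int (k + card J) \<or>
       divisor_degree F = int (k + card J) \<and> divisor_sum (coord 0) F - real k / 3 \<notin> \<int>"
    and G: "divisor_on graph G" "effective G"
  shows "\<not> linearly_equivalent graph F G"
proof
  assume "linearly_equivalent graph F G"
  then have dG: "divisor_degree G = divisor_degree F"
    and cG: "\<And>j. j < g \<Longrightarrow> divisor_sum (coord j) F - divisor_sum (coord j) G \<in> \<int>"
    using linearly_equivalent_iff[OF F G(1)] by auto
  define N where "N = nontrivial_loops (\<lambda>i. divisor_sum (coord i) G)"
  have sub: "{1..k} \<union> J \<subseteq> N"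
  proof
    fix i assume i: "i \<in> {1..k} \<union> J"
    then have "0 < i" "i < g" using J gk by auto
    then show "i \<in> N" using nt[OF i] Ints_diff_cong[OF cG[of i]] by (auto simp: N_def nontrivial_loops_def)
  qed
  have finJ: "finite J" using J finite_subset by blast
  have cU: "card ({1..k} \<union> J) = k + card J"
    using J finJ by (subst card_Un_disjoint) auto
  have le: "k + card J \<le> card N" using card_mono[OF _ sub] cU by (simp add: N_def)
  note nG = nontrivial_loops_of_effective[OF G, folded N_def]
  from nG(1) le deg dG have eq: "divisor_degree F = int (k + card J)" "card N = k + card J"
    and ne: "divisor_sum (coord 0) F - real k / 3 \<notin> \<int>" by auto
  have "N = {1..k} \<union> J" using card_subset_eq[OF _ sub] cU eq by (simp add: N_def)
  then have G0: "divisor_sum (coord 0) G = real k / 3"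
    using nG(2) eq dG sum_att[OF finJ] J by fastforce
  show False using cG[OF g_pos] ne unfolding G0 by contradiction
qed

text \<open>
  The case distinction is whether \<open>P\<close> cancels one of the midpoints in the divisor. If it does, subtracting
  the same midpoint once more makes that loop nontrivial again, at the price of a point whose retraction to the
  central circle is \<open>1/3\<close>. Together with \<open>P\<close> this shifts the coordinate there by \<open>2/3\<close>, which is
  not an integer.
\<close>

lemma witness_minus_point_rank:
  assumes P: "P \<in> pts" shows "\<not> rank_at_least (witness - Poly_Mapping.single P 1) r"
proof -
  let ?P = "Poly_Mapping.single P 1 :: (nat \<times> real) divisor"
  have on: "divisor_on graph (witness - ?P)" using witness_basic(1) P by (simp add: divisor_on_diff divisor_on_single)
  have half_not_int: "(1/2 :: real) \<notin> \<int>"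
    using Ints_unit_interval_eq[of "1/2" 0] by auto
  have "\<exists>E. divisor_on graph E \<and> effective E \<and> divisor_degree E = int r \<and>
     (\<forall>G. divisor_on graph G \<longrightarrow> effective G \<longrightarrow> \<not> linearly_equivalent graph (witness - ?P - E) G)"
  proof (cases "\<exists>i\<in>{1..k}. P = (i, 1/2)")
    case False
    have "r \<le> card ({k<..<g} - {fst P})"
      using gk by (cases "fst P \<in> {k<..<g}") auto
    then obtain J where J: "J \<subseteq> {k<..<g} - {fst P}" "card J = r" "finite J"
      using obtain_subset_with_card_n by metis
    have JJ: "finite J" "J \<subseteq> {0<..<g}" using J by auto
    note s = sum_half[OF JJ]
    show ?thesis
    proof (intro exI[of _ "sum half J"] conjI allI impI)
      show "divisor_on graph (sum half J)" "effective (sum half J)" "divisor_degree (sum half J) = int r"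
        using s J(2) by auto
      fix G assume G: "divisor_on graph G" "effective G"
      show "\<not> linearly_equivalent graph (witness - ?P - sum half J) G"
      proof (rule not_equivalent_to_effective[of _ J])
        show "divisor_on graph (witness - ?P - sum half J)" using on s(1) by (rule divisor_on_diff)
        show "J \<subseteq> {k<..<g}" using J by blast
        fix i assume i: "i \<in> {1..k} \<union> J"
        show "divisor_sum (coord i) (witness - ?P - sum half J) \<notin> \<int>"
        proof (cases "i \<in> J")
          case True
          then have "coord i P = 0" "k < i" using J by (auto simp: coord_def)
          then have "divisor_sum (coord i) (witness - ?P - sum half J) = - (1/2)"
            using True witness_basic(4)[of i] s(4)[of i] by (simp add: divisor_sum_diff)
          then show ?thesis using half_not_int by (metis minus_in_Ints_iff)
        next
          case False
          then have i': "0 < i" "i \<le> k" using i by auto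
          have "divisor_sum (coord i) (witness - ?P - sum half J) = 1/2 - coord i P"
            using i' False witness_basic(4)[of i] s(4)[of i] by (simp add: divisor_sum_diff)
          moreover have "coord i P \<noteq> 1/2"
            using \<open>\<not> (\<exists>i\<in>{1..k}. P = (i, 1/2))\<close> i' by (cases P) (auto simp: coord_def)
          ultimately show ?thesis
            using Ints_unit_interval_eq[of "1/2" "coord i P"] coord_range[OF P] by auto
        qed
      next
        show "divisor_degree (witness - ?P - sum half J) < int (k + card J) \<or>
          divisor_degree (witness - ?P - sum half J) = int (k + card J) \<and>
          divisor_sum (coord 0) (witness - ?P - sum half J) - real k / 3 \<notin> \<int>"
          using witness_basic(3) s(3) J(2) by (simp add: divisor_degree_diff)
      qed (use G in auto)
    qed
  next
    case True
    then obtain p where p: "p \<in> {1..k}" "P = (p, 1/2)" by blast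
    have "r - 1 \<le> card {k<..<g}" using gk by simp
    then obtain J where J: "J \<subseteq> {k<..<g}" "card J = r - 1" "finite J"
      using obtain_subset_with_card_n by metis
    have pJ: "p \<notin> J" using p J by auto
    have JJ: "finite (insert p J)" "insert p J \<subseteq> {0<..<g}" using J p gk by auto
    note s = sum_half[OF JJ]
    show ?thesis
    proof (intro exI[of _ "sum half (insert p J)"] conjI allI impI)
      show "divisor_on graph (sum half (insert p J))" "effective (sum half (insert p J))"
        "divisor_degree (sum half (insert p J)) = int r"
        using s J pJ r1 by auto
      fix G assume G: "divisor_on graph G" "effective G"
      show "\<not> linearly_equivalent graph (witness - ?P - sum half (insert p J)) G"
      proof (rule not_equivalent_to_effective[of _ J])
        show "divisor_on graph (witness - ?P - sum half (insert p J))" using on s(1) by (rule divisor_on_diff)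
        show "J \<subseteq> {k<..<g}" by fact
        fix i assume i: "i \<in> {1..k} \<union> J"
        then have i': "0 < i" using J by auto
        have "divisor_sum (coord i) (witness - ?P - sum half (insert p J)) =
           (if i \<le> k then 1/2 else 0) - (if i = p then 1/2 else 0) - (if i \<in> insert p J then 1/2 else 0)"
          using i' witness_basic(4)[of i] s(4)[of i] p by (simp add: divisor_sum_diff coord_def)
        also have "\<dots> = 1/2 \<or> \<dots> = - (1/2)" using i p J by auto
        finally show "divisor_sum (coord i) (witness - ?P - sum half (insert p J)) \<notin> \<int>"
          using half_not_int by (metis minus_in_Ints_iff)
      next
        have "sum att (insert p J) = 1/3"
          using pJ J p by (subst sum.insert) (auto simp: att_def intro!: sum.neutral)
        then have "divisor_sum (coord 0) (witness - ?P - sum half (insert p J)) - real k / 3 = - (2/3)"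
          unfolding divisor_sum_diff witness_basic(5) s(5) using p by (simp add: coord_def att_def)
        moreover have "(2/3 :: real) \<notin> \<int>"
          using Ints_unit_interval_eq[of "2/3" 0] by auto
        ultimately have "divisor_sum (coord 0) (witness - ?P - sum half (insert p J)) - real k / 3 \<notin> \<int>"
          by (metis minus_in_Ints_iff)
        moreover have "divisor_degree (witness - ?P - sum half (insert p J)) = int (k + card J)"
          using witness_basic(3) s(3) J pJ r1 by (simp add: divisor_degree_diff)
        ultimately show "divisor_degree (witness - ?P - sum half (insert p J)) < int (k + card J) \<or>
          divisor_degree (witness - ?P - sum half (insert p J)) = int (k + card J) \<and>
          divisor_sum (coord 0) (witness - ?P - sum half (insert p J)) - real k / 3 \<notin> \<int>" by blast
      qed (use G in auto)
    qed
  qed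
  then show ?thesis unfolding rank_at_least_def by blast
qed

lemma witness_free: "free_divisor graph witness" "rk graph witness = int r"
proof -
  have ge: "int r \<le> rk graph witness" using le_rk_iff[OF witness_basic(1)] witness_rank by simp
  have less: "rk graph (witness - Poly_Mapping.single P 1) < int r" if "P \<in> pts" for P
    using le_rk_iff[OF divisor_on_diff[OF witness_basic(1) divisor_on_single[of P graph 1]], of r] that
      witness_minus_point_rank[OF that] by simp
  show "free_divisor graph witness"
    unfolding free_divisor_def mspace_graph using witness_basic(1,2) less ge order.strict_trans2 by blast
  have "\<not> rank_at_least witness (Suc r)"
    using rank_at_least_Suc[of witness r "(0, 0)"] witness_minus_point_rank[of "(0, 0)"] origin_mem by auto
  then have "\<not> int (Suc r) \<le> rk graph witness" using le_rk_iff[OF witness_basic(1)] by blast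
  then show "rk graph witness = int r" using ge by simp
qed

end

theorem theorem2:
  fixes r d g :: int
  assumes "r \<ge> 1" and "d \<le> r + g - 2" and "d - 2 * r \<ge> 0"
  shows "\<exists>\<Gamma> :: (nat \<times> real) metric.
           metric_graph \<Gamma> \<and> genus \<Gamma> = g \<and>
           (\<exists>D. free_divisor \<Gamma> D \<and> divisor_degree D = d \<and> rk \<Gamma> D = r)"
proof -
  interpret two_attachments "nat g" "nat r" "nat (d - 2 * r)"
    by unfold_locales (use assms in auto)
  have "genus graph = g" using genus_graph assms by simp
  moreover have "divisor_degree witness = d" "rk graph witness = r"
    using witness_basic(3) witness_free(2) assms by auto
  ultimately show ?thesis using metric_graph_graph witness_free(1) by blast
qed

end
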